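(* Let $k_1>2$ be an even integer and let $r,s$ be positive integers of the same parity with $r+s\ge4$. Suppose that $r+s>k_1$. Then the sequence of maps $$0\longrightarrow H^0(\Gamma,\mathcal R\otimes P_{k_1-2}[X_1])\overset{\bar\iota}{\longrightarrow}\tilde M_c^{(2)}(\mathcal R)\overset{\bar\psi}{\longrightarrow}\tilde{\mathcal M}_{r,s}\otimes(S_{k_1}\oplus\overline S_{k_1})\longrightarrow0$$ is exact.
   Context: Let $\Gamma=\mathrm{SL}_2(\mathbb Z)$, $T=\left(\begin{smallmatrix}1&1\\0&1\end{smallmatrix}\right)$, $B=\{\pm T^n:n\in\mathbb Z\}$, $\mathfrak H$ the upper half-plane, $z=x+iy\in\mathfrak H$. For $\gamma=\left(\begin{smallmatrix}a&b\\c&d\end{smallmatrix}\right)\in\Gamma$ put $j(\gamma,z)=cz+d$, and similarly $j(\gamma,\bar z)$, $j(\gamma,X_1)$. Let $\mathcal R$ be the space of real-analytic functions $f:\mathfrak H\to\mathbb C$ such that, for some $C>0$, $f(z)=O(y^C)$ as $y\to\infty$, uniformly in $x$. The group $\Gamma$ acts on $\mathcal R$ on the right by $(f.\gamma)(z)=j(\gamma,z)^{-r}j(\gamma,\bar z)^{-s}f(\gamma z)$. Let $P_{k_1-2}=P_{k_1-2}[X_1]$ be the space of complex polynomials in $X_1$ of degree $\le k_1-2$, with the right action $(p.\gamma)(X_1)=p(\gamma X_1)j(\gamma,X_1)^{k_1-2}$. On $\mathcal R\otimes P_{k_1-2}$, $\Gamma$ acts by the tensor product of these actions, $$(f.\gamma)(z,X_1)=f(\gamma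 z,\gamma X_1)\,j(\gamma,z)^{-r}j(\gamma,\bar z)^{-s}j(\gamma,X_1)^{k_1-2}.$$ All actions are extended to $\mathbb C[\Gamma]$ by linearity, and $H^0(\Gamma,\cdot)$ denotes the subspace of $\Gamma$-invariant elements. Let $M_c^{(2)}(\mathcal R)$ be the space of $f\in\mathcal R\otimes P_{k_1-2}$ such that $f.(\gamma-1)\in H^0(\Gamma,\mathcal R)\otimes P_{k_1-2}$ for all $\gamma\in\Gamma$ and $f.\pi=f$ for all parabolic $\pi\in\Gamma$. The map $\bar\iota$ is induced by the inclusion of $H^0(\Gamma,\mathcal R\otimes P_{k_1-2})$ in $M_c^{(2)}(\mathcal R)$. Let $Z^1_c(\Gamma,P_{k_1-2})$ be the space of $1$-cocycles $\alpha:\Gamma\to P_{k_1-2}$ (i.e. $\alpha(\gamma\delta)=\alpha(\gamma).\delta+\alpha(\delta)$) with $\alpha(\pi)=0$ for all parabolic $\pi\in\Gamma$, let $B^1_c(\Gamma,P_{k_1-2})$ be the space of $1$-coboundaries with values in $P_{k_1-2}$ that vanish at all parabolic $\pi\in\Gamma$, and let $H^1_c(\Gamma,P_{k_1-2})=Z^1_c(\Gamma,P_{k_1-2})/B^1_c(\Gamma,P_{k_1-2})$. Fix a basis $\{u_i\}$ of $H^0(\Gamma,\mathcal R)$. For $f\in M_c^{(2)}(\mathcal R)$ write $f.(\gamma-1)=\sum_i\psi_i^f(\gamma)\otimes u_i$ with $\psi_i^f\in Z^1_c(\Gamma,P_{k_1-2})$. The assignment $f\mapsto\sum_i\psi_i^f\otimes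 u_i$, followed by the natural projection $Z^1_c\to H^1_c$, induces a map $$\bar\psi:M_c^{(2)}(\mathcal R)/(H^0(\Gamma,\mathcal R)\otimes P^c)\to H^0(\Gamma,\mathcal R)\otimes H^1_c(\Gamma,P_{k_1-2}),$$ where $P^c$ is the space of elements of $P_{k_1-2}$ invariant under all parabolic $\pi\in\Gamma$; since $k_1>2$, $P^c=H^0(\Gamma,P_{k_1-2})=0$. Let $\mathcal E_{r,s}(z)=\sum_{\gamma\in B\backslash\Gamma}j(\gamma,z)^{-r}j(\gamma,\bar z)^{-s}$, which lies in $H^0(\Gamma,\mathcal R)$, let $\tilde{\mathcal M}_{r,s}$ be the one-dimensional subspace of $H^0(\Gamma,\mathcal R)$ generated by $\mathcal E_{r,s}$, and set $$\tilde M_c^{(2)}(\mathcal R)=\bar\psi^{-1}\big(\tilde{\mathcal M}_{r,s}\otimes H^1_c(\Gamma,P_{k_1-2})\big).$$ $S_{k_1}$ is the space of holomorphic cusp forms of weight $k_1$ for $\Gamma$, $\overline S_{k_1}$ is the space of their complex conjugates, and $H^1_c(\Gamma,P_{k_1-2})$ is identified with $S_{k_1}\oplus\overline S_{k_1}$ by the Eichler–Shimura isomorphism.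
   Formalization: All parabolic π generate Γ, so literally H^1_c=0, not S⊕S̄ (k_1=12). Mended: π ranges over B, O(y^C) is uniform for bounded x, and P^c is the constants; the literal setting is also treated with H^1_c. S⊕S̄ enters through any linear isomorphism from H^1_c. *)

theory Defs
  imports
    "HOL-Complex_Analysis.Complex_Analysis"
    "HOL-Computational_Algebra.Polynomial"
    "HOL-Algebra.Product_Groups"
    "HOL-Library.Function_Algebras"
begin

section \<open>The modular group\<close>

definition SL2Z :: "(int^2^2) monoid" where
  "SL2Z = \<lparr>carrier = {A. det A = 1}, monoid.mult = (**), one = mat 1\<rparr>"

definition Tmat :: "int^2^2" where
  "Tmat = vector [vector [1, 1], vector [0, 1]]"

definition Bgrp :: "(int^2^2) set" where
  "Bgrp = {A. \<exists>n::int. A = Tmat [^]\<^bsub>SL2Z\<^esub> n \<or> A = - (Tmat [^]\<^bsub>SL2Z\<^esub> n)}"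

definition parabolics :: "(int^2^2) set" where
  "parabolics = {A \<in> carrier SL2Z. A \<noteq> mat 1 \<and> A \<noteq> - mat 1 \<and> \<bar>trace A\<bar> = 2}"

definition upper_half :: "complex set" where
  "upper_half = {z. Im z > 0}"

definition moebius :: "int^2^2 \<Rightarrow> complex \<Rightarrow> complex" where
  "moebius A z = (of_int (A$1$1) * z + of_int (A$1$2)) / (of_int (A$2$1) * z + of_int (A$2$2))"

definition jfac :: "int^2^2 \<Rightarrow> complex \<Rightarrow> complex" where
  "jfac A z = of_int (A$2$1) * z + of_int (A$2$2)"


section \<open>Function and polynomial spaces\<close>

text \<open>A function on the upper half-plane is a function on \<^typ>\<open>complex\<close> that vanishes off
  \<^const>\<open>upper_half\<close>. Likewise, a function on \<^const>\<open>SL2Z\<close> vanishes off its carrier.\<close>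

definition real_analytic_at :: "(complex \<Rightarrow> complex) \<Rightarrow> complex \<Rightarrow> bool" where
  "real_analytic_at f z0 \<longleftrightarrow>
     (\<exists>a e. e > 0 \<and>
        (\<forall>z\<in>ball z0 e.
           ((\<lambda>(m::nat, n::nat). a m n * of_real ((Re z - Re z0) ^ m * (Im z - Im z0) ^ n))
              has_sum f z) UNIV))"

text \<open>The bound \<open>f(z) = O(y\<^sup>C)\<close> is uniform in \<open>x\<close> over each member \<open>X\<close> of \<open>Xs\<close>: taking \<open>{UNIV}\<close> for \<open>Xs\<close>
  means uniformly over all real \<open>x\<close>, and taking the bounded sets means uniformly over bounded ranges
  of \<open>x\<close>. For functions of period 1 the two agree. They differ on \<open>\<R> \<otimes> P\<^sub>k\<^sub>-\<^sub>2\<close>, where invariance under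
  \<open>T\<close> means \<open>f(z + 1, X + 1) = f(z, X)\<close>, so that the coefficients of a \<open>T\<close>-invariant element of
  positive degree in \<open>X\<close> are unbounded in \<open>x\<close>.\<close>

definition Rspace :: "real set set \<Rightarrow> (complex \<Rightarrow> complex) set" where
  "Rspace Xs = {f. (\<forall>z. z \<notin> upper_half \<longrightarrow> f z = 0)
              \<and> (\<forall>z\<in>upper_half. real_analytic_at f z)
              \<and> (\<exists>C>0. \<forall>X\<in>Xs.
                   f \<in> O[inf (filtercomap Im at_top) (principal {z. Re z \<in> X})](\<lambda>z. of_real (Im z powr C)))}"

definition actR :: "nat \<Rightarrow> nat \<Rightarrow> int^2^2 \<Rightarrow> (complex \<Rightarrow> complex) \<Rightarrow> complex \<Rightarrow> complex" where
  "actR r s \<gamma> f = (\<lambda>z. f (moebius \<gamma> z) / (jfac \<gamma> z ^ r * jfac \<gamma> (cnj z) ^ s))"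

definition H0R :: "real set set \<Rightarrow> nat \<Rightarrow> nat \<Rightarrow> (complex \<Rightarrow> complex) set" where
  "H0R Xs r s = {f \<in> Rspace Xs. \<forall>\<gamma>\<in>carrier SL2Z. actR r s \<gamma> f = f}"

definition Ppoly :: "nat \<Rightarrow> complex poly set" where
  "Ppoly k = {p. degree p \<le> k - 2}"

text \<open>With \<open>\<gamma> = (a, b; c, d)\<close>, this is \<open>p(\<gamma>X) (cX + d)\<^sup>k\<^sup>-\<^sup>2\<close> with the denominators cleared,
  for \<open>p\<close> of degree at most \<open>k - 2\<close>.\<close>

definition actP :: "nat \<Rightarrow> int^2^2 \<Rightarrow> complex poly \<Rightarrow> complex poly" where
  "actP k \<gamma> p = (\<Sum>i\<le>k - 2. smult (coeff p i)
      ([:of_int (\<gamma>$1$2), of_int (\<gamma>$1$1):] ^ i * [:of_int (\<gamma>$2$2), of_int (\<gamma>$2$1):] ^ (k - 2 - i)))"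

definition Pc :: "(int^2^2) set \<Rightarrow> nat \<Rightarrow> complex poly set" where
  "Pc Par k = {p \<in> Ppoly k. \<forall>\<pi>\<in>Par. actP k \<pi> p = p}"


section \<open>Tensor products\<close>

definition addgrp :: "'a::ab_group_add set \<Rightarrow> 'a monoid" where
  "addgrp A = \<lparr>carrier = A, monoid.mult = (+), one = 0\<rparr>"

text \<open>Let \<open>V\<close> be a space of complex-valued functions and \<open>W\<close> a complex vector space with scalar
  multiplication \<open>sc\<close>. The tensor product \<open>V \<otimes> W\<close> is realised inside the \<open>W\<close>-valued functions by
  the canonical injection \<open>v \<otimes> w \<mapsto> (z \<mapsto> v(z) w)\<close>. As \<open>V\<close> is closed under scalars, the additive
  subgroup generated by the pure tensors is their linear span.\<close>

definition tensor ::
    "(complex \<Rightarrow> 'w \<Rightarrow> 'w) \<Rightarrow> (complex \<Rightarrow> complex) set \<Rightarrow> 'w monoid \<Rightarrow> (complex \<Rightarrow> 'w) monoid" where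
  "tensor sc V W = subgroup_generated (product_group UNIV (\<lambda>_. W))
      {F. \<exists>v\<in>V. \<exists>w\<in>carrier W. F = (\<lambda>z. sc (v z) w)}"

abbreviation tensorP ::
    "(complex \<Rightarrow> complex) set \<Rightarrow> complex poly set \<Rightarrow> (complex \<Rightarrow> complex poly) monoid" where
  "tensorP V P \<equiv> tensor smult V (addgrp P)"

definition actRP ::
    "nat \<Rightarrow> nat \<Rightarrow> nat \<Rightarrow> int^2^2 \<Rightarrow> (complex \<Rightarrow> complex poly) \<Rightarrow> complex \<Rightarrow> complex poly" where
  "actRP k r s \<gamma> F = (\<lambda>z. smult (1 / (jfac \<gamma> z ^ r * jfac \<gamma> (cnj z) ^ s)) (actP k \<gamma> (F (moebius \<gamma> z))))"

definition H0RP :: "real set set \<Rightarrow> nat \<Rightarrow> nat \<Rightarrow> nat \<Rightarrow> (complex \<Rightarrow> complex poly) set" where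
  "H0RP Xs k r s = {F \<in> carrier (tensorP (Rspace Xs) (Ppoly k)). \<forall>\<gamma>\<in>carrier SL2Z. actRP k r s \<gamma> F = F}"


section \<open>Second-order invariants and cohomology\<close>

text \<open>In what follows, \<open>Par\<close> is the set of elements \<open>\<pi>\<close> on which the conditions ``for all parabolic
  \<open>\<pi>\<close>'' are imposed. If \<open>Par\<close> is \<^const>\<open>parabolics\<close>, then cocycles vanishing on \<open>Par\<close> are zero,
  because the parabolic elements generate the modular group. The choice \<^const>\<open>Bgrp\<close> (the stabiliser
  of the cusp at infinity) gives the cohomology to which the Eichler-Shimura isomorphism applies;
  then \<^const>\<open>Pc\<close> consists of the constants.\<close>

definition Mc2 :: "real set set \<Rightarrow> (int^2^2) set \<Rightarrow> nat \<Rightarrow> nat \<Rightarrow> nat \<Rightarrow> (complex \<Rightarrow> complex poly) set" where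
  "Mc2 Xs Par k r s = {F \<in> carrier (tensorP (Rspace Xs) (Ppoly k)).
      (\<forall>\<gamma>\<in>carrier SL2Z. actRP k r s \<gamma> F - F \<in> carrier (tensorP (H0R Xs r s) (Ppoly k)))
    \<and> (\<forall>\<pi>\<in>Par. actRP k r s \<pi> F = F)}"

type_synonym cochain = "int^2^2 \<Rightarrow> complex poly"

definition Z1c :: "(int^2^2) set \<Rightarrow> nat \<Rightarrow> cochain set" where
  "Z1c Par k = {\<alpha>. (\<forall>\<gamma>. \<gamma> \<notin> carrier SL2Z \<longrightarrow> \<alpha> \<gamma> = 0)
    \<and> (\<forall>\<gamma>\<in>carrier SL2Z. \<alpha> \<gamma> \<in> Ppoly k)
    \<and> (\<forall>\<gamma>\<in>carrier SL2Z. \<forall>\<delta>\<in>carrier SL2Z. \<alpha> (\<gamma> ** \<delta>) = actP k \<delta> (\<alpha> \<gamma>) + \<alpha> \<delta>)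
    \<and> (\<forall>\<pi>\<in>Par. \<alpha> \<pi> = 0)}"

definition B1c :: "(int^2^2) set \<Rightarrow> nat \<Rightarrow> cochain set" where
  "B1c Par k = {\<alpha>. (\<exists>p\<in>Ppoly k. \<alpha> = (\<lambda>\<gamma>. if \<gamma> \<in> carrier SL2Z then actP k \<gamma> p - p else 0))
    \<and> (\<forall>\<pi>\<in>Par. \<alpha> \<pi> = 0)}"

definition H1c :: "(int^2^2) set \<Rightarrow> nat \<Rightarrow> cochain set monoid" where
  "H1c Par k = addgrp (Z1c Par k) Mod B1c Par k"

definition cscale :: "complex \<Rightarrow> cochain \<Rightarrow> cochain" where
  "cscale c \<alpha> = (\<lambda>\<gamma>. smult c (\<alpha> \<gamma>))"

text \<open>Adding \<^const>\<open>B1c\<close> matters only for the scalar \<open>0\<close>.\<close>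

definition H1scale :: "(int^2^2) set \<Rightarrow> nat \<Rightarrow> complex \<Rightarrow> cochain set \<Rightarrow> cochain set" where
  "H1scale Par k c K = {cscale c \<alpha> + \<beta> | \<alpha> \<beta>. \<alpha> \<in> K \<and> \<beta> \<in> B1c Par k}"

definition Mquot ::
    "real set set \<Rightarrow> (int^2^2) set \<Rightarrow> nat \<Rightarrow> nat \<Rightarrow> nat \<Rightarrow> (complex \<Rightarrow> complex poly) set monoid" where
  "Mquot Xs Par k r s = addgrp (Mc2 Xs Par k r s) Mod carrier (tensorP (H0R Xs r s) (Pc Par k))"

definition iota_bar ::
    "real set set \<Rightarrow> (int^2^2) set \<Rightarrow> nat \<Rightarrow> nat \<Rightarrow> nat \<Rightarrow> (complex \<Rightarrow> complex poly) \<Rightarrow> (complex \<Rightarrow> complex poly) set" where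
  "iota_bar Xs Par k r s F =
     carrier (tensorP (H0R Xs r s) (Pc Par k)) #>\<^bsub>addgrp (Mc2 Xs Par k r s)\<^esub> F"


section \<open>The map induced by the cocycle components\<close>

definition is_basis :: "(complex \<Rightarrow> complex) set \<Rightarrow> (complex \<Rightarrow> complex) set \<Rightarrow> bool" where
  "is_basis V U \<longleftrightarrow> \<not> module.dependent (\<lambda>c f z. c * f z) U \<and> module.span (\<lambda>c f z. c * f z) U = V"

definition psi_comp ::
    "(complex \<Rightarrow> complex) set \<Rightarrow> (int^2^2) set \<Rightarrow> nat \<Rightarrow> nat \<Rightarrow> nat
      \<Rightarrow> (complex \<Rightarrow> complex poly) \<Rightarrow> (complex \<Rightarrow> complex) \<Rightarrow> cochain" where
  "psi_comp U Par k r s F = (THE \<psi>.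
      finite {u. \<psi> u \<noteq> 0} \<and> {u. \<psi> u \<noteq> 0} \<subseteq> U
    \<and> (\<forall>u\<in>U. \<psi> u \<in> Z1c Par k)
    \<and> (\<forall>\<gamma>\<in>carrier SL2Z. actRP k r s \<gamma> F - F = (\<lambda>z. \<Sum>u | \<psi> u \<noteq> 0. smult (u z) (\<psi> u \<gamma>))))"

text \<open>The element \<open>\<Sum>\<^sub>i \<psi>\<^sub>i \<otimes> u\<^sub>i\<close> of \<open>H\<^sup>0 \<otimes> Z\<^sup>1\<^sub>c\<close>, as a function with values in \<^const>\<open>Z1c\<close>, and then its
  image in \<open>H\<^sup>0 \<otimes> H\<^sup>1\<^sub>c\<close> under the projection of the values to \<^const>\<open>H1c\<close>.\<close>

definition psi_cocycle ::
    "(complex \<Rightarrow> complex) set \<Rightarrow> (int^2^2) set \<Rightarrow> nat \<Rightarrow> nat \<Rightarrow> nat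
      \<Rightarrow> (complex \<Rightarrow> complex poly) \<Rightarrow> complex \<Rightarrow> cochain" where
  "psi_cocycle U Par k r s F = (\<lambda>z. \<Sum>u | psi_comp U Par k r s F u \<noteq> 0.
      cscale (u z) (psi_comp U Par k r s F u))"

definition psi_class ::
    "(complex \<Rightarrow> complex) set \<Rightarrow> (int^2^2) set \<Rightarrow> nat \<Rightarrow> nat \<Rightarrow> nat
      \<Rightarrow> (complex \<Rightarrow> complex poly) \<Rightarrow> complex \<Rightarrow> cochain set" where
  "psi_class U Par k r s F =
     (\<lambda>z. B1c Par k #>\<^bsub>addgrp (Z1c Par k)\<^esub> psi_cocycle U Par k r s F z)"

definition psi_bar ::
    "(complex \<Rightarrow> complex) set \<Rightarrow> (int^2^2) set \<Rightarrow> nat \<Rightarrow> nat \<Rightarrow> nat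
      \<Rightarrow> (complex \<Rightarrow> complex poly) set \<Rightarrow> complex \<Rightarrow> cochain set" where
  "psi_bar U Par k r s K = the_elem (psi_class U Par k r s ` K)"


section \<open>The Eisenstein series and its line\<close>

text \<open>Every coset \<open>B\<gamma>\<close> is mapped to the common value of the summand on it; this uses that
  \<open>r\<close> and \<open>s\<close> have the same parity.\<close>

definition Eis :: "nat \<Rightarrow> nat \<Rightarrow> complex \<Rightarrow> complex" where
  "Eis r s z = (if z \<in> upper_half
     then \<Sum>\<^sub>\<infinity>K\<in>rcosets\<^bsub>SL2Z\<^esub> Bgrp. the_elem ((\<lambda>\<gamma>. 1 / (jfac \<gamma> z ^ r * jfac \<gamma> (cnj z) ^ s)) ` K)
     else 0)"

definition Mtilde_line :: "nat \<Rightarrow> nat \<Rightarrow> (complex \<Rightarrow> complex) set" where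
  "Mtilde_line r s = {f. \<exists>c. f = (\<lambda>z. c * Eis r s z)}"

definition target ::
    "(int^2^2) set \<Rightarrow> nat \<Rightarrow> nat \<Rightarrow> nat \<Rightarrow> (complex \<Rightarrow> cochain set) monoid" where
  "target Par k r s = tensor (H1scale Par k) (Mtilde_line r s) (H1c Par k)"

definition Mc2_tilde ::
    "(complex \<Rightarrow> complex) set \<Rightarrow> real set set \<Rightarrow> (int^2^2) set \<Rightarrow> nat \<Rightarrow> nat \<Rightarrow> nat
      \<Rightarrow> (complex \<Rightarrow> complex poly) set monoid" where
  "Mc2_tilde U Xs Par k r s = (Mquot Xs Par k r s)
     \<lparr>carrier := {K \<in> carrier (Mquot Xs Par k r s). psi_bar U Par k r s K \<in> carrier (target Par k r s)}\<rparr>"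


section \<open>Cusp forms\<close>

definition cusp_forms :: "nat \<Rightarrow> (complex \<Rightarrow> complex) set" where
  "cusp_forms k = {f. f holomorphic_on upper_half
    \<and> (\<forall>z. z \<notin> upper_half \<longrightarrow> f z = 0)
    \<and> (\<forall>\<gamma>\<in>carrier SL2Z. \<forall>z\<in>upper_half. f (moebius \<gamma> z) = jfac \<gamma> z ^ k * f z)
    \<and> (f \<longlongrightarrow> 0) (filtercomap Im at_top)}"

definition conj_cusp_forms :: "nat \<Rightarrow> (complex \<Rightarrow> complex) set" where
  "conj_cusp_forms k = (\<lambda>f z. cnj (f z)) ` cusp_forms k"

definition SSbar :: "nat \<Rightarrow> ((complex \<Rightarrow> complex) \<times> (complex \<Rightarrow> complex)) monoid" where
  "SSbar k = addgrp (cusp_forms k \<times> conj_cusp_forms k)"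

definition SSscale ::
    "complex \<Rightarrow> (complex \<Rightarrow> complex) \<times> (complex \<Rightarrow> complex) \<Rightarrow> (complex \<Rightarrow> complex) \<times> (complex \<Rightarrow> complex)" where
  "SSscale c = (\<lambda>(f, g). (\<lambda>z. c * f z, \<lambda>z. c * g z))"

definition linear_iso ::
    "(complex \<Rightarrow> 'v \<Rightarrow> 'v) \<Rightarrow> 'v monoid \<Rightarrow> (complex \<Rightarrow> 'w \<Rightarrow> 'w) \<Rightarrow> 'w monoid \<Rightarrow> ('v \<Rightarrow> 'w) \<Rightarrow> bool" where
  "linear_iso scV V scW W h \<longleftrightarrow> h \<in> iso V W \<and> (\<forall>c. \<forall>v\<in>carrier V. h (scV c v) = scW c (h v))"


section \<open>Exactness\<close>

text \<open>Exactness of \<open>0 \<rightarrow> G\<^sub>1 \<rightarrow> G\<^sub>2 \<rightarrow> G\<^sub>3 \<rightarrow> 0\<close>. The sequences in \<open>HOL-Algebra.Exact_Sequence\<close> have all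
  their terms over one type.\<close>

definition short_exact ::
    "'a monoid \<Rightarrow> ('a \<Rightarrow> 'b) \<Rightarrow> 'b monoid \<Rightarrow> ('b \<Rightarrow> 'c) \<Rightarrow> 'c monoid \<Rightarrow> bool" where
  "short_exact G1 f G2 g G3 \<longleftrightarrow>
     group_hom G1 G2 f \<and> group_hom G2 G3 g
     \<and> inj_on f (carrier G1)
     \<and> f ` carrier G1 = kernel G2 G3 g
     \<and> g ` carrier G2 = carrier G3"

end

theory Submission
  imports Defs
begin

text \<open>
  Exactness rests on the cochain \<open>A \<mapsto> (F.(A - 1))(z)\<close> (\<open>defect\<close>). For a second-order invariant \<open>F\<close> it is a
  cocycle at each point \<open>z\<close>, and it is the value at \<open>z\<close> of \<open>\<Sum>\<^sub>i \<psi>\<^sub>i \<otimes> u\<^sub>i\<close>, so the map \<open>\<psi>\<close> sends \<open>F\<close> to the family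
  of the classes of these cocycles (\<open>psi_cocycle_eq\<close>).

  Injectivity on the left: an invariant element of \<open>H\<^sup>0 \<otimes> P\<^sup>c\<close> has at each point a polynomial value that is fixed
  by the group, and for \<open>k > 2\<close> only \<open>0\<close> is fixed (\<open>actP_invariant_zero\<close>). Exactness in the middle: if
  all these cocycles are coboundaries, they are coboundaries of constants \<open>c(z)\<close>; evaluation at \<open>S\<close> shows that
  the function \<open>c\<close> lies in \<open>H\<^sup>0\<close>, and \<open>F - c\<close> is invariant (\<open>kernel_correction\<close>).

  Surjectivity: let \<open>\<alpha>\<close> be a cocycle that vanishes on the stabiliser \<open>B\<close> of the cusp. The Poincare series
  \<open>F(z) = - \<Sum> \<alpha>(\<gamma>) j(\<gamma>, z)\<^sup>-\<^sup>r j(\<gamma>, z\<^sup>*)\<^sup>-\<^sup>s\<close> over \<open>B\<close>-cosets, where \<open>z\<^sup>*\<close> is the conjugate of \<open>z\<close>, satisfies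
  \<open>F.(A - 1) = \<alpha>(A) E\<close>, where \<open>E\<close> is the Eisenstein series, by the cocycle relation (\<open>poincare_poly_cobounds\<close>).
  Convergence needs a sharp bound on \<open>\<alpha>\<close>. Following the Euclidean algorithm on the bottom row \<open>(c, d)\<close> one
  finds that \<open>\<alpha>(\<gamma>) = O(\<bar>(c, d)\<bar>\<^sup>k\<^sup>-\<^sup>2)\<close> (\<open>cocycle_growth\<close>). The terms are \<open>O(\<bar>(c, d)\<bar>\<^sup>k\<^sup>-\<^sup>2\<^sup>-\<^sup>r\<^sup>-\<^sup>s)\<close>, and since
  \<open>k\<close> and \<open>r + s\<close> are even, \<open>r + s > k\<close> makes the exponent at most \<open>-4\<close>. The series is bounded for \<open>y \<ge> 1\<close> and
  bounded \<open>x\<close>. It is real analytic because its terms have expansions in \<open>x\<close> and \<open>y\<close> on a common square whose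
  absolutely convergent norms are summable (\<open>ps_norm_le_infsum\<close>). If instead the cocycles vanish on all
  parabolic elements, then they are zero, because these elements generate the group, and surjectivity is trivial.

  The second sequence arises from the first by applying the Eichler-Shimura isomorphism pointwise.
\<close>

(* The infix $ stands for matrix entries only. *)
unbundle no fps_syntax
no_notation fps_nth (infixl "$" 75)

section \<open>The modular group\<close>

abbreviation mat2 :: "int \<Rightarrow> int \<Rightarrow> int \<Rightarrow> int \<Rightarrow> int^2^2" where
  "mat2 a b c d \<equiv> vector [vector [a, b], vector [c, d]]"

lemma mat2_eq_iff:
  "(A :: int^2^2) = B \<longleftrightarrow> A$1$1 = B$1$1 \<and> A$1$2 = B$1$2 \<and> A$2$1 = B$2$1 \<and> A$2$2 = B$2$2"
  by (simp only: vec_eq_iff forall_2 conj_assoc)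

lemma mat2_mult_nth [simp]:
  "((A :: int^2^2) ** B) $ i $ j = A$i$1 * B$1$j + A$i$2 * B$2$j"
  by (simp add: matrix_matrix_mult_def sum_2)

lemma mat_1_nth [simp]:
  "(mat 1 :: int^2^2) $ 1 $ 1 = 1" "(mat 1 :: int^2^2) $ 1 $ 2 = 0"
  "(mat 1 :: int^2^2) $ 2 $ 1 = 0" "(mat 1 :: int^2^2) $ 2 $ 2 = 1"
  by (simp_all add: mat_def)

lemma SL2Z_iff: "A \<in> carrier SL2Z \<longleftrightarrow> A$1$1 * A$2$2 - A$1$2 * A$2$1 = 1"
  by (simp add: SL2Z_def det_2)

lemma mult_SL2Z [simp]: "x \<otimes>\<^bsub>SL2Z\<^esub> y = x ** y"
  by (simp add: SL2Z_def)

lemma one_SL2Z [simp]: "\<one>\<^bsub>SL2Z\<^esub> = mat 1"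
  by (simp add: SL2Z_def)

lemma SL2Z_mult: "A \<in> carrier SL2Z \<Longrightarrow> B \<in> carrier SL2Z \<Longrightarrow> A ** B \<in> carrier SL2Z"
  by (simp add: SL2Z_def det_mul)

lemma group_SL2Z: "group SL2Z"
proof (rule groupI)
  fix A assume A: "A \<in> carrier SL2Z"
  show "\<exists>B\<in>carrier SL2Z. B \<otimes>\<^bsub>SL2Z\<^esub> A = \<one>\<^bsub>SL2Z\<^esub>"
    by (rule bexI[where x = "mat2 (A$2$2) (- (A$1$2)) (- (A$2$1)) (A$1$1)"])
       (use A in \<open>auto simp: SL2Z_iff mat2_eq_iff algebra_simps\<close>)
qed (use SL2Z_mult in \<open>auto simp: matrix_mul_assoc\<close>, simp add: SL2Z_iff)

lemma Tmat_SL2Z: "Tmat \<in> carrier SL2Z"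
  by (simp add: Tmat_def SL2Z_iff)

lemma Tmat_power: "Tmat [^]\<^bsub>SL2Z\<^esub> (n :: int) = mat2 1 n 0 1"
proof -
  interpret group SL2Z by (rule group_SL2Z)
  have nat: "Tmat [^]\<^bsub>SL2Z\<^esub> m = mat2 1 (int m) 0 1" for m :: nat
    by (induction m) (auto simp: mat2_eq_iff Tmat_def)
  show ?thesis
  proof (cases n)
    case (nonneg m)
    thus ?thesis by (simp add: int_pow_int nat)
  next
    case (neg m)
    have "mat2 1 n 0 1 \<otimes>\<^bsub>SL2Z\<^esub> Tmat [^]\<^bsub>SL2Z\<^esub> (Suc m) = \<one>\<^bsub>SL2Z\<^esub>"
      by (subst nat) (auto simp: mat2_eq_iff neg)
    hence "inv\<^bsub>SL2Z\<^esub> (Tmat [^]\<^bsub>SL2Z\<^esub> (Suc m)) = mat2 1 n 0 1"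
      by (intro inv_equality) (use nat_pow_closed[OF Tmat_SL2Z, of "Suc m"] in \<open>auto simp del: nat_pow_Suc mult_SL2Z\<close>,
        simp add: SL2Z_iff)
    thus ?thesis
      using int_pow_neg_int[OF Tmat_SL2Z, of "Suc m"] by (simp add: neg del: nat_pow_Suc)
  qed
qed

text \<open>The matrices \<open>\<plusminus>T\<^sup>n\<close> form the stabiliser of the cusp at infinity; described by the vanishing of
  the lower left entry, membership becomes a computation with entries.\<close>
lemma Bgrp_iff: "A \<in> Bgrp \<longleftrightarrow> A \<in> carrier SL2Z \<and> A$2$1 = 0"
proof
  assume "A \<in> Bgrp"
  thus "A \<in> carrier SL2Z \<and> A$2$1 = 0"
    by (auto simp: Bgrp_def Tmat_power SL2Z_iff)
next
  assume A: "A \<in> carrier SL2Z \<and> A$2$1 = 0"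
  hence "A$1$1 * A$2$2 = 1" unfolding SL2Z_iff by fastforce
  hence "A$1$1 = 1 \<and> A$2$2 = 1 \<or> A$1$1 = -1 \<and> A$2$2 = -1"
    by (simp add: zmult_eq_1_iff)
  thus "A \<in> Bgrp"
  proof
    assume "A$1$1 = 1 \<and> A$2$2 = 1"
    hence "A = Tmat [^]\<^bsub>SL2Z\<^esub> (A$1$2)" using A by (simp add: Tmat_power mat2_eq_iff)
    thus ?thesis unfolding Bgrp_def by blast
  next
    assume "A$1$1 = -1 \<and> A$2$2 = -1"
    hence "A = - (Tmat [^]\<^bsub>SL2Z\<^esub> (- A$1$2))" using A by (simp add: Tmat_power mat2_eq_iff)
    thus ?thesis unfolding Bgrp_def by blast
  qed
qed

lemma Tmat_Bgrp: "Tmat \<in> Bgrp"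
  by (simp add: Bgrp_iff Tmat_SL2Z) (simp add: Tmat_def)

lemma Tmat_parabolic: "Tmat \<in> parabolics"
  by (simp add: parabolics_def Tmat_SL2Z) (simp add: Tmat_def trace_def sum_2 mat2_eq_iff)

lemma subgroup_Bgrp: "subgroup Bgrp SL2Z"
proof -
  interpret group SL2Z by (rule group_SL2Z)
  show ?thesis
  proof (rule subgroupI)
    fix A assume A: "A \<in> Bgrp"
    have "inv\<^bsub>SL2Z\<^esub> A = mat2 (A$2$2) (- (A$1$2)) 0 (A$1$1)"
      by (rule inv_equality) (use A in \<open>auto simp: Bgrp_iff SL2Z_iff mat2_eq_iff algebra_simps\<close>)
    thus "inv\<^bsub>SL2Z\<^esub> A \<in> Bgrp" using A by (simp add: Bgrp_iff SL2Z_iff algebra_simps)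
  next
    show "Bgrp \<noteq> {}" using Tmat_Bgrp by blast
  qed (auto simp: Bgrp_iff SL2Z_mult)
qed


definition Smat :: "int^2^2" where
  "Smat = mat2 0 (-1) 1 0"

lemma Smat_SL2Z: "Smat \<in> carrier SL2Z"
  by (simp add: Smat_def SL2Z_iff)

text \<open>The bottom row \<open>(c, d)\<close> determines the coset of a matrix modulo powers of \<open>T\<close> acting on the left,
  so its squared length measures cosets. Being an integer, it can serve as an induction measure.\<close>
definition row_norm :: "int^2^2 \<Rightarrow> int" where
  "row_norm A = (A$2$1)\<^sup>2 + (A$2$2)\<^sup>2"

lemma row_norm_pos:
  assumes "A \<in> carrier SL2Z"
  shows "row_norm A \<ge> 1"
proof -
  have "A$2$1 \<noteq> 0 \<or> A$2$2 \<noteq> 0" using assms by (auto simp: SL2Z_iff)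
  hence "row_norm A > 0" by (auto simp: row_norm_def sum_power2_gt_zero_iff)
  thus ?thesis by simp
qed

text \<open>Multiplying by \<open>T\<^sup>n\<close> on the left adds \<open>n\<close> times the bottom row to the top row, and \<open>S\<close> then exchanges
  the rows. Choose \<open>n\<close> so that the scalar product \<open>t\<close> of the rows satisfies \<open>2\<bar>t\<bar> \<le> N\<close>, where \<open>N\<close> is the
  squared length of the bottom row. As the determinant is \<open>1\<close>, Lagrange's identity says that the squared
  length \<open>M\<close> of the new bottom row satisfies \<open>M N = t\<^sup>2 + 1\<close>. Hence \<open>M \<le> N/4 + 1/N \<le> N/2\<close> if \<open>N \<ge> 2\<close>;
  if \<open>N = 1\<close>, the translated rows are orthogonal unit vectors, and the old or the new bottom row is \<open>(0, \<plusminus>1)\<close>.\<close>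
lemma euclid_step:
  assumes A: "A \<in> carrier SL2Z"
  obtains n A1 where "A1 = mat2 1 n 0 1 ** A" "A1 \<in> carrier SL2Z" "Smat ** A1 \<in> carrier SL2Z"
    "row_norm (Smat ** A1) \<le> row_norm A"
    "2 * row_norm (Smat ** A1) \<le> row_norm A \<or> row_norm A = 1 \<and> (Smat ** A1)$2$1 * A$2$1 = 0"
proof -
  define a b c d where "a = A$1$1" "b = A$1$2" "c = A$2$1" "d = A$2$2"
  note abcd = this
  have det: "a * d - b * c = 1" using A by (simp add: SL2Z_iff abcd)
  define N where "N = row_norm A"
  have N: "N = c\<^sup>2 + d\<^sup>2" by (simp add: N_def row_norm_def abcd)
  have N1: "N \<ge> 1" using row_norm_pos[OF A] by (simp add: N_def)
  \<comment> \<open>the integer nearest to \<open>- (a c + b d) / N\<close>\<close>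
  define n where "n = - ((2 * (a * c + b * d) + N) div (2 * N))"
  define t where "t = (a * c + b * d) + n * N"
  have "2 * t = (2 * (a * c + b * d) + N) mod (2 * N) - N"
    unfolding t_def n_def
    using minus_mult_div_eq_mod[of "2 * (a * c + b * d) + N" "2 * N"] by (simp add: algebra_simps)
  moreover have "0 \<le> (2 * (a * c + b * d) + N) mod (2 * N)" "(2 * (a * c + b * d) + N) mod (2 * N) < 2 * N"
    using N1 by auto
  ultimately have "\<bar>2 * t\<bar> \<le> N" by linarith
  hence t4: "4 * t\<^sup>2 \<le> N\<^sup>2" using power2_le_iff_abs_le[of N "2*t"] N1 by (simp add: power_mult_distrib)
  define a' b' where "a' = a + n * c" "b' = b + n * d"
  note ab' = this
  define A1 where "A1 = mat2 1 n 0 1 ** A"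
  have A1: "A1 \<in> carrier SL2Z" unfolding A1_def by (rule SL2Z_mult[OF _ A]) (simp add: SL2Z_iff)
  have S1: "Smat ** A1 \<in> carrier SL2Z" by (rule SL2Z_mult[OF Smat_SL2Z A1])
  define M where "M = row_norm (Smat ** A1)"
  have M: "M = a'\<^sup>2 + b'\<^sup>2"
    by (simp add: M_def row_norm_def Smat_def A1_def ab' abcd)
  have det': "a' * d - b' * c = 1" using det by (simp add: ab' algebra_simps)
  have t': "t = a' * c + b' * d" by (simp add: t_def ab' N algebra_simps power2_eq_square)
  have "M * N = t\<^sup>2 + (a' * d - b' * c)\<^sup>2"
    unfolding M N t' by algebra
  hence MN: "M * N = t\<^sup>2 + 1" by (simp add: det')
  have M1: "M \<ge> 1" using row_norm_pos[OF S1] by (simp add: M_def)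
  have disj: "2 * M \<le> N \<or> N = 1 \<and> M = 1 \<and> t = 0"
  proof (cases "N = 1")
    case True
    hence "4 * t\<^sup>2 \<le> 1" using t4 by simp
    hence "t\<^sup>2 \<le> 0" by linarith
    hence "t = 0" by simp
    thus ?thesis using True MN by simp
  next
    case False
    hence "N \<ge> 2" using N1 by simp
    hence "N\<^sup>2 \<ge> 4" using power_mono[of 2 N 2] by simp
    hence "4 * (M * N) \<le> 2 * N\<^sup>2" using t4 MN by simp
    hence "(2 * M) * N \<le> N * N" by (simp add: power2_eq_square)
    thus ?thesis using \<open>N \<ge> 2\<close> by (simp add: mult_le_cancel_right)
  qed
  have "a' * c = 0" if h: "N = 1" "t = 0"
  proof (cases "c = 0")
    case False
    have "c\<^sup>2 \<ge> 1" using False by (simp add: int_one_le_iff_zero_less)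
    moreover have "d\<^sup>2 \<ge> 0" by simp
    ultimately have "d\<^sup>2 = 0" using h N by linarith
    hence "d = 0" by simp
    thus ?thesis using h t' by simp
  qed simp
  hence "2 * M \<le> N \<or> N = 1 \<and> a' * c = 0" using disj by blast
  moreover have "M \<le> N" using disj M1 by auto
  moreover have "(Smat ** A1)$2$1 = a'" by (simp add: Smat_def A1_def ab' abcd)
  ultimately show ?thesis
    using that[OF A1_def A1 S1] by (simp add: M_def N_def abcd)
qed

text \<open>The Euclidean algorithm as an induction rule. That \<open>row_norm\<close> is halved, and does not merely decrease,
  is what makes the resulting estimate of cocycles sharp.\<close>
lemma SL2Z_euclid_induct [consumes 1, case_names Bgrp step]:
  assumes "A \<in> carrier SL2Z"
    and B: "\<And>A. A \<in> Bgrp \<Longrightarrow> P A"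
    and step: "\<And>A A1 n. A \<in> carrier SL2Z \<Longrightarrow> A1 \<in> carrier SL2Z \<Longrightarrow> A1 = mat2 1 n 0 1 ** A \<Longrightarrow>
      row_norm (Smat ** A1) \<le> row_norm A \<Longrightarrow>
      2 * row_norm (Smat ** A1) \<le> row_norm A \<or> Smat ** A1 \<in> Bgrp \<Longrightarrow> P (Smat ** A1) \<Longrightarrow> P A"
  shows "P A"
  using assms(1)
proof (induction "nat (row_norm A)" arbitrary: A rule: less_induct)
  case less
  show ?case
  proof (cases "A \<in> Bgrp")
    case False
    obtain n A1 where A1: "A1 = mat2 1 n 0 1 ** A" "A1 \<in> carrier SL2Z" "Smat ** A1 \<in> carrier SL2Z"
      "row_norm (Smat ** A1) \<le> row_norm A"
      "2 * row_norm (Smat ** A1) \<le> row_norm A \<or> row_norm A = 1 \<and> (Smat ** A1)$2$1 * A$2$1 = 0"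
      using euclid_step[OF less.prems] by metis
    have "A$2$1 \<noteq> 0" using False less.prems by (simp add: Bgrp_iff)
    hence d: "2 * row_norm (Smat ** A1) \<le> row_norm A \<or> Smat ** A1 \<in> Bgrp"
      using A1(3,5) unfolding Bgrp_iff mult_eq_0_iff by blast
    have "P (Smat ** A1)"
      using d
    proof
      assume "2 * row_norm (Smat ** A1) \<le> row_norm A"
      thus ?thesis using row_norm_pos[OF A1(3)] by (intro less.hyps A1) linarith
    qed (rule B)
    thus ?thesis using step[OF less.prems A1(2,1,4) d] by blast
  qed (rule B)
qed

text \<open>The elements \<open>S\<close> and \<open>T\<close> generate the group. The statement speaks of a set closed under products and
  inverses, as the zero sets of cocycles are.\<close>
lemma SL2Z_generated:
  assumes "A \<in> carrier SL2Z"
    and "M \<subseteq> carrier SL2Z" "Tmat \<in> M" "Smat \<in> M"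
    and mult: "\<And>A B. A \<in> M \<Longrightarrow> B \<in> M \<Longrightarrow> A ** B \<in> M"
    and inv: "\<And>A B. A \<in> M \<Longrightarrow> B \<in> carrier SL2Z \<Longrightarrow> B ** A = mat 1 \<Longrightarrow> B \<in> M"
  shows "A \<in> M"
proof -
  have inv_S: "mat2 0 1 (-1) 0 ** Smat = mat 1"
    by (simp add: mat2_eq_iff Smat_def)
  have "mat2 0 1 (-1) 0 \<in> M"
    by (rule inv[OF \<open>Smat \<in> M\<close> _ inv_S]) (simp add: SL2Z_iff)
  from mult[OF this \<open>Smat \<in> M\<close>] have one: "mat 1 \<in> M"
    by (simp only: inv_S)
  have nat: "mat2 1 (int n) 0 1 \<in> M" for n
  proof (induction n)
    case 0
    have "mat2 1 0 0 1 = mat 1" by (simp add: mat2_eq_iff)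
    thus ?case using one by simp
  next
    case (Suc n)
    have "mat2 1 (int (Suc n)) 0 1 = mat2 1 (int n) 0 1 ** Tmat" by (simp add: mat2_eq_iff Tmat_def)
    thus ?case using mult[OF Suc \<open>Tmat \<in> M\<close>] by simp
  qed
  have T: "mat2 1 n 0 1 \<in> M" for n
  proof (cases "n \<ge> 0")
    case True
    thus ?thesis using nat[of "nat n"] by simp
  next
    case False
    show ?thesis
      by (rule inv[OF nat[of "nat (- n)"]]) (use False in \<open>auto simp: SL2Z_iff mat2_eq_iff\<close>)
  qed
  have "- mat 1 = Smat ** Smat" by (simp add: mat2_eq_iff Smat_def)
  hence neg1: "- mat 1 \<in> M" using mult[OF \<open>Smat \<in> M\<close> \<open>Smat \<in> M\<close>] by (simp only:)
  have B: "A \<in> M" if A: "A \<in> Bgrp" for A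
  proof -
    obtain n where "A = mat2 1 n 0 1 \<or> A = - mat2 1 n 0 1"
      using A by (auto simp: Bgrp_def Tmat_power)
    moreover have "- mat2 1 n 0 1 = - mat 1 ** mat2 1 n 0 1" by (simp add: mat2_eq_iff)
    ultimately show ?thesis using mult[OF neg1 T, of n] T[of n] by auto
  qed
  show ?thesis
    using assms(1)
  proof (induction A rule: SL2Z_euclid_induct)
    case (Bgrp A)
    thus ?case by (rule B)
  next
    case (step A A1 n)
    have "Smat ** (Smat ** (Smat ** (Smat ** A1))) \<in> M" by (intro mult assms(4) step)
    moreover have "Smat ** (Smat ** (Smat ** (Smat ** A1))) = A1" by (simp add: mat2_eq_iff Smat_def)
    ultimately have "mat2 1 (- n) 0 1 ** A1 \<in> M" using mult[OF T] by simp
    moreover have "mat2 1 (- n) 0 1 ** A1 = A" using step(3) by (simp add: mat2_eq_iff algebra_simps)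
    ultimately show ?case by simp
  qed
qed

text \<open>\<open>S = T\<^sup>-\<^sup>1 V T\<^sup>-\<^sup>1\<close>, where \<open>V\<close> is the transpose of \<open>T\<close>, is a product of parabolic elements.\<close>
lemma parabolics_generate:
  assumes "A \<in> carrier SL2Z"
    and "M \<subseteq> carrier SL2Z" "parabolics \<subseteq> M"
    and mult: "\<And>A B. A \<in> M \<Longrightarrow> B \<in> M \<Longrightarrow> A ** B \<in> M"
    and inv: "\<And>A B. A \<in> M \<Longrightarrow> B \<in> carrier SL2Z \<Longrightarrow> B ** A = mat 1 \<Longrightarrow> B \<in> M"
  shows "A \<in> M"
proof (rule SL2Z_generated[OF assms(1,2) _ _ mult inv])
  show "Tmat \<in> M" using Tmat_parabolic assms(3) by blast
  have "mat2 1 (-1) 0 1 \<in> M" "mat2 1 0 1 1 \<in> M"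
    using assms(3) by (auto simp: parabolics_def SL2Z_iff trace_def sum_2 mat2_eq_iff)
  hence "mat2 1 (-1) 0 1 ** mat2 1 0 1 1 ** mat2 1 (-1) 0 1 \<in> M" by (intro mult)
  also have "mat2 1 (-1) 0 1 ** mat2 1 0 1 1 ** mat2 1 (-1) 0 1 = Smat"
    by (simp add: mat2_eq_iff Smat_def)
  finally show "Smat \<in> M" .
qed auto


section \<open>The actions on functions and polynomials\<close>

lemma jfac_cnj: "jfac A (cnj z) = cnj (jfac A z)"
  by (simp add: jfac_def)

lemma Im_moebius:
  assumes "A \<in> carrier SL2Z"
  shows "Im (moebius A z) = Im z / (cmod (jfac A z))\<^sup>2"
proof -
  have "real_of_int (A$1$1 * A$2$2 - A$1$2 * A$2$1) = 1"
    using assms unfolding SL2Z_iff by (simp only: of_int_1)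
  hence "of_int (A$1$1) * of_int (A$2$2) - of_int (A$1$2) * of_int (A$2$1) = (1 :: real)"
    by simp
  hence "Im z * (of_int (A$1$1) * of_int (A$2$2) - of_int (A$1$2) * of_int (A$2$1)) = Im z"
    by simp
  hence "Im z = of_int (A$1$1) * Im z * (of_int (A$2$1) * Re z + of_int (A$2$2)) -
      (of_int (A$1$1) * Re z + of_int (A$1$2)) * (of_int (A$2$1) * Im z)"
    by (simp add: algebra_simps)
  thus ?thesis
    by (simp add: moebius_def jfac_def Im_divide cmod_power2 add.commute)
qed

lemma jfac_nonzero:
  assumes "A \<in> carrier SL2Z" "Im z \<noteq> 0"
  shows "jfac A z \<noteq> 0"
proof
  assume "jfac A z = 0"
  hence "Im (jfac A z) = 0" "Re (jfac A z) = 0" by simp_all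
  hence "A$2$1 = 0" "A$2$2 = 0" using assms(2) by (auto simp: jfac_def)
  thus False using assms(1) by (simp add: SL2Z_iff)
qed

lemma moebius_upper_half_iff:
  assumes "A \<in> carrier SL2Z"
  shows "moebius A z \<in> upper_half \<longleftrightarrow> z \<in> upper_half"
proof (cases "Im z = 0")
  case False
  hence "cmod (jfac A z) > 0" using jfac_nonzero[OF assms] by simp
  thus ?thesis using assms by (simp add: upper_half_def Im_moebius zero_less_divide_iff)
qed (use assms in \<open>simp add: upper_half_def Im_moebius\<close>)

lemma jfac_mult:
  assumes "B \<in> carrier SL2Z" "Im z \<noteq> 0"
  shows "jfac (A ** B) z = jfac A (moebius B z) * jfac B z"
  using jfac_nonzero[OF assms] by (simp add: jfac_def moebius_def field_simps)

lemma moebius_mult: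
  assumes "A \<in> carrier SL2Z" "B \<in> carrier SL2Z" "Im z \<noteq> 0"
  shows "moebius (A ** B) z = moebius A (moebius B z)"
proof -
  have eq: "moebius B z * jfac B z = of_int (B$1$1) * z + of_int (B$1$2)"
    using jfac_nonzero[OF assms(2,3)] by (simp add: moebius_def jfac_def)
  have "(of_int (A$1$1) * moebius B z + of_int (A$1$2)) * jfac B z =
      of_int (A$1$1) * (of_int (B$1$1) * z + of_int (B$1$2)) + of_int (A$1$2) * jfac B z"
    unfolding eq[symmetric] by (simp add: algebra_simps)
  also have "\<dots> = of_int ((A ** B)$1$1) * z + of_int ((A ** B)$1$2)"
    by (simp add: jfac_def algebra_simps)
  finally have "moebius (A ** B) z =
      (of_int (A$1$1) * moebius B z + of_int (A$1$2)) * jfac B z / jfac (A ** B) z"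
    by (simp add: moebius_def jfac_def)
  also have "\<dots> = (of_int (A$1$1) * moebius B z + of_int (A$1$2)) / jfac A (moebius B z)"
    using jfac_nonzero[OF assms(2,3)] by (simp add: jfac_mult[OF assms(2,3)])
  finally show ?thesis by (simp add: moebius_def jfac_def)
qed

text \<open>The automorphy factor of bi-weight \<open>(r, s)\<close>.\<close>
definition aut_factor :: "nat \<Rightarrow> nat \<Rightarrow> int^2^2 \<Rightarrow> complex \<Rightarrow> complex" where
  "aut_factor r s A z = jfac A z ^ r * jfac A (cnj z) ^ s"

lemma aut_factor_mult:
  assumes "B \<in> carrier SL2Z" "Im z \<noteq> 0"
  shows "aut_factor r s (A ** B) z = aut_factor r s A (moebius B z) * aut_factor r s B z"
  by (simp add: aut_factor_def jfac_cnj jfac_mult[OF assms] power_mult_distrib)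

lemma actR_aut_factor: "actR r s A f = (\<lambda>z. f (moebius A z) / aut_factor r s A z)"
  by (simp add: actR_def aut_factor_def)

lemma actRP_aut_factor: "actRP k r s A F = (\<lambda>z. smult (1 / aut_factor r s A z) (actP k A (F (moebius A z))))"
  by (simp add: actRP_def aut_factor_def)


text \<open>The matrix of the action on polynomials with respect to the monomials. It reduces statements about
  polynomial-valued functions to statements about their coefficients.\<close>
definition actP_coeff :: "nat \<Rightarrow> int^2^2 \<Rightarrow> nat \<Rightarrow> nat \<Rightarrow> complex" where
  "actP_coeff k A i j = coeff ([:of_int (A$1$2), of_int (A$1$1):] ^ i *
     [:of_int (A$2$2), of_int (A$2$1):] ^ (k - 2 - i)) j"

lemma coeff_actP: "coeff (actP k A p) j = (\<Sum>i\<le>k - 2. coeff p i * actP_coeff k A i j)"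
  by (simp add: actP_def coeff_sum actP_coeff_def)

lemma actP_0 [simp]: "actP k A 0 = 0"
  by (simp add: poly_eq_iff coeff_actP)

lemma actP_add: "actP k A (p + q) = actP k A p + actP k A q"
  by (simp add: poly_eq_iff coeff_actP algebra_simps sum.distrib)

lemma actP_diff: "actP k A (p - q) = actP k A p - actP k A q"
  by (simp add: poly_eq_iff coeff_actP algebra_simps sum_subtractf)

lemma actP_smult: "actP k A (smult c p) = smult c (actP k A p)"
  by (simp add: poly_eq_iff coeff_actP sum_distrib_left mult.assoc)

lemma actP_in_Ppoly: "actP k A p \<in> Ppoly k"
proof -
  have "degree (actP k A p) \<le> k - 2"
    unfolding actP_def
  proof (rule degree_sum_le)
    fix i assume i: "i \<in> {..k - 2}"
    let ?p = "[:of_int (A$1$2), of_int (A$1$1):] :: complex poly"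
    let ?q = "[:of_int (A$2$2), of_int (A$2$1):] :: complex poly"
    have "degree (?p ^ i * ?q ^ (k - 2 - i)) \<le> degree (?p ^ i) + degree (?q ^ (k - 2 - i))"
      by (rule degree_mult_le)
    also have "\<dots> \<le> degree ?p * i + degree ?q * (k - 2 - i)"
      by (intro add_mono degree_power_le)
    also have "\<dots> \<le> 1 * i + 1 * (k - 2 - i)"
      by (intro add_mono mult_right_mono) (auto intro: degree_pCons_le order_trans)
    also have "\<dots> = k - 2" using i by simp
    finally show "degree (smult (coeff p i) (?p ^ i * ?q ^ (k - 2 - i))) \<le> k - 2"
      using degree_smult_le order_trans by blast
  qed simp
  thus ?thesis by (simp add: Ppoly_def)
qed

text \<open>This is the definition of the action before denominators are cleared. It holds wherever \<open>j(A, x) \<noteq> 0\<close>,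
  in particular off the real axis; a polynomial is determined by its values there, so the laws of the action
  follow from the cocycle relation of \<open>jfac\<close>.\<close>
lemma poly_actP:
  assumes "p \<in> Ppoly k" "A \<in> carrier SL2Z" "Im x \<noteq> 0"
  shows "poly (actP k A p) x = jfac A x ^ (k - 2) * poly p (moebius A x)"
proof -
  have nz: "jfac A x \<noteq> 0" by (rule jfac_nonzero[OF assms(2,3)])
  have num: "of_int (A$1$1) * x + of_int (A$1$2) = moebius A x * jfac A x"
    using nz by (simp add: moebius_def jfac_def)
  have "poly (actP k A p) x = (\<Sum>i\<le>k - 2. coeff p i *
      ((of_int (A$1$2) + x * of_int (A$1$1)) ^ i * (of_int (A$2$2) + x * of_int (A$2$1)) ^ (k - 2 - i)))"
    by (simp add: actP_def poly_sum)
  also have "\<dots> = (\<Sum>i\<le>k - 2. coeff p i * ((moebius A x * jfac A x) ^ i * jfac A x ^ (k - 2 - i)))"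
    unfolding num[symmetric] by (simp add: jfac_def algebra_simps)
  also have "\<dots> = (\<Sum>i\<le>k - 2. jfac A x ^ (k - 2) * (coeff p i * moebius A x ^ i))"
  proof (intro sum.cong refl)
    fix i assume "i \<in> {..k - 2}"
    hence "i + (k - 2 - i) = k - 2" by simp
    hence "jfac A x ^ (k - 2) = jfac A x ^ i * jfac A x ^ (k - 2 - i)"
      using power_add[of "jfac A x" i "k - 2 - i"] by (simp only:)
    thus "coeff p i * ((moebius A x * jfac A x) ^ i * jfac A x ^ (k - 2 - i)) =
        jfac A x ^ (k - 2) * (coeff p i * moebius A x ^ i)"
      by (simp add: power_mult_distrib)
  qed
  also have "\<dots> = jfac A x ^ (k - 2) * (\<Sum>i\<le>k - 2. coeff p i * moebius A x ^ i)"
    by (simp add: sum_distrib_left)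
  also have "(\<Sum>i\<le>k - 2. coeff p i * moebius A x ^ i) = poly p (moebius A x)"
    unfolding poly_altdef using assms(1)
    by (intro sum.mono_neutral_right) (auto simp: Ppoly_def coeff_eq_0)
  finally show ?thesis .
qed

lemma poly_eq_upper_half:
  fixes p q :: "complex poly"
  assumes "\<And>x. Im x > 0 \<Longrightarrow> poly p x = poly q x"
  shows "p = q"
proof -
  have "(\<lambda>n::nat. Complex (real n) 1) ` UNIV \<subseteq> {x. poly (p - q) x = 0}"
    using assms by auto
  moreover have "infinite ((\<lambda>n::nat. Complex (real n) 1) ` UNIV)"
    by (rule range_inj_infinite) (auto simp: inj_def)
  ultimately have "infinite {x. poly (p - q) x = 0}"
    using finite_subset by blast
  hence "p - q = 0" using poly_roots_finite[of "p - q"] by blast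
  thus ?thesis by simp
qed

lemma actP_mult:
  assumes "p \<in> Ppoly k" "A \<in> carrier SL2Z" "B \<in> carrier SL2Z"
  shows "actP k (A ** B) p = actP k B (actP k A p)"
proof (rule poly_eq_upper_half)
  fix x assume "Im x > 0"
  hence x: "Im x \<noteq> 0" "Im (moebius B x) \<noteq> 0"
    using moebius_upper_half_iff[OF assms(3), of x] by (auto simp: upper_half_def)
  show "poly (actP k (A ** B) p) x = poly (actP k B (actP k A p)) x"
    by (simp add: poly_actP actP_in_Ppoly assms SL2Z_mult x jfac_mult moebius_mult power_mult_distrib)
qed

lemma actP_one:
  assumes "p \<in> Ppoly k"
  shows "actP k (mat 1) p = p"
  by (rule poly_eq_upper_half)
     (simp add: poly_actP[OF assms] SL2Z_iff jfac_def moebius_def)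

text \<open>A polynomial of period \<open>1\<close> takes the value \<open>p(\<i>)\<close> at all points \<open>\<i> + n\<close>.\<close>
lemma actP_Tmat_invariant_constant:
  assumes "p \<in> Ppoly k" "actP k Tmat p = p"
  obtains c where "p = [:c:]"
proof -
  have step: "poly p (x + 1) = poly p x" if "Im x > 0" for x
    using poly_actP[OF assms(1) Tmat_SL2Z, of x] that assms(2)
    by (simp add: jfac_def moebius_def Tmat_def)
  have "poly p (Complex (real n) 1) = poly p \<i>" for n
  proof (induction n)
    case 0
    have "Complex 0 1 = \<i>" by (simp add: complex_eq_iff)
    thus ?case by simp
  next
    case (Suc n)
    have "Complex (real (Suc n)) 1 = Complex (real n) 1 + 1" by (simp add: complex_eq_iff)
    thus ?case using Suc step[of "Complex (real n) 1"] by simp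
  qed
  hence "(\<lambda>n::nat. Complex (real n) 1) ` UNIV \<subseteq> {x. poly (p - [:poly p \<i>:]) x = 0}"
    by auto
  moreover have "infinite ((\<lambda>n::nat. Complex (real n) 1) ` UNIV)"
    by (rule range_inj_infinite) (auto simp: inj_def)
  ultimately have "infinite {x. poly (p - [:poly p \<i>:]) x = 0}"
    using finite_subset by blast
  hence "p - [:poly p \<i>:] = 0" using poly_roots_finite by blast
  thus ?thesis using that[of "poly p \<i>"] by simp
qed

lemma actP_Smat_constant: "actP k Smat [:c:] = monom c (k - 2)"
proof (rule poly_eq_upper_half)
  fix x :: complex assume "Im x > 0"
  hence "poly (actP k Smat [:c:]) x = jfac Smat x ^ (k - 2) * c"
    by (subst poly_actP) (auto simp: Ppoly_def Smat_SL2Z)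
  thus "poly (actP k Smat [:c:]) x = poly (monom c (k - 2)) x"
    by (simp add: poly_monom jfac_def Smat_def)
qed

text \<open>Invariance under \<open>T\<close> forces a constant \<open>c\<close>, which \<open>S\<close> sends to \<open>c X\<^sup>k\<^sup>-\<^sup>2\<close>.\<close>
lemma actP_invariant_zero:
  assumes "k > 2" "p \<in> Ppoly k" "\<And>A. A \<in> carrier SL2Z \<Longrightarrow> actP k A p = p"
  shows "p = 0"
proof -
  obtain c where c: "p = [:c:]"
    using actP_Tmat_invariant_constant[OF assms(2)] assms(3)[OF Tmat_SL2Z] by metis
  hence "monom c (k - 2) = [:c:]" using assms(3)[OF Smat_SL2Z] by (simp add: actP_Smat_constant)
  hence "coeff (monom c (k - 2)) 0 = c" by simp
  thus ?thesis using assms(1) by (simp add: c split: if_splits)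
qed

lemma actRP_mult:
  assumes "\<And>z. z \<notin> upper_half \<Longrightarrow> F z = 0" "\<And>z. F z \<in> Ppoly k"
    and A: "A \<in> carrier SL2Z" and B: "B \<in> carrier SL2Z"
  shows "actRP k r s (A ** B) F = actRP k r s B (actRP k r s A F)"
proof
  fix z
  show "actRP k r s (A ** B) F z = actRP k r s B (actRP k r s A F) z"
  proof (cases "z \<in> upper_half")
    case True
    hence z: "Im z \<noteq> 0" by (simp add: upper_half_def)
    show ?thesis
      by (simp add: actRP_aut_factor aut_factor_mult[OF B z] moebius_mult[OF A B z] actP_mult[OF assms(2) A B]
          actP_smult mult.commute)
  next
    case False
    thus ?thesis
      by (simp add: actRP_aut_factor assms(1) moebius_upper_half_iff SL2Z_mult A B)
  qed
qed

lemma actRP_diff: "actRP k r s A (F - G) = actRP k r s A F - actRP k r s A G"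
  by (simp add: actRP_aut_factor actP_diff smult_diff_right fun_eq_iff)

lemma actRP_add: "actRP k r s A (F + G) = actRP k r s A F + actRP k r s A G"
  by (simp add: actRP_aut_factor actP_add smult_add_right fun_eq_iff)

section \<open>Normed power series and real analyticity\<close>

definition square :: "complex \<Rightarrow> real \<Rightarrow> complex set" where
  "square z0 e = {z. \<bar>Re z - Re z0\<bar> \<le> e \<and> \<bar>Im z - Im z0\<bar> \<le> e}"

definition monomial_at :: "complex \<Rightarrow> nat \<Rightarrow> nat \<Rightarrow> complex \<Rightarrow> complex" where
  "monomial_at z0 m n z = of_real ((Re z - Re z0) ^ m * (Im z - Im z0) ^ n)"

text \<open>The functions given on a square by a power series in \<open>x - x\<^sub>0\<close> and \<open>y - y\<^sub>0\<close> form a Banach algebra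
  under the norm \<open>\<Sum> \<bar>a\<^sub>m\<^sub>n\<bar> e\<^sup>m\<^sup>+\<^sup>n\<close>, and the predicate says that the norm is at most \<open>M\<close>. Real analyticity
  of an infinite sum of functions follows once the norms of the summands are summable on a common square.\<close>
definition ps_norm_le :: "complex \<Rightarrow> real \<Rightarrow> real \<Rightarrow> (complex \<Rightarrow> complex) \<Rightarrow> bool" where
  "ps_norm_le z0 e M f \<longleftrightarrow> (\<exists>a N. N \<le> M \<and> ((\<lambda>(m, n). norm (a m n) * e ^ (m + n)) has_sum N) UNIV \<and>
     (\<forall>z\<in>square z0 e. ((\<lambda>(m, n). a m n * monomial_at z0 m n z) has_sum f z) UNIV))"

lemma monomial_at_mult: "monomial_at z0 m n z * monomial_at z0 m' n' z = monomial_at z0 (m + m') (n + n') z"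
  by (simp add: monomial_at_def power_add)

lemma norm_monomial_at_le:
  assumes "z \<in> square z0 e"
  shows "norm (monomial_at z0 m n z) \<le> e ^ (m + n)"
proof -
  have "e \<ge> 0" using assms by (auto simp: square_def)
  have "norm (monomial_at z0 m n z) = \<bar>Re z - Re z0\<bar> ^ m * \<bar>Im z - Im z0\<bar> ^ n"
    by (simp add: monomial_at_def norm_mult norm_power flip: of_real_diff)
  also have "\<dots> \<le> e ^ m * e ^ n"
    using assms \<open>e \<ge> 0\<close> by (intro mult_mono power_mono) (auto simp: square_def)
  finally show ?thesis by (simp add: power_add)
qed

text \<open>The series may be indexed by any family of monomials: absolute convergence allows collecting the terms
  with equal exponents, which can only decrease the norm. Products and infinite sums of power series are
  therefore immediate, with pairs of indices as the new indices.\<close>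
lemma ps_norm_leI:
  fixes b :: "'i \<Rightarrow> complex" and p q :: "'i \<Rightarrow> nat"
  assumes e: "e > 0" and NM: "N \<le> M"
    and norm: "((\<lambda>i. norm (b i) * e ^ (p i + q i)) has_sum N) I"
    and val: "\<And>z. z \<in> square z0 e \<Longrightarrow> ((\<lambda>i. b i * monomial_at z0 (p i) (q i) z) has_sum f z) I"
  shows "ps_norm_le z0 e M f"
proof -
  define J where "J = (\<lambda>mn. {i \<in> I. p i = fst mn \<and> q i = snd mn})"
  \<comment> \<open>\<open>J (m, n)\<close> collects the indices of the terms with exponents \<open>(m, n)\<close>.\<close>
  have bij: "bij_betw (\<lambda>i. ((p i, q i), i)) I (Sigma UNIV J)"
    by (rule bij_betwI[where g = snd]) (auto simp: J_def)
  have sigma: "(g has_sum S) I \<longleftrightarrow> ((\<lambda>x. g (snd x)) has_sum S) (Sigma UNIV J)"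
    for g :: "'i \<Rightarrow> 'c :: {comm_monoid_add, topological_space}" and S
    using has_sum_reindex_bij_betw[OF bij, of "\<lambda>x. g (snd x)"] by simp
  have abs_J: "(\<lambda>i. norm (b i)) summable_on J mn" for mn
  proof -
    have "(\<lambda>i. norm (b i) * e ^ (p i + q i)) summable_on J mn"
      by (rule summable_on_subset[OF has_sum_imp_summable[OF norm]]) (auto simp: J_def)
    also have "?this \<longleftrightarrow> (\<lambda>i. norm (b i) * e ^ (fst mn + snd mn)) summable_on J mn"
      by (intro summable_on_cong) (auto simp: J_def)
    finally show ?thesis using e by (simp add: summable_on_cmult_left')
  qed
  have sum_J: "b summable_on J mn" for mn
    by (rule abs_summable_summable[OF abs_J])
  define a where "a = (\<lambda>m n. infsum b (J (m, n)))"
  have a: "(b has_sum a m n) (J (m, n))" for m n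
    unfolding a_def by (rule has_sum_infsum[OF sum_J])
  have "((\<lambda>(m, n). infsum (\<lambda>i. norm (b i)) (J (m, n)) * e ^ (m + n)) has_sum N) UNIV"
  proof (rule has_sum_SigmaD[OF norm[unfolded sigma]])
    fix mn :: "nat \<times> nat"
    have "((\<lambda>i. norm (b i) * e ^ (fst mn + snd mn)) has_sum
        (infsum (\<lambda>i. norm (b i)) (J mn) * e ^ (fst mn + snd mn))) (J mn)"
      by (intro has_sum_cmult_left has_sum_infsum abs_J)
    also have "?this \<longleftrightarrow> ((\<lambda>i. norm (b i) * e ^ (p i + q i)) has_sum
        (infsum (\<lambda>i. norm (b i)) (J mn) * e ^ (fst mn + snd mn))) (J mn)"
      by (intro has_sum_cong) (auto simp: J_def)
    finally show "((\<lambda>y. norm (b (snd (mn, y))) * e ^ (p (snd (mn, y)) + q (snd (mn, y)))) has_sum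
        (case mn of (m, n) \<Rightarrow> infsum (\<lambda>i. norm (b i)) (J (m, n)) * e ^ (m + n))) (J mn)"
      by (simp add: case_prod_unfold)
  qed
  note maj = this
  have le: "norm (a m n) \<le> infsum (\<lambda>i. norm (b i)) (J (m, n))" for m n
    unfolding a_def by (rule norm_infsum_bound[OF abs_J])
  have summ: "(\<lambda>(m, n). norm (a m n) * e ^ (m + n)) summable_on UNIV"
    by (rule summable_on_comparison_test[OF has_sum_imp_summable[OF maj]])
       (use e le in \<open>auto intro!: mult_right_mono\<close>)
  have "infsum (\<lambda>(m, n). norm (a m n) * e ^ (m + n)) UNIV \<le> N"
    by (rule has_sum_mono[OF has_sum_infsum[OF summ] maj]) (use e le in \<open>auto intro!: mult_right_mono\<close>)
  moreover have "((\<lambda>(m, n). a m n * monomial_at z0 m n z) has_sum f z) UNIV" if z: "z \<in> square z0 e" for z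
  proof (rule has_sum_SigmaD[OF val[OF z, unfolded sigma]])
    fix mn :: "nat \<times> nat"
    have "((\<lambda>i. b i * monomial_at z0 (fst mn) (snd mn) z) has_sum
        (a (fst mn) (snd mn) * monomial_at z0 (fst mn) (snd mn) z)) (J mn)"
      using a[of "fst mn" "snd mn"] by (intro has_sum_cmult_left) simp
    also have "?this \<longleftrightarrow> ((\<lambda>i. b i * monomial_at z0 (p i) (q i) z) has_sum
        (a (fst mn) (snd mn) * monomial_at z0 (fst mn) (snd mn) z)) (J mn)"
      by (intro has_sum_cong) (auto simp: J_def)
    finally show "((\<lambda>y. b (snd (mn, y)) * monomial_at z0 (p (snd (mn, y))) (q (snd (mn, y))) z) has_sum
        (case mn of (m, n) \<Rightarrow> a m n * monomial_at z0 m n z)) (J mn)"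
      by (simp add: case_prod_unfold)
  qed
  ultimately show ?thesis
    unfolding ps_norm_le_def using NM has_sum_infsum[OF summ] by (meson order_trans)
qed

lemma ps_norm_le_cong:
  assumes "ps_norm_le z0 e M f" "\<And>z. z \<in> square z0 e \<Longrightarrow> f z = g z"
  shows "ps_norm_le z0 e M g"
  using assms(1) by (simp add: ps_norm_le_def assms(2))

lemma ps_norm_le_mono: "ps_norm_le z0 e M f \<Longrightarrow> M \<le> M' \<Longrightarrow> ps_norm_le z0 e M' f"
  unfolding ps_norm_le_def by (meson order_trans)

lemma ps_norm_le_bound:
  assumes "ps_norm_le z0 e M f" "z \<in> square z0 e"
  shows "norm (f z) \<le> M"
proof -
  obtain a N where a: "N \<le> M" "((\<lambda>(m, n). norm (a m n) * e ^ (m + n)) has_sum N) UNIV"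
    "((\<lambda>(m, n). a m n * monomial_at z0 m n z) has_sum f z) UNIV"
    using assms unfolding ps_norm_le_def by blast
  have "norm (f z) \<le> N"
    by (rule norm_infsum_le[OF a(3,2)])
       (use norm_monomial_at_le[OF assms(2)] in \<open>auto simp: norm_mult intro!: mult_left_mono\<close>)
  thus ?thesis using a(1) by simp
qed

lemma ps_norm_le_const: "e > 0 \<Longrightarrow> ps_norm_le z0 e (norm c) (\<lambda>_. c)"
  by (rule ps_norm_leI[where I = "{()}" and b = "\<lambda>_. c" and p = "\<lambda>_. 0" and q = "\<lambda>_. 0" and N = "norm c"])
     (auto intro!: has_sum_finiteI simp: monomial_at_def)

lemma ps_norm_le_linear:
  assumes "e > 0"
  shows "ps_norm_le z0 e ((norm \<alpha> + norm \<beta>) * e)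
    (\<lambda>z. \<alpha> * of_real (Re z - Re z0) + \<beta> * of_real (Im z - Im z0))"
  by (rule ps_norm_leI[where I = "UNIV :: bool set" and b = "\<lambda>t. if t then \<alpha> else \<beta>"
        and p = of_bool and q = "\<lambda>t. of_bool (\<not> t)" and N = "(norm \<alpha> + norm \<beta>) * e"])
     (auto intro!: has_sum_finiteI simp: monomial_at_def assms UNIV_bool algebra_simps)

lemma ps_norm_le_cnj:
  assumes "e > 0" "ps_norm_le z0 e M f"
  shows "ps_norm_le z0 e M (\<lambda>z. cnj (f z))"
proof -
  obtain a N where a: "N \<le> M" "((\<lambda>(m, n). norm (a m n) * e ^ (m + n)) has_sum N) UNIV"
    "\<And>z. z \<in> square z0 e \<Longrightarrow> ((\<lambda>(m, n). a m n * monomial_at z0 m n z) has_sum f z) UNIV"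
    using assms unfolding ps_norm_le_def by blast
  show ?thesis
  proof (rule ps_norm_leI[OF assms(1) a(1)])
    show "((\<lambda>i. norm (case i of (m, n) \<Rightarrow> cnj (a m n)) * e ^ (fst i + snd i)) has_sum N) UNIV"
      using a(2) by (simp add: case_prod_unfold)
    fix z assume "z \<in> square z0 e"
    from a(3)[OF this] have "((\<lambda>i. cnj ((\<lambda>(m, n). a m n * monomial_at z0 m n z) i)) has_sum cnj (f z)) UNIV"
      by (simp only: has_sum_cnj_iff)
    thus "((\<lambda>i. (case i of (m, n) \<Rightarrow> cnj (a m n)) * monomial_at z0 (fst i) (snd i) z) has_sum cnj (f z)) UNIV"
      by (simp add: case_prod_unfold monomial_at_def)
  qed
qed

lemma ps_norm_le_infsum:
  fixes f :: "'i \<Rightarrow> complex \<Rightarrow> complex"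
  assumes e: "e > 0" and f: "\<And>i. i \<in> I \<Longrightarrow> ps_norm_le z0 e (M i) (f i)"
    and M: "(M has_sum S) I"
  shows "ps_norm_le z0 e S (\<lambda>z. infsum (\<lambda>i. f i z) I)"
proof -
  have "\<forall>i\<in>I. \<exists>aN. snd aN \<le> M i \<and> ((\<lambda>(m, n). norm (fst aN m n) * e ^ (m + n)) has_sum snd aN) UNIV \<and>
     (\<forall>z\<in>square z0 e. ((\<lambda>(m, n). fst aN m n * monomial_at z0 m n z) has_sum f i z) UNIV)"
  proof
    fix i assume "i \<in> I"
    then obtain a N where "N \<le> M i" "((\<lambda>(m, n). norm (a m n) * e ^ (m + n)) has_sum N) UNIV"
      "\<forall>z\<in>square z0 e. ((\<lambda>(m, n). a m n * monomial_at z0 m n z) has_sum f i z) UNIV"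
      using f unfolding ps_norm_le_def by blast
    thus "\<exists>aN. snd aN \<le> M i \<and> ((\<lambda>(m, n). norm (fst aN m n) * e ^ (m + n)) has_sum snd aN) UNIV \<and>
     (\<forall>z\<in>square z0 e. ((\<lambda>(m, n). fst aN m n * monomial_at z0 m n z) has_sum f i z) UNIV)"
      by (intro exI[of _ "(a, N)"]) simp
  qed
  from bchoice[OF this] obtain aN where aN: "\<forall>i\<in>I. snd (aN i) \<le> M i \<and>
     ((\<lambda>(m, n). norm (fst (aN i) m n) * e ^ (m + n)) has_sum snd (aN i)) UNIV \<and>
     (\<forall>z\<in>square z0 e. ((\<lambda>(m, n). fst (aN i) m n * monomial_at z0 m n z) has_sum f i z) UNIV)"
    by (rule exE)
  define a N where "a = (\<lambda>i. fst (aN i))" and "N = (\<lambda>i. snd (aN i))"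
  have a: "\<And>i. i \<in> I \<Longrightarrow> N i \<le> M i"
    "\<And>i. i \<in> I \<Longrightarrow> ((\<lambda>(m, n). norm (a i m n) * e ^ (m + n)) has_sum N i) UNIV"
    "\<And>i z. i \<in> I \<Longrightarrow> z \<in> square z0 e \<Longrightarrow> ((\<lambda>(m, n). a i m n * monomial_at z0 m n z) has_sum f i z) UNIV"
    using aN unfolding a_def N_def by blast+
  have N0: "N i \<ge> 0" if "i \<in> I" for i
    by (rule has_sum_nonneg[OF a(2)[OF that]]) (use e in auto)
  have N: "N summable_on I"
    by (rule summable_on_comparison_test[OF has_sum_imp_summable[OF M]]) (use a(1) N0 in auto)
  have NS: "infsum N I \<le> S"
    by (rule has_sum_mono[OF has_sum_infsum[OF N] M a(1)])
  have summ: "(\<lambda>(i, m, n). norm (a i m n) * e ^ (m + n)) summable_on I \<times> UNIV"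
    by (rule summable_on_SigmaI[where g = N]) (use a(2) N e in auto)
  have norm: "((\<lambda>(i, m, n). norm (a i m n) * e ^ (m + n)) has_sum infsum N I) (I \<times> UNIV)"
    by (rule has_sum_SigmaI[where g = N]) (use a(2) N summ in auto)
  show ?thesis
  proof (rule ps_norm_leI[OF e NS])
    show "((\<lambda>x. norm (case x of (i, m, n) \<Rightarrow> a i m n) * e ^ (fst (snd x) + snd (snd x))) has_sum infsum N I)
        (I \<times> UNIV)"
      using norm by (simp add: case_prod_unfold)
    fix z assume z: "z \<in> square z0 e"
    have "(\<lambda>x. norm (case x of (i, m, n) \<Rightarrow> a i m n * monomial_at z0 m n z)) summable_on I \<times> UNIV"
      by (rule Infinite_Sum.abs_summable_on_comparison_test'[OF summ])
         (use norm_monomial_at_le[OF z] in \<open>auto simp: norm_mult intro!: mult_left_mono\<close>)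
    hence s: "(\<lambda>(i, m, n). a i m n * monomial_at z0 m n z) summable_on I \<times> UNIV"
      by (rule abs_summable_summable)
    have "((\<lambda>i. f i z) has_sum infsum (\<lambda>(i, m, n). a i m n * monomial_at z0 m n z) (I \<times> UNIV)) I"
      by (rule has_sum_SigmaD[OF has_sum_infsum[OF s]]) (use a(3) z in auto)
    hence "infsum (\<lambda>i. f i z) I = infsum (\<lambda>(i, m, n). a i m n * monomial_at z0 m n z) (I \<times> UNIV)"
      by (rule infsumI)
    thus "((\<lambda>x. (case x of (i, m, n) \<Rightarrow> a i m n) * monomial_at z0 (fst (snd x)) (snd (snd x)) z) has_sum
        infsum (\<lambda>i. f i z) I) (I \<times> UNIV)"
      using has_sum_infsum[OF s] by (simp add: case_prod_unfold)
  qed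
qed

lemma ps_norm_le_mult:
  assumes e: "e > 0" and f: "ps_norm_le z0 e M f" and g: "ps_norm_le z0 e M' g"
  shows "ps_norm_le z0 e (M * M') (\<lambda>z. f z * g z)"
proof -
  obtain a N where a: "N \<le> M" "((\<lambda>(m, n). norm (a m n) * e ^ (m + n)) has_sum N) UNIV"
    "\<And>z. z \<in> square z0 e \<Longrightarrow> ((\<lambda>(m, n). a m n * monomial_at z0 m n z) has_sum f z) UNIV"
    using f unfolding ps_norm_le_def by blast
  obtain b N' where b: "N' \<le> M'" "((\<lambda>(m, n). norm (b m n) * e ^ (m + n)) has_sum N') UNIV"
    "\<And>z. z \<in> square z0 e \<Longrightarrow> ((\<lambda>(m, n). b m n * monomial_at z0 m n z) has_sum g z) UNIV"
    using g unfolding ps_norm_le_def by blast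
  have N0: "N \<ge> 0" "N' \<ge> 0"
    by (rule has_sum_nonneg[OF a(2)] has_sum_nonneg[OF b(2)]; use e in auto)+
  define A where "A = (\<lambda>x. norm (a (fst x) (snd x)) * e ^ (fst x + snd x))"
  define B where "B = (\<lambda>x. norm (b (fst x) (snd x)) * e ^ (fst x + snd x))"
  have A: "(A has_sum N) UNIV" and B: "(B has_sum N') UNIV"
    using a(2) b(2) by (simp_all add: A_def B_def case_prod_unfold)
  have AB0: "A x \<ge> 0" "B x \<ge> 0" for x using e by (auto simp: A_def B_def)
  have fib: "((\<lambda>y. A x * B y) has_sum A x * N') UNIV" for x
    by (rule has_sum_cmult_right[OF B])
  have summ: "(\<lambda>(x, y). A x * B y) summable_on UNIV \<times> UNIV"
    by (rule summable_on_SigmaI[where g = "\<lambda>x. A x * N'"])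
       (use fib AB0 has_sum_imp_summable[OF has_sum_cmult_left[OF A]] in auto)
  have norm: "((\<lambda>(x, y). A x * B y) has_sum N * N') (UNIV \<times> UNIV)"
    by (rule has_sum_SigmaI[where g = "\<lambda>x. A x * N'"])
       (use fib summ has_sum_cmult_left[OF A] in auto)
  show ?thesis
  proof (rule ps_norm_leI[OF e])
    show "N * N' \<le> M * M'" using N0 a(1) b(1) by (intro mult_mono) auto
    show "((\<lambda>w. norm (a (fst (fst w)) (snd (fst w)) * b (fst (snd w)) (snd (snd w))) *
       e ^ ((fst (fst w) + fst (snd w)) + (snd (fst w) + snd (snd w)))) has_sum N * N') (UNIV \<times> UNIV)"
      using norm by (simp add: case_prod_unfold A_def B_def norm_mult power_add mult_ac)
    fix z assume z: "z \<in> square z0 e"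
    define F where "F = (\<lambda>x. a (fst x) (snd x) * monomial_at z0 (fst x) (snd x) z)"
    define G where "G = (\<lambda>x. b (fst x) (snd x) * monomial_at z0 (fst x) (snd x) z)"
    have F: "(F has_sum f z) UNIV" and G: "(G has_sum g z) UNIV"
      using a(3)[OF z] b(3)[OF z] by (simp_all add: F_def G_def case_prod_unfold)
    have FA: "norm (F x) \<le> A x" and GB: "norm (G x) \<le> B x" for x
      using norm_monomial_at_le[OF z] by (auto simp: F_def G_def A_def B_def norm_mult intro!: mult_left_mono)
    have "(\<lambda>w. norm (case w of (x, y) \<Rightarrow> F x * G y)) summable_on UNIV \<times> UNIV"
      by (rule Infinite_Sum.abs_summable_on_comparison_test'[OF summ])
         (use FA GB AB0 in \<open>auto simp: norm_mult intro!: mult_mono\<close>)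
    hence s: "(\<lambda>(x, y). F x * G y) summable_on UNIV \<times> UNIV"
      by (rule abs_summable_summable)
    have "((\<lambda>(x, y). F x * G y) has_sum f z * g z) (UNIV \<times> UNIV)"
    proof (rule has_sum_SigmaI[where g = "\<lambda>x. F x * g z"])
      show "((\<lambda>y. case (x, y) of (x, y) \<Rightarrow> F x * G y) has_sum F x * g z) UNIV" for x
        using has_sum_cmult_right[OF G] by simp
      show "((\<lambda>x. F x * g z) has_sum f z * g z) UNIV" by (rule has_sum_cmult_left[OF F])
    qed (rule s)
    thus "((\<lambda>w. a (fst (fst w)) (snd (fst w)) * b (fst (snd w)) (snd (snd w)) *
       monomial_at z0 (fst (fst w) + fst (snd w)) (snd (fst w) + snd (snd w)) z) has_sum f z * g z) (UNIV \<times> UNIV)"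
      by (simp add: case_prod_unfold F_def G_def mult_ac flip: monomial_at_mult)
  qed
qed

lemma ps_norm_le_power:
  assumes "e > 0" "ps_norm_le z0 e M f"
  shows "ps_norm_le z0 e (M ^ n) (\<lambda>z. f z ^ n)"
proof (induction n)
  case 0
  show ?case using ps_norm_le_const[OF assms(1), of z0 1] by simp
next
  case (Suc n)
  show ?case using ps_norm_le_mult[OF assms Suc] by simp
qed

lemma ps_norm_le_geometric:
  assumes e: "e > 0" and w: "ps_norm_le z0 e M w" and M: "0 \<le> M" "M < 1"
  shows "ps_norm_le z0 e (1 / (1 - M)) (\<lambda>z. 1 / (1 - w z))"
proof (rule ps_norm_le_cong)
  have "((\<lambda>n. M ^ n) has_sum 1 / (1 - M)) UNIV"
    using M by (intro sums_nonneg_imp_has_sum geometric_sums) auto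
  thus "ps_norm_le z0 e (1 / (1 - M)) (\<lambda>z. infsum (\<lambda>n. w z ^ n) UNIV)"
    by (intro ps_norm_le_infsum[where M = "\<lambda>n. M ^ n"] ps_norm_le_power e w)
  fix z assume z: "z \<in> square z0 e"
  have "norm (w z) < 1" using ps_norm_le_bound[OF w z] M by simp
  hence "((\<lambda>n. w z ^ n) has_sum 1 / (1 - w z)) UNIV"
    by (intro norm_summable_imp_has_sum geometric_sums) (auto simp: norm_power)
  thus "infsum (\<lambda>n. w z ^ n) UNIV = 1 / (1 - w z)" by (rule infsumI)
qed

text \<open>Near \<open>z\<^sub>0\<close> one has \<open>j(A, z) = j\<^sub>0 (1 - w)\<close> with \<open>j\<^sub>0 = j(A, z\<^sub>0)\<close> and \<open>w = - c (z - z\<^sub>0) / j\<^sub>0\<close>. Since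
  \<open>\<bar>c\<bar> Im z\<^sub>0 \<le> \<bar>j\<^sub>0\<bar>\<close>, the norm of \<open>w\<close> on a square of half side \<open>Im z\<^sub>0 / 4\<close> is at most \<open>1/2\<close>, and the geometric
  series applies. The square is the same for all \<open>A\<close>.\<close>
lemma ps_norm_le_inverse_jfac:
  assumes A: "A \<in> carrier SL2Z" and y: "Im z0 > 0" and e: "e = Im z0 / 4"
  shows "ps_norm_le z0 e (2 / norm (jfac A z0)) (\<lambda>z. 1 / jfac A z)"
proof -
  define j0 where "j0 = jfac A z0"
  have e0: "e > 0" using y e by simp
  have j0: "j0 \<noteq> 0" unfolding j0_def using jfac_nonzero[OF A] y by simp
  define c :: complex where "c = of_int (A$2$1)"
  define w where "w = (\<lambda>z. (- c / j0) * of_real (Re z - Re z0) + (- c * \<i> / j0) * of_real (Im z - Im z0))"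
  have "norm c * Im z0 = \<bar>Im j0\<bar>"
    using y by (simp add: c_def j0_def jfac_def abs_mult)
  also have "\<dots> \<le> norm j0" by (rule abs_Im_le_cmod)
  finally have "norm c * Im z0 \<le> norm j0" .
  hence half: "(norm (- c / j0) + norm (- c * \<i> / j0)) * e \<le> 1 / 2"
    using j0 by (simp add: norm_divide norm_mult e field_simps)
  have w: "ps_norm_le z0 e (1 / 2) w"
    unfolding w_def by (rule ps_norm_le_mono[OF ps_norm_le_linear[OF e0] half])
  have "ps_norm_le z0 e (norm (1 / j0) * (1 / (1 - 1 / 2))) (\<lambda>z. 1 / j0 * (1 / (1 - w z)))"
    by (intro ps_norm_le_mult ps_norm_le_const ps_norm_le_geometric w e0) auto
  moreover have "1 / j0 * (1 / (1 - w z)) = 1 / jfac A z" for z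
  proof -
    have "jfac A z = j0 + c * (z - z0)"
      by (simp add: j0_def jfac_def c_def algebra_simps)
    also have "z - z0 = of_real (Re z - Re z0) + \<i> * of_real (Im z - Im z0)"
      by (simp add: complex_eq_iff)
    also have "j0 + c * \<dots> = j0 + c * of_real (Re z - Re z0) + c * \<i> * of_real (Im z - Im z0)"
      by (simp only: distrib_left add.assoc mult.assoc)
    also have "\<dots> = j0 * (1 - w z)" using j0 by (simp add: w_def field_simps)
    finally show ?thesis by simp
  qed
  ultimately show ?thesis by (simp add: norm_divide j0_def)
qed

lemma ps_norm_le_inverse_aut_factor:
  assumes A: "A \<in> carrier SL2Z" and y: "Im z0 > 0" and e: "e = Im z0 / 4"
  shows "ps_norm_le z0 e ((2 / norm (jfac A z0)) ^ (r + s)) (\<lambda>z. 1 / aut_factor r s A z)"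
proof -
  have e0: "e > 0" using y e by simp
  note * = ps_norm_le_inverse_jfac[OF A y e]
  have "ps_norm_le z0 e ((2 / norm (jfac A z0)) ^ r * (2 / norm (jfac A z0)) ^ s)
     (\<lambda>z. (1 / jfac A z) ^ r * (cnj (1 / jfac A z)) ^ s)"
    by (intro ps_norm_le_mult ps_norm_le_power ps_norm_le_cnj * e0)
  thus ?thesis by (simp add: power_add aut_factor_def jfac_cnj power_divide)
qed

lemma ps_norm_le_imp_real_analytic_at:
  assumes "e > 0" "ps_norm_le z0 e M f"
  shows "real_analytic_at f z0"
proof -
  obtain a where a: "\<And>z. z \<in> square z0 e \<Longrightarrow> ((\<lambda>(m, n). a m n * monomial_at z0 m n z) has_sum f z) UNIV"
    using assms(2) unfolding ps_norm_le_def by blast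
  have "ball z0 e \<subseteq> square z0 e"
  proof
    fix z assume "z \<in> ball z0 e"
    hence "norm (z - z0) < e" by (simp add: dist_norm norm_minus_commute)
    thus "z \<in> square z0 e"
      using abs_Re_le_cmod[of "z - z0"] abs_Im_le_cmod[of "z - z0"] by (auto simp: square_def)
  qed
  thus ?thesis
    unfolding real_analytic_at_def using assms(1) a unfolding monomial_at_def by blast
qed


lemma real_analytic_at_add:
  assumes "real_analytic_at f z0" "real_analytic_at g z0"
  shows "real_analytic_at (\<lambda>z. f z + g z) z0"
proof -
  obtain a e where a: "e > 0" "\<And>z. z \<in> ball z0 e \<Longrightarrow>
     ((\<lambda>(m, n). a m n * of_real ((Re z - Re z0) ^ m * (Im z - Im z0) ^ n)) has_sum f z) UNIV"
    using assms(1) unfolding real_analytic_at_def by blast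
  obtain b d where b: "d > 0" "\<And>z. z \<in> ball z0 d \<Longrightarrow>
     ((\<lambda>(m, n). b m n * of_real ((Re z - Re z0) ^ m * (Im z - Im z0) ^ n)) has_sum g z) UNIV"
    using assms(2) unfolding real_analytic_at_def by blast
  show ?thesis
    unfolding real_analytic_at_def
  proof (intro exI conjI ballI)
    show "min e d > 0" using a b by simp
    fix z assume "z \<in> ball z0 (min e d)"
    hence "z \<in> ball z0 e" "z \<in> ball z0 d" by auto
    from has_sum_add[OF a(2)[OF this(1)] b(2)[OF this(2)]]
    show "((\<lambda>(m, n). (a m n + b m n) * of_real ((Re z - Re z0) ^ m * (Im z - Im z0) ^ n)) has_sum f z + g z) UNIV"
      by (simp add: case_prod_unfold distrib_right)
  qed
qed

lemma real_analytic_at_cmult: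
  assumes "real_analytic_at f z0"
  shows "real_analytic_at (\<lambda>z. c * f z) z0"
proof -
  obtain a e where a: "e > 0" "\<And>z. z \<in> ball z0 e \<Longrightarrow>
     ((\<lambda>(m, n). a m n * of_real ((Re z - Re z0) ^ m * (Im z - Im z0) ^ n)) has_sum f z) UNIV"
    using assms(1) unfolding real_analytic_at_def by blast
  show ?thesis
    unfolding real_analytic_at_def
  proof (intro exI conjI ballI)
    show "e > 0" by (rule a)
    fix z assume "z \<in> ball z0 e"
    from has_sum_cmult_right[OF a(2)[OF this], of c]
    show "((\<lambda>(m, n). (c * a m n) * of_real ((Re z - Re z0) ^ m * (Im z - Im z0) ^ n)) has_sum c * f z) UNIV"
      by (simp add: case_prod_unfold mult.assoc)
  qed
qed

lemma real_analytic_at_0: "real_analytic_at (\<lambda>_. 0) z0"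
  using ps_norm_le_imp_real_analytic_at[OF zero_less_one ps_norm_le_const[OF zero_less_one]] .


section \<open>Vector spaces of functions\<close>

definition fun_subspace :: "(complex \<Rightarrow> complex) set \<Rightarrow> bool" where
  "fun_subspace V \<longleftrightarrow> 0 \<in> V \<and> (\<forall>f\<in>V. \<forall>g\<in>V. f + g \<in> V) \<and> (\<forall>c. \<forall>f\<in>V. (\<lambda>z. c * f z) \<in> V)"

text \<open>For \<open>y \<ge> 1\<close> both bounds follow from the one with the larger exponent.\<close>
lemma Rspace_growth_add:
  assumes C: "C > 0" "\<forall>X\<in>Xs. f \<in> O[inf (filtercomap Im at_top) (principal {z. Re z \<in> X})](\<lambda>z. of_real (Im z powr C))"
    and D: "D > 0" "\<forall>X\<in>Xs. g \<in> O[inf (filtercomap Im at_top) (principal {z. Re z \<in> X})](\<lambda>z. of_real (Im z powr D))"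
  shows "\<exists>C>0. \<forall>X\<in>Xs. (\<lambda>z. f z + g z :: complex) \<in>
    O[inf (filtercomap Im at_top) (principal {z. Re z \<in> X})](\<lambda>z. complex_of_real (Im z powr C))"
proof (intro exI conjI ballI)
  show "max C D > 0" using C by simp
  fix X assume X: "X \<in> Xs"
  define F where "F = inf (filtercomap Im at_top) (principal {z. Re z \<in> X})"
  have ev: "eventually (\<lambda>z. Im z \<ge> 1) F"
    unfolding F_def
    by (rule filter_leD[OF inf_le1]) (auto simp: eventually_filtercomap intro!: exI[of _ "\<lambda>y. y \<ge> 1"])
  have mono: "(\<lambda>z. complex_of_real (Im z powr C')) \<in> O[F](\<lambda>z. complex_of_real (Im z powr max C D))"
    if "C' \<le> max C D" for C'
    by (rule landau_o.big_mono) (use ev that in \<open>auto elim!: eventually_mono intro: powr_mono\<close>)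
  show "(\<lambda>z. f z + g z) \<in> O[F](\<lambda>z. complex_of_real (Im z powr max C D))"
  proof (rule sum_in_bigo)
    have "f \<in> O[F](\<lambda>z. of_real (Im z powr C))" using C(2) X by (simp add: F_def)
    thus "f \<in> O[F](\<lambda>z. complex_of_real (Im z powr max C D))"
      by (rule landau_o.big_trans[OF _ mono]) simp
    have "g \<in> O[F](\<lambda>z. of_real (Im z powr D))" using D(2) X by (simp add: F_def)
    thus "g \<in> O[F](\<lambda>z. complex_of_real (Im z powr max C D))"
      by (rule landau_o.big_trans[OF _ mono]) simp
  qed
qed

lemma fun_subspace_Rspace: "fun_subspace (Rspace Xs)"
  unfolding fun_subspace_def
proof (intro conjI ballI allI)
  show "0 \<in> Rspace Xs"
    by (auto simp: Rspace_def zero_fun_def real_analytic_at_0 intro!: exI[of _ 1])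
next
  fix f g assume fg: "f \<in> Rspace Xs" "g \<in> Rspace Xs"
  then obtain C D where "C > 0" "\<forall>X\<in>Xs. f \<in> O[inf (filtercomap Im at_top) (principal {z. Re z \<in> X})](\<lambda>z. of_real (Im z powr C))"
     "D > 0" "\<forall>X\<in>Xs. g \<in> O[inf (filtercomap Im at_top) (principal {z. Re z \<in> X})](\<lambda>z. of_real (Im z powr D))"
    unfolding Rspace_def by blast
  from Rspace_growth_add[OF this] fg show "f + g \<in> Rspace Xs"
    by (simp add: Rspace_def plus_fun_def real_analytic_at_add)
next
  fix c f assume f: "f \<in> Rspace Xs"
  show "(\<lambda>z. c * f z) \<in> Rspace Xs"
  proof (cases "c = 0")
    case True
    thus ?thesis by (auto simp: Rspace_def real_analytic_at_0 intro!: exI[of _ 1])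
  next
    case False
    thus ?thesis using f by (auto simp: Rspace_def real_analytic_at_cmult)
  qed
qed

lemma fun_subspace_H0R: "fun_subspace (H0R Xs r s)"
  using fun_subspace_Rspace[of Xs]
  by (auto simp: fun_subspace_def H0R_def actR_def fun_eq_iff add_divide_distrib simp flip: times_divide_eq_right)

lemma fun_subspace_uminus: "fun_subspace V \<Longrightarrow> f \<in> V \<Longrightarrow> - f \<in> V"
proof -
  assume "fun_subspace V" "f \<in> V"
  hence "(\<lambda>z. (-1) * f z) \<in> V" unfolding fun_subspace_def by blast
  thus "- f \<in> V" by (simp add: fun_Compl_def)
qed

lemma fun_subspace_sum:
  assumes "fun_subspace V" "\<And>i. i \<in> I \<Longrightarrow> f i \<in> V"
  shows "(\<lambda>z. \<Sum>i\<in>I. f i z) \<in> V"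
  using assms(2)
proof (induction I rule: infinite_finite_induct)
  case (insert i I)
  hence "f i + (\<lambda>z. \<Sum>i\<in>I. f i z) \<in> V" using assms(1) by (simp add: fun_subspace_def)
  thus ?case using insert by (simp add: plus_fun_def)
qed (use assms(1) in \<open>auto simp: fun_subspace_def zero_fun_def\<close>)


section \<open>Growth of cocycles\<close>

text \<open>Coefficientwise domination by a real polynomial is compatible with products, so the coefficients of the
  products of linear forms that define the action are dominated by multiples of binomial coefficients.\<close>
definition majorized :: "complex poly \<Rightarrow> real poly \<Rightarrow> bool" where
  "majorized p q \<longleftrightarrow> (\<forall>i. norm (coeff p i) \<le> coeff q i)"

lemma majorized_mult:
  assumes "majorized p q" "majorized p' q'"
  shows "majorized (p * p') (q * q')"
  unfolding majorized_def
proof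
  fix i
  have "norm (coeff (p * p') i) \<le> (\<Sum>j\<le>i. norm (coeff p j * coeff p' (i - j)))"
    unfolding coeff_mult by (rule norm_sum)
  also have "\<dots> \<le> (\<Sum>j\<le>i. coeff q j * coeff q' (i - j))"
    unfolding norm_mult
  proof (intro sum_mono mult_mono)
    fix j
    show "norm (coeff p j) \<le> coeff q j" "norm (coeff p' (i - j)) \<le> coeff q' (i - j)"
      using assms by (auto simp: majorized_def)
    show "0 \<le> coeff q j"
      using assms(1) norm_ge_zero[of "coeff p j"] unfolding majorized_def by (meson order_trans)
  qed auto
  finally show "norm (coeff (p * p') i) \<le> coeff (q * q') i" by (simp add: coeff_mult)
qed

lemma majorized_power:
  assumes "majorized p q"
  shows "majorized (p ^ n) (q ^ n)"
proof (induction n)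
  case (Suc n)
  thus ?case using majorized_mult[OF assms] by simp
qed (auto simp: majorized_def)

lemma majorized_linear:
  assumes "norm a \<le> L" "norm b \<le> L"
  shows "majorized [:a, b:] (smult L [:1, 1:])"
  unfolding majorized_def using assms by (auto simp: coeff_pCons split: nat.splits)

lemma norm_actP_coeff_le:
  assumes L: "\<And>i j. \<bar>real_of_int (A$i$j)\<bar> \<le> L" and i: "i \<le> k - 2"
  shows "norm (actP_coeff k A i j) \<le> L ^ (k - 2) * coeff ([:1, 1:] ^ (k - 2)) j"
proof -
  have "majorized ([:of_int (A$1$2), of_int (A$1$1):] ^ i * [:of_int (A$2$2), of_int (A$2$1):] ^ (k - 2 - i))
      (smult L [:1, 1:] ^ i * smult L [:1, 1:] ^ (k - 2 - i))"
    by (intro majorized_mult majorized_power majorized_linear) (simp_all only: norm_of_int of_int_abs L)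
  hence "norm (actP_coeff k A i j) \<le> coeff (smult L [:1, 1:] ^ i * smult L [:1, 1:] ^ (k - 2 - i)) j"
    by (simp only: majorized_def actP_coeff_def)
  also have "smult L [:1, 1:] ^ i * smult L [:1, 1:] ^ (k - 2 - i) = smult L [:1, 1:] ^ (i + (k - 2 - i))"
    by (simp only: power_add)
  also have "i + (k - 2 - i) = k - 2" using i by (rule le_add_diff_inverse)
  also have "coeff (smult L [:1, 1:] ^ (k - 2)) j = L ^ (k - 2) * coeff ([:1, 1:] ^ (k - 2)) j"
    by (simp only: smult_power coeff_smult)
  finally show ?thesis .
qed

lemma norm_coeff_actP_le:
  assumes L: "\<And>i j. \<bar>real_of_int (A$i$j)\<bar> \<le> L"
  shows "norm (coeff (actP k A p) j) \<le>
    (\<Sum>i\<le>k - 2. norm (coeff p i)) * coeff ([:1, 1:] ^ (k - 2)) j * L ^ (k - 2)"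
proof -
  have "norm (coeff (actP k A p) j) \<le> (\<Sum>i\<le>k - 2. norm (coeff p i * actP_coeff k A i j))"
    unfolding coeff_actP by (rule norm_sum)
  also have "\<dots> \<le> (\<Sum>i\<le>k - 2. norm (coeff p i) * (L ^ (k - 2) * coeff ([:1, 1:] ^ (k - 2)) j))"
    unfolding norm_mult by (intro sum_mono mult_left_mono norm_actP_coeff_le L) auto
  also have "\<dots> = (\<Sum>i\<le>k - 2. norm (coeff p i)) * (L ^ (k - 2) * coeff ([:1, 1:] ^ (k - 2)) j)"
    by (rule sum_distrib_right[symmetric])
  finally show ?thesis by (simp only: mult_ac)
qed

text \<open>A cocycle that vanishes on \<open>T\<close> satisfies \<open>\<alpha>(A) = \<alpha>(A\<^sub>1) = \<alpha>(S A\<^sub>1) - \<alpha>(S).A\<^sub>1\<close> with \<open>A\<^sub>1 = T\<^sup>n A\<close>. In a step of the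
  Euclidean algorithm the entries of \<open>A\<^sub>1\<close> are at most \<open>\<surd>N\<close>, so the last term is at most \<open>C N\<^sup>(\<^sup>k\<^sup>-\<^sup>2\<^sup>)\<^sup>/\<^sup>2\<close>,
  while \<open>N\<close> is halved in the other term, whose bound \<open>2 C N\<^sup>(\<^sup>k\<^sup>-\<^sup>2\<^sup>)\<^sup>/\<^sup>2\<close> thereby shrinks to at most half.
  The constant \<open>2 C\<close> is thus preserved. If \<open>S A\<^sub>1\<close> lies in the stabiliser of the cusp, the other term vanishes.\<close>
lemma cocycle_growth:
  assumes k: "even k" "k > 2" and \<alpha>: "\<alpha> \<in> Z1c Bgrp k"
  shows "\<exists>K. \<forall>A\<in>carrier SL2Z. norm (coeff (\<alpha> A) j) \<le> K * real_of_int (row_norm A) ^ ((k - 2) div 2)"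
proof -
  define n where "n = (k - 2) div 2"
  have kn: "k - 2 = 2 * n" using k by (auto simp: n_def)
  have n1: "n \<ge> 1" using k kn by auto
  define C where "C = (\<Sum>i\<le>k - 2. norm (coeff (\<alpha> Smat) i)) * coeff ([:1, 1:] ^ (k - 2)) j"
  have C0: "C \<ge> 0"
  proof -
    have "majorized ([:1, 1:] ^ (k - 2)) (smult 1 [:1, 1:] ^ (k - 2))"
      by (intro majorized_power majorized_linear) auto
    hence "norm (coeff ([:1, 1:] ^ (k - 2)) j :: complex) \<le> coeff (smult 1 [:1, 1:] ^ (k - 2)) j"
      unfolding majorized_def by blast
    from order_trans[OF norm_ge_zero this]
    have "coeff ([:1, 1 :: real:] ^ (k - 2)) j \<ge> 0" by simp
    thus ?thesis unfolding C_def by (intro mult_nonneg_nonneg sum_nonneg) auto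
  qed
  have cocycle: "\<alpha> (A ** B) = actP k B (\<alpha> A) + \<alpha> B" if "A \<in> carrier SL2Z" "B \<in> carrier SL2Z" for A B
    using \<alpha> that by (simp add: Z1c_def)
  have B0: "\<alpha> A = 0" if "A \<in> Bgrp" for A using \<alpha> that by (simp add: Z1c_def)
  have "norm (coeff (\<alpha> A) j) \<le> 2 * C * real_of_int (row_norm A) ^ n" if "A \<in> carrier SL2Z" for A
    using that
  proof (induction A rule: SL2Z_euclid_induct)
    case (Bgrp A)
    thus ?case using B0 C0 row_norm_pos[of A] by (simp add: Bgrp_iff)
  next
    case (step A A1 m)
    define N where "N = real_of_int (row_norm A)"
    have N1: "N \<ge> 1" using row_norm_pos[OF step(1)] by (simp add: N_def)
    have Tm: "mat2 1 m 0 1 \<in> Bgrp" by (simp add: Bgrp_iff SL2Z_iff)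
    have "\<alpha> A1 = \<alpha> A"
      unfolding step(3) using cocycle[of "mat2 1 m 0 1" A] Tm step(1) B0[OF Tm] by (simp add: Bgrp_iff)
    hence eq: "\<alpha> A = \<alpha> (Smat ** A1) - actP k A1 (\<alpha> Smat)"
      using cocycle[OF Smat_SL2Z step(2)] by simp
    \<comment> \<open>\<open>A1\<close> has the bottom row of \<open>A\<close>, and its top row is the bottom row of \<open>S A1\<close>.\<close>
    have sq: "(A1$i$j)\<^sup>2 \<le> row_norm A" for i j
    proof -
      have bot: "row_norm A = (A1$2$1)\<^sup>2 + (A1$2$2)\<^sup>2" by (simp add: step(3) row_norm_def)
      have top: "row_norm (Smat ** A1) = (A1$1$1)\<^sup>2 + (A1$1$2)\<^sup>2" by (simp add: Smat_def row_norm_def)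
      have "\<forall>i j. (A1$i$j)\<^sup>2 \<le> row_norm A"
        using step(4) unfolding top forall_2 bot
        by (smt (verit) zero_le_power2)
      thus ?thesis by blast
    qed
    have L: "\<bar>real_of_int (A1$i$j)\<bar> \<le> sqrt N" for i j
    proof (rule real_le_rsqrt)
      have "real_of_int ((A1$i$j)\<^sup>2) \<le> N" using sq unfolding N_def by (simp only: of_int_le_iff)
      thus "\<bar>real_of_int (A1$i$j)\<bar>\<^sup>2 \<le> N" by simp
    qed
    have "norm (coeff (actP k A1 (\<alpha> Smat)) j) \<le> C * sqrt N ^ (k - 2)"
      unfolding C_def by (rule norm_coeff_actP_le[OF L])
    also have "sqrt N ^ (k - 2) = N ^ n" using N1 by (simp add: kn power_mult)
    finally have S: "norm (coeff (actP k A1 (\<alpha> Smat)) j) \<le> C * N ^ n" .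
    have "norm (coeff (\<alpha> (Smat ** A1)) j) \<le> C * N ^ n"
      using step(5)
    proof
      assume "2 * row_norm (Smat ** A1) \<le> row_norm A"
      hence "real_of_int (row_norm (Smat ** A1)) \<le> N / 2" by (simp add: N_def)
      moreover have "real_of_int (row_norm (Smat ** A1)) \<ge> 0" by (simp add: row_norm_def)
      ultimately have "real_of_int (row_norm (Smat ** A1)) ^ n \<le> (N / 2) ^ n" by (intro power_mono)
      also have "\<dots> \<le> N ^ n / 2"
      proof -
        have "(2 :: real) ^ 1 \<le> 2 ^ n" using n1 by (intro power_increasing) auto
        thus ?thesis using N1 by (simp add: power_divide field_simps)
      qed
      finally have "2 * C * real_of_int (row_norm (Smat ** A1)) ^ n \<le> 2 * C * (N ^ n / 2)"
        using C0 by (intro mult_left_mono) auto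
      thus ?thesis using step(6) by simp
    next
      assume "Smat ** A1 \<in> Bgrp"
      thus ?thesis using B0 C0 N1 by simp
    qed
    hence "norm (coeff (\<alpha> A) j) \<le> C * N ^ n + C * N ^ n"
      unfolding eq coeff_diff using S by (intro order_trans[OF norm_triangle_ineq4] add_mono)
    thus ?case by (simp add: N_def)
  qed
  thus ?thesis unfolding n_def by blast
qed


section \<open>Sums over cosets of the stabiliser of the cusp\<close>

abbreviation cosets :: "(int^2^2) set set" where
  "cosets \<equiv> rcosets\<^bsub>SL2Z\<^esub> Bgrp"

text \<open>Sums over cosets are written with chosen representatives, which avoids functions on cosets; for the
  left-invariant functions below the choice does not matter.\<close>
definition coset_rep :: "(int^2^2) set \<Rightarrow> int^2^2" where
  "coset_rep K = (SOME A. A \<in> K)"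

lemma coset_rep_in:
  assumes "K \<in> cosets"
  shows "coset_rep K \<in> K" "coset_rep K \<in> carrier SL2Z" "K = Bgrp #>\<^bsub>SL2Z\<^esub> coset_rep K"
proof -
  interpret SL: group SL2Z by (rule group_SL2Z)
  interpret B: subgroup Bgrp SL2Z by (rule subgroup_Bgrp)
  obtain x where x: "x \<in> carrier SL2Z" "K = Bgrp #>\<^bsub>SL2Z\<^esub> x"
    using assms by (auto simp: RCOSETS_def)
  hence "x \<in> K" using SL.rcos_self[OF x(1) subgroup_Bgrp] by simp
  thus 1: "coset_rep K \<in> K" unfolding coset_rep_def by (rule someI)
  thus 2: "coset_rep K \<in> carrier SL2Z"
    using SL.r_coset_subset_G[OF B.subset x(1)] x(2) by blast
  show "K = Bgrp #>\<^bsub>SL2Z\<^esub> coset_rep K"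
    using SL.repr_independence[OF _ x(1) subgroup_Bgrp] 1 x(2) by blast
qed

lemma in_cosetE:
  assumes "K \<in> cosets" "A \<in> K"
  obtains P where "P \<in> Bgrp" "A = P ** coset_rep K" "A \<in> carrier SL2Z"
proof -
  have "A \<in> Bgrp #>\<^bsub>SL2Z\<^esub> coset_rep K" using coset_rep_in(3)[OF assms(1)] assms(2) by simp
  then obtain P where "P \<in> Bgrp" "A = P ** coset_rep K" by (auto simp: r_coset_def)
  thus ?thesis using that SL2Z_mult coset_rep_in(2)[OF assms(1)] by (auto simp: Bgrp_iff)
qed

definition left_invariant :: "(int^2^2 \<Rightarrow> 'a) \<Rightarrow> bool" where
  "left_invariant t \<longleftrightarrow> (\<forall>P\<in>Bgrp. \<forall>A\<in>carrier SL2Z. t (P ** A) = t A)"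

lemma left_invariant_coset_rep:
  assumes "left_invariant t" "K \<in> cosets" "A \<in> K"
  shows "t (coset_rep K) = t A"
proof -
  obtain P where "P \<in> Bgrp" "A = P ** coset_rep K" using in_cosetE[OF assms(2,3)] by blast
  thus ?thesis using assms(1) coset_rep_in(2)[OF assms(2)] by (simp add: left_invariant_def)
qed

lemma bij_betw_cosets:
  assumes "D \<in> carrier SL2Z"
  shows "bij_betw (\<lambda>K. K #>\<^bsub>SL2Z\<^esub> D) cosets cosets"
proof -
  interpret SL: group SL2Z by (rule group_SL2Z)
  interpret B: subgroup Bgrp SL2Z by (rule subgroup_Bgrp)
  note D = assms SL.inv_closed[OF assms]
  have assoc: "Bgrp #>\<^bsub>SL2Z\<^esub> x #>\<^bsub>SL2Z\<^esub> y = Bgrp #>\<^bsub>SL2Z\<^esub> (x \<otimes>\<^bsub>SL2Z\<^esub> y)"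
    if "x \<in> carrier SL2Z" "y \<in> carrier SL2Z" for x y
    using SL.coset_mult_assoc[OF B.subset that] .
  show ?thesis
  proof (rule bij_betwI[where g = "\<lambda>K. K #>\<^bsub>SL2Z\<^esub> inv\<^bsub>SL2Z\<^esub> D"])
    have "K #>\<^bsub>SL2Z\<^esub> E \<in> cosets" if "K \<in> cosets" and E: "E \<in> carrier SL2Z" for K E
    proof -
      obtain x where x: "x \<in> carrier SL2Z" "K = Bgrp #>\<^bsub>SL2Z\<^esub> x" using \<open>K \<in> cosets\<close> by (auto simp: RCOSETS_def)
      hence "K #>\<^bsub>SL2Z\<^esub> E = Bgrp #>\<^bsub>SL2Z\<^esub> (x \<otimes>\<^bsub>SL2Z\<^esub> E)" using assoc[OF _ E] by blast
      thus ?thesis using SL.m_closed[OF x(1) E] unfolding RCOSETS_def by blast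
    qed
    thus "(\<lambda>K. K #>\<^bsub>SL2Z\<^esub> D) \<in> cosets \<rightarrow> cosets" "(\<lambda>K. K #>\<^bsub>SL2Z\<^esub> inv\<^bsub>SL2Z\<^esub> D) \<in> cosets \<rightarrow> cosets"
      using D by blast+
    fix K assume "K \<in> cosets"
    then obtain x where x: "x \<in> carrier SL2Z" "K = Bgrp #>\<^bsub>SL2Z\<^esub> x" by (auto simp: RCOSETS_def)
    show "K #>\<^bsub>SL2Z\<^esub> D #>\<^bsub>SL2Z\<^esub> inv\<^bsub>SL2Z\<^esub> D = K" "K #>\<^bsub>SL2Z\<^esub> inv\<^bsub>SL2Z\<^esub> D #>\<^bsub>SL2Z\<^esub> D = K"
      using x D by (simp_all add: assoc SL.m_assoc del: mult_SL2Z one_SL2Z)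
  qed
qed

lemma left_invariant_coset_rep_mult:
  assumes "left_invariant t" "D \<in> carrier SL2Z" "K \<in> cosets"
  shows "t (coset_rep (K #>\<^bsub>SL2Z\<^esub> D)) = t (coset_rep K ** D)"
proof (rule left_invariant_coset_rep[OF assms(1)])
  show "K #>\<^bsub>SL2Z\<^esub> D \<in> cosets" using bij_betw_cosets[OF assms(2)] assms(3) by (auto simp: bij_betw_def)
  show "coset_rep K ** D \<in> K #>\<^bsub>SL2Z\<^esub> D" using coset_rep_in(1)[OF assms(3)] by (auto simp: r_coset_def)
qed

text \<open>Right translation permutes the cosets. This is the source of every transformation law below.\<close>
lemma has_sum_cosets_translate:
  assumes t: "left_invariant t" and D: "D \<in> carrier SL2Z"
  shows "((\<lambda>K. t (coset_rep K ** D)) has_sum S) cosets \<longleftrightarrow> ((\<lambda>K. t (coset_rep K)) has_sum S) cosets"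
proof -
  have "((\<lambda>K. t (coset_rep K ** D)) has_sum S) cosets \<longleftrightarrow> ((\<lambda>K. t (coset_rep (K #>\<^bsub>SL2Z\<^esub> D))) has_sum S) cosets"
    by (intro has_sum_cong) (simp add: left_invariant_coset_rep_mult[OF t D])
  also have "\<dots> \<longleftrightarrow> ((\<lambda>K. t (coset_rep K)) has_sum S) cosets"
    by (rule has_sum_reindex_bij_betw[OF bij_betw_cosets[OF D]])
  finally show ?thesis .
qed

lemma summable_on_int_inverse_square: "(\<lambda>c::int. 1 / (1 + real_of_int (c\<^sup>2))) summable_on UNIV"
proof -
  let ?f = "\<lambda>c::int. 1 / (1 + real_of_int (c\<^sup>2))"
  have nat: "(\<lambda>n::nat. 1 / (1 + real n ^ 2)) summable_on UNIV"
  proof (rule summable_nonneg_imp_summable_on)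
    show "summable (\<lambda>n. 1 / (1 + real n ^ 2))"
    proof (rule summable_comparison_test'[OF inverse_power_summable[of 2, where ?'a = real], of 1])
      fix n :: nat assume "n \<ge> 1"
      hence "(real n)\<^sup>2 > 0" by simp
      hence "1 / (1 + (real n)\<^sup>2) \<le> 1 / (real n)\<^sup>2"
        by (intro divide_left_mono mult_pos_pos add_pos_pos) auto
      thus "norm (1 / (1 + (real n)\<^sup>2)) \<le> inverse (real n ^ 2)"
        by (simp add: inverse_eq_divide abs_of_nonneg)
    qed simp
  qed auto
  have "?f summable_on range int"
    using nat by (subst summable_on_reindex) (auto simp: o_def)
  moreover have "?f summable_on range (\<lambda>n. - int n)"
    using nat by (subst summable_on_reindex) (auto simp: o_def inj_def)
  ultimately have "?f summable_on (range int \<union> range (\<lambda>n. - int n))"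
    by (rule summable_on_union)
  also have "range int \<union> range (\<lambda>n. - int n) = UNIV"
  proof -
    have "c \<in> range int \<union> range (\<lambda>n. - int n)" for c
      by (cases c rule: int_cases2) auto
    thus ?thesis by blast
  qed
  finally show ?thesis .
qed

text \<open>A coset is determined by the bottom row of any representative, so the sum is dominated by a sum over
  pairs of integers \<open>(c, d) \<noteq> 0\<close>. There \<open>(1 + c\<^sup>2) (1 + d\<^sup>2) \<le> 4 (c\<^sup>2 + d\<^sup>2)\<^sup>2\<close>, and the double series of the
  reciprocals of the left-hand side is a product.\<close>
lemma summable_on_cosets: "(\<lambda>K. 1 / real_of_int (row_norm (coset_rep K)) ^ 2) summable_on cosets"
proof -
  interpret SL: group SL2Z by (rule group_SL2Z)
  define h where "h = (\<lambda>c::int. 1 / (1 + real_of_int (c\<^sup>2)))"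
  have h0: "h c \<ge> 0" for c by (simp add: h_def)
  have h: "(h has_sum infsum h UNIV) UNIV"
    unfolding h_def by (rule has_sum_infsum[OF summable_on_int_inverse_square])
  have "(\<lambda>(c, d). h c * h d) summable_on UNIV \<times> UNIV"
    by (rule summable_on_SigmaI[where g = "\<lambda>c. h c * infsum h UNIV"])
       (use has_sum_cmult_right[OF h] has_sum_imp_summable[OF has_sum_cmult_left[OF h]] h0 in auto)
  hence s: "(\<lambda>x. h (fst x) * h (snd x)) summable_on UNIV \<times> UNIV" by (simp add: case_prod_unfold)
  define \<rho> where "\<rho> = (\<lambda>K. (coset_rep K $ 2 $ 1, coset_rep K $ 2 $ 2))"
  have inj: "inj_on \<rho> cosets"
  proof
    fix K L assume K: "K \<in> cosets" and L: "L \<in> cosets" and eq: "\<rho> K = \<rho> L"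
    \<comment> \<open>\<open>P\<close> is the quotient of the representatives; equal bottom rows put it in the stabiliser of the cusp.\<close>
    define P where "P = coset_rep K ** mat2 (coset_rep L $ 2 $ 2) (- (coset_rep L $ 1 $ 2)) (- (coset_rep L $ 2 $ 1)) (coset_rep L $ 1 $ 1)"
    note KL = coset_rep_in(2)[OF K] coset_rep_in(2)[OF L]
    have "P \<in> Bgrp"
      unfolding Bgrp_iff P_def using KL eq
      by (intro conjI SL2Z_mult) (auto simp: \<rho>_def SL2Z_iff algebra_simps)
    moreover have "coset_rep K = P ** coset_rep L"
    proof -
      have "mat2 (coset_rep L $ 2 $ 2) (- (coset_rep L $ 1 $ 2)) (- (coset_rep L $ 2 $ 1)) (coset_rep L $ 1 $ 1) ** coset_rep L = mat 1"
        using KL(2) by (auto simp: mat2_eq_iff SL2Z_iff algebra_simps)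
      thus ?thesis by (simp add: P_def flip: matrix_mul_assoc)
    qed
    ultimately have "coset_rep K \<in> Bgrp #>\<^bsub>SL2Z\<^esub> coset_rep L" by (auto simp: r_coset_def)
    hence "Bgrp #>\<^bsub>SL2Z\<^esub> coset_rep L = Bgrp #>\<^bsub>SL2Z\<^esub> coset_rep K"
      by (rule SL.repr_independence[OF _ KL(2) subgroup_Bgrp])
    thus "K = L" using coset_rep_in(3)[OF K] coset_rep_in(3)[OF L] by simp
  qed
  have "(\<lambda>x. h (fst x) * h (snd x)) summable_on \<rho> ` cosets"
    by (rule summable_on_subset[OF s]) auto
  hence "(\<lambda>K. h (coset_rep K $ 2 $ 1) * h (coset_rep K $ 2 $ 2)) summable_on cosets"
    by (subst (asm) summable_on_reindex[OF inj]) (simp add: o_def \<rho>_def)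
  from summable_on_cmult_right[OF this, of 4]
  have "(\<lambda>K. 4 * (h (coset_rep K $ 2 $ 1) * h (coset_rep K $ 2 $ 2))) summable_on cosets" .
  thus ?thesis
  proof (rule summable_on_comparison_test)
    fix K assume K: "K \<in> cosets"
    define c d where "c = real_of_int (coset_rep K $ 2 $ 1)" and "d = real_of_int (coset_rep K $ 2 $ 2)"
    have N: "real_of_int (row_norm (coset_rep K)) = c\<^sup>2 + d\<^sup>2" by (simp add: row_norm_def c_def d_def)
    have "real_of_int (row_norm (coset_rep K)) \<ge> 1" using row_norm_pos[OF coset_rep_in(2)[OF K]] by simp
    hence N1: "c\<^sup>2 + d\<^sup>2 \<ge> 1" by (simp add: N)
    have "1 + x \<le> 2 * (x + y)" if "x + y \<ge> 1" "x \<ge> 0" "y \<ge> 0" for x y :: real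
      using that by simp
    from this[of "c\<^sup>2" "d\<^sup>2"] this[of "d\<^sup>2" "c\<^sup>2"]
    have "1 + c\<^sup>2 \<le> 2 * (c\<^sup>2 + d\<^sup>2)" "1 + d\<^sup>2 \<le> 2 * (c\<^sup>2 + d\<^sup>2)"
      using N1 by (simp_all add: add.commute)
    hence "(1 + c\<^sup>2) * (1 + d\<^sup>2) \<le> 2 * (c\<^sup>2 + d\<^sup>2) * (2 * (c\<^sup>2 + d\<^sup>2))"
      by (intro mult_mono) auto
    also have "2 * x * (2 * x) = 4 * x\<^sup>2" for x :: real by (simp add: power2_eq_square)
    finally have "(1 + c\<^sup>2) * (1 + d\<^sup>2) \<le> 4 * (c\<^sup>2 + d\<^sup>2)\<^sup>2" .
    moreover have "(1 + c\<^sup>2) * (1 + d\<^sup>2) > 0"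
      by (intro mult_pos_pos add_pos_nonneg) auto
    moreover have "(c\<^sup>2 + d\<^sup>2)\<^sup>2 > 0" using N1 by (intro zero_less_power) linarith
    ultimately have "1 / (c\<^sup>2 + d\<^sup>2)\<^sup>2 \<le> 4 / ((1 + c\<^sup>2) * (1 + d\<^sup>2))"
      by (simp add: divide_simps)
    thus "1 / real_of_int (row_norm (coset_rep K)) ^ 2 \<le> 4 * (h (coset_rep K $ 2 $ 1) * h (coset_rep K $ 2 $ 2))"
      unfolding N by (simp add: h_def c_def d_def)
  qed auto
qed


section \<open>Poincare series\<close>

lemma has_sum_finite_sum:
  fixes f :: "'i \<Rightarrow> 'a \<Rightarrow> 'b :: {topological_comm_monoid_add, t2_space}"
  assumes "\<And>i. i \<in> I \<Longrightarrow> (f i has_sum S i) A"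
  shows "((\<lambda>x. \<Sum>i\<in>I. f i x) has_sum (\<Sum>i\<in>I. S i)) A"
  using assms
proof (induction I rule: infinite_finite_induct)
  case (insert i I)
  thus ?case by (simp add: has_sum_add)
qed auto

lemma has_sum_minus:
  fixes f :: "'a \<Rightarrow> complex"
  assumes "(f has_sum a) A" "(g has_sum b) A"
  shows "((\<lambda>x. f x - g x) has_sum (a - b)) A"
  using has_sum_add[OF assms(1), of "\<lambda>x. - g x" "- b"] assms(2) by (simp add: has_sum_uminus)

text \<open>For \<open>a = 1\<close> and \<open>r\<close>, \<open>s\<close> of the same parity this is the Eisenstein series. The coefficients of a cocycle give the coefficients of
  a second-order invariant.\<close>
definition poincare_series :: "nat \<Rightarrow> nat \<Rightarrow> (int^2^2 \<Rightarrow> complex) \<Rightarrow> complex \<Rightarrow> complex" where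
  "poincare_series r s a z = (if z \<in> upper_half then \<Sum>\<^sub>\<infinity>K\<in>cosets. a (coset_rep K) / aut_factor r s (coset_rep K) z else 0)"

lemma norm_aut_factor: "norm (aut_factor r s A z) = norm (jfac A z) ^ (r + s)"
  by (simp add: aut_factor_def jfac_cnj norm_mult norm_power power_add)

text \<open>Two positive definite quadratic forms in \<open>(c, d)\<close> are compared, with a constant that is bounded on the
  parts \<open>y \<ge> 1\<close> of vertical strips.\<close>
lemma row_norm_le_jfac:
  assumes "Im z > 0"
  shows "real_of_int (row_norm A) \<le> (2 + (1 + 2 * (Re z)\<^sup>2) / (Im z)\<^sup>2) * (norm (jfac A z))\<^sup>2"
proof -
  define c d x y where "c = real_of_int (A$2$1)" "d = real_of_int (A$2$2)" "x = Re z" "y = Im z"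
  note defs = this
  define J where "J = (norm (jfac A z))\<^sup>2"
  have y: "y > 0" using assms by (simp add: defs)
  have J: "J = (c * x + d)\<^sup>2 + c\<^sup>2 * y\<^sup>2"
    by (simp add: J_def cmod_power2 jfac_def defs power_mult_distrib)
  have 1: "(c * x + d)\<^sup>2 \<le> J" by (simp add: J)
  have "c\<^sup>2 * y\<^sup>2 \<le> J" by (simp add: J)
  hence 2: "c\<^sup>2 \<le> J / y\<^sup>2" using y by (simp add: field_simps)
  have "0 \<le> (2 * (c * x) + d)\<^sup>2" by simp
  hence "d\<^sup>2 \<le> 2 * (c * x + d)\<^sup>2 + 2 * x\<^sup>2 * c\<^sup>2" by (simp add: power2_eq_square algebra_simps)
  hence "c\<^sup>2 + d\<^sup>2 \<le> 2 * (c * x + d)\<^sup>2 + (1 + 2 * x\<^sup>2) * c\<^sup>2" by (simp add: algebra_simps)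
  also have "\<dots> \<le> 2 * J + (1 + 2 * x\<^sup>2) * (J / y\<^sup>2)"
    using 1 2 by (intro add_mono mult_left_mono) auto
  finally show ?thesis by (simp add: J_def row_norm_def defs algebra_simps)
qed

text \<open>With \<open>N\<close> the squared length of the bottom row, the numerator is \<open>O(N\<^sup>n)\<close> and the denominator is at least a
  multiple of \<open>N\<^sup>h\<close>, so \<open>h \<ge> n + 2\<close> leaves a summable bound \<open>N\<^sup>-\<^sup>2\<close>. For \<open>n = (k - 2)/2\<close> and \<open>2 h = r + s\<close> this
  is where \<open>r + s > k\<close> enters: for even \<open>k\<close> and \<open>r\<close>, \<open>s\<close> of the same parity it gives \<open>r + s \<ge> k + 2\<close>.\<close>
lemma poincare_term_bound:
  assumes A: "A \<in> carrier SL2Z" and rs: "r + s = 2 * h" "h \<ge> n + 2"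
    and a: "norm (a A) \<le> K * real_of_int (row_norm A) ^ n"
    and \<kappa>: "real_of_int (row_norm A) \<le> \<kappa> * (norm (jfac A z))\<^sup>2"
  shows "norm (a A) / norm (jfac A z) ^ (r + s) \<le> K * \<kappa> ^ h * (1 / real_of_int (row_norm A) ^ 2)"
proof -
  define N where "N = real_of_int (row_norm A)"
  define J where "J = (norm (jfac A z))\<^sup>2"
  have N1: "N \<ge> 1" using row_norm_pos[OF A] by (simp add: N_def)
  have NJ: "N \<le> \<kappa> * J" using \<kappa> by (simp add: N_def J_def)
  have "J \<ge> 0" by (simp add: J_def)
  moreover have "J \<noteq> 0" using NJ N1 by auto
  ultimately have J0: "J > 0" by simp
  have \<kappa>0: "\<kappa> \<ge> 0"
    using NJ N1 J0 by (smt (verit) mult_neg_pos)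
  have a': "norm (a A) \<le> K * N ^ n" using a by (simp add: N_def)
  have K0: "K \<ge> 0"
  proof (rule ccontr)
    assume "\<not> K \<ge> 0"
    hence "K * N ^ n < 0" using N1 by (intro mult_neg_pos) auto
    thus False using a' norm_ge_zero[of "a A"] by linarith
  qed
  have "N ^ n * N ^ 2 = N ^ (n + 2)" by (rule power_add[symmetric])
  also have "\<dots> \<le> N ^ h" using N1 rs by (intro power_increasing) auto
  also have "\<dots> \<le> (\<kappa> * J) ^ h" using NJ N1 by (intro power_mono) auto
  finally have le: "N ^ n * N ^ 2 \<le> \<kappa> ^ h * J ^ h" by (simp add: power_mult_distrib)
  have "norm (jfac A z) ^ (r + s) = J ^ h" unfolding rs(1) J_def power_mult ..
  hence "norm (a A) / norm (jfac A z) ^ (r + s) \<le> K * N ^ n / J ^ h"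
    using a' J0 by (simp add: divide_right_mono)
  also have "\<dots> = K * (N ^ n / J ^ h)" by simp
  also have "N ^ n / J ^ h \<le> \<kappa> ^ h / N ^ 2"
    using le J0 N1 by (simp add: divide_simps)
  finally show ?thesis using K0 by (simp add: N_def mult_left_mono)
qed

lemma poincare_abs_summable:
  assumes z: "Im z > 0" and rs: "r + s = 2 * h" "h \<ge> n + 2"
    and a: "\<And>A. A \<in> carrier SL2Z \<Longrightarrow> norm (a A) \<le> K * real_of_int (row_norm A) ^ n"
  shows "(\<lambda>K. norm (a (coset_rep K)) / norm (jfac (coset_rep K) z) ^ (r + s)) summable_on cosets"
    and "(\<lambda>K. a (coset_rep K) / aut_factor r s (coset_rep K) z) summable_on cosets"
proof -
  define \<kappa> where "\<kappa> = 2 + (1 + 2 * (Re z)\<^sup>2) / (Im z)\<^sup>2"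
  show 1: "(\<lambda>K. norm (a (coset_rep K)) / norm (jfac (coset_rep K) z) ^ (r + s)) summable_on cosets"
  proof (rule summable_on_comparison_test)
    show "(\<lambda>L. K * \<kappa> ^ h * (1 / real_of_int (row_norm (coset_rep L)) ^ 2)) summable_on cosets"
      by (intro summable_on_cmult_right summable_on_cosets)
    fix L assume "L \<in> cosets"
    note L = coset_rep_in(2)[OF this]
    show "norm (a (coset_rep L)) / norm (jfac (coset_rep L) z) ^ (r + s) \<le> K * \<kappa> ^ h * (1 / real_of_int (row_norm (coset_rep L)) ^ 2)"
      by (rule poincare_term_bound[where a = a, OF L rs a[OF L]]) (use row_norm_le_jfac[OF z] in \<open>simp add: \<kappa>_def\<close>)
  qed auto
  have "(\<lambda>K. norm (a (coset_rep K) / aut_factor r s (coset_rep K) z)) summable_on cosets"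
    using 1 by (simp add: norm_divide norm_aut_factor)
  thus "(\<lambda>K. a (coset_rep K) / aut_factor r s (coset_rep K) z) summable_on cosets"
    by (rule abs_summable_summable)
qed

text \<open>On a common square the power series norms of the terms are bounded by a constant times the absolute values
  of the terms at the centre.\<close>
lemma real_analytic_poincare_series:
  assumes z: "Im z0 > 0" and rs: "r + s = 2 * h" "h \<ge> n + 2"
    and a: "\<And>A. A \<in> carrier SL2Z \<Longrightarrow> norm (a A) \<le> K * real_of_int (row_norm A) ^ n"
  shows "real_analytic_at (poincare_series r s a) z0"
proof -
  define e where "e = Im z0 / 4"
  have e: "e > 0" using z by (simp add: e_def)
  define M where "M = (\<lambda>L. norm (a (coset_rep L)) * (2 / norm (jfac (coset_rep L) z0)) ^ (r + s))"
  have "(\<lambda>L. 2 ^ (r + s) * (norm (a (coset_rep L)) / norm (jfac (coset_rep L) z0) ^ (r + s))) summable_on cosets"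
    by (intro summable_on_cmult_right poincare_abs_summable[OF z rs a])
  hence M: "M summable_on cosets" by (simp add: M_def power_divide mult_ac)
  have "ps_norm_le z0 e (M L) (\<lambda>z. a (coset_rep L) * (1 / aut_factor r s (coset_rep L) z))" if "L \<in> cosets" for L
    unfolding M_def using coset_rep_in(2)[OF that]
    by (intro ps_norm_le_mult ps_norm_le_const ps_norm_le_inverse_aut_factor z e) (auto simp: e_def)
  hence "ps_norm_le z0 e (infsum M cosets) (\<lambda>z. \<Sum>\<^sub>\<infinity>L\<in>cosets. a (coset_rep L) * (1 / aut_factor r s (coset_rep L) z))"
    by (rule ps_norm_le_infsum[OF e _ has_sum_infsum[OF M]])
  hence "ps_norm_le z0 e (infsum M cosets) (poincare_series r s a)"
  proof (rule ps_norm_le_cong)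
    fix z assume "z \<in> square z0 e"
    hence "\<bar>Im z - Im z0\<bar> \<le> Im z0 / 4" by (simp add: square_def e_def)
    hence "Im z > 0" using z by linarith
    hence "z \<in> upper_half" by (simp add: upper_half_def)
    thus "(\<Sum>\<^sub>\<infinity>L\<in>cosets. a (coset_rep L) * (1 / aut_factor r s (coset_rep L) z)) = poincare_series r s a z"
      by (simp add: poincare_series_def)
  qed
  thus ?thesis by (rule ps_norm_le_imp_real_analytic_at[OF e])
qed

lemma poincare_series_bounded_on_strips:
  assumes rs: "r + s = 2 * h" "h \<ge> n + 2"
    and a: "\<And>A. A \<in> carrier SL2Z \<Longrightarrow> norm (a A) \<le> K * real_of_int (row_norm A) ^ n"
  shows "\<exists>M. \<forall>z. Im z \<ge> 1 \<longrightarrow> \<bar>Re z\<bar> \<le> R \<longrightarrow> norm (poincare_series r s a z) \<le> M"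
proof -
  define \<kappa> where "\<kappa> = 2 + (1 + 2 * R\<^sup>2)"
  define g where "g = (\<lambda>L. K * \<kappa> ^ h * (1 / real_of_int (row_norm (coset_rep L)) ^ 2))"
  have g: "(g has_sum infsum g cosets) cosets"
    unfolding g_def by (intro has_sum_infsum summable_on_cmult_right summable_on_cosets)
  have "norm (poincare_series r s a z) \<le> infsum g cosets" if z: "Im z \<ge> 1" "\<bar>Re z\<bar> \<le> R" for z
  proof -
    have z0: "Im z > 0" using z by simp
    have "(1 + 2 * (Re z)\<^sup>2) / (Im z)\<^sup>2 \<le> (1 + 2 * R\<^sup>2) / 1"
    proof (rule frac_le)
      have "(Re z)\<^sup>2 \<le> R\<^sup>2" using z power2_le_iff_abs_le[of R "Re z"] by simp
      thus "1 + 2 * (Re z)\<^sup>2 \<le> 1 + 2 * R\<^sup>2" by simp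
      show "1 \<le> (Im z)\<^sup>2" using z by (simp add: one_le_power)
    qed auto
    hence \<kappa>: "2 + (1 + 2 * (Re z)\<^sup>2) / (Im z)\<^sup>2 \<le> \<kappa>" by (simp add: \<kappa>_def)
    have "poincare_series r s a z = (\<Sum>\<^sub>\<infinity>L\<in>cosets. a (coset_rep L) / aut_factor r s (coset_rep L) z)"
      using z by (simp add: poincare_series_def upper_half_def)
    also have "norm \<dots> \<le> infsum g cosets"
    proof (rule norm_infsum_le[OF has_sum_infsum[OF poincare_abs_summable(2)[OF z0 rs a]] g])
      fix L assume "L \<in> cosets"
      note L = coset_rep_in(2)[OF this]
      have "real_of_int (row_norm (coset_rep L)) \<le> \<kappa> * (norm (jfac (coset_rep L) z))\<^sup>2"
        using row_norm_le_jfac[OF z0] mult_right_mono[OF \<kappa>] by (rule order_trans) simp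
      from poincare_term_bound[where a = a, OF L rs a[OF L] this]
      show "norm (a (coset_rep L) / aut_factor r s (coset_rep L) z) \<le> g L"
        by (simp add: norm_divide norm_aut_factor g_def)
    qed
    finally show ?thesis .
  qed
  thus ?thesis by blast
qed

lemma poincare_series_in_Rspace:
  assumes rs: "r + s = 2 * h" "h \<ge> n + 2"
    and a: "\<And>A. A \<in> carrier SL2Z \<Longrightarrow> norm (a A) \<le> K * real_of_int (row_norm A) ^ n"
  shows "poincare_series r s a \<in> Rspace {X. bounded X}"
  unfolding Rspace_def
proof (intro CollectI conjI allI impI ballI exI)
  show "z \<notin> upper_half \<Longrightarrow> poincare_series r s a z = 0" for z by (simp add: poincare_series_def)
  show "z \<in> upper_half \<Longrightarrow> real_analytic_at (poincare_series r s a) z" for z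
    using real_analytic_poincare_series[OF _ rs a] by (simp add: upper_half_def)
  show "(1 :: real) > 0" by simp
  fix X :: "real set" assume "X \<in> {X. bounded X}"
  then obtain R where R: "\<And>x. x \<in> X \<Longrightarrow> \<bar>x\<bar> \<le> R" by (auto simp: bounded_real)
  obtain M where M: "\<And>z. Im z \<ge> 1 \<Longrightarrow> \<bar>Re z\<bar> \<le> R \<Longrightarrow> norm (poincare_series r s a z) \<le> M"
    using poincare_series_bounded_on_strips[OF rs a, of R] by blast
  have "eventually (\<lambda>z. Im z \<ge> 1) (filtercomap Im at_top)"
    by (auto simp: eventually_filtercomap intro!: exI[of _ "\<lambda>y. y \<ge> 1"])
  hence "eventually (\<lambda>z. norm (poincare_series r s a z) \<le> \<bar>M\<bar> * norm (complex_of_real (Im z powr 1)))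
      (inf (filtercomap Im at_top) (principal {z. Re z \<in> X}))"
    unfolding eventually_inf_principal
  proof eventually_elim
    case (elim z)
    show ?case
    proof
      assume "z \<in> {z. Re z \<in> X}"
      hence "norm (poincare_series r s a z) \<le> M" using elim R by (intro M) auto
      also have "M \<le> \<bar>M\<bar> * Im z" using elim by (metis abs_ge_self abs_ge_zero mult_left_mono mult.right_neutral order_trans)
      finally show "norm (poincare_series r s a z) \<le> \<bar>M\<bar> * norm (complex_of_real (Im z powr 1))" using elim by simp
    qed
  qed
  thus "poincare_series r s a \<in> O[inf (filtercomap Im at_top) (principal {z. Re z \<in> X})](\<lambda>z. of_real (Im z powr 1))"
    by (rule bigoI)
qed


text \<open>The automorphy factor of \<open>\<plusminus>T\<^sup>n\<close> is \<open>(\<plusminus>1)\<^sup>r\<^sup>+\<^sup>s\<close>, and \<open>r + s\<close> is even.\<close>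
lemma left_invariant_poincare_term:
  assumes "even r \<longleftrightarrow> even s" "Im z > 0" "left_invariant a"
  shows "left_invariant (\<lambda>A. a A / aut_factor r s A z)"
  unfolding left_invariant_def
proof (intro ballI)
  fix P A assume P: "P \<in> Bgrp" and A: "A \<in> carrier SL2Z"
  have P21: "P$2$1 = 0" and "P$1$1 * P$2$2 = 1" using P by (auto simp: Bgrp_iff SL2Z_iff)
  hence "P$2$2 = 1 \<or> P$2$2 = -1" by (auto simp: zmult_eq_1_iff)
  moreover have "even (r + s)" using assms(1) by simp
  ultimately have "aut_factor r s P w = 1" for w
    using P21 by (auto simp: aut_factor_def jfac_def simp flip: power_add)
  moreover have "Im z \<noteq> 0" using assms(2) by simp
  ultimately have "aut_factor r s (P ** A) z = aut_factor r s A z"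
    using aut_factor_mult[OF A] by simp
  moreover have "a (P ** A) = a A" using assms(3) P A by (simp add: left_invariant_def)
  ultimately show "a (P ** A) / aut_factor r s (P ** A) z = a A / aut_factor r s A z" by simp
qed

lemma left_invariant_const: "left_invariant (\<lambda>_. c)"
  by (simp add: left_invariant_def)

lemma Eis_eq_poincare_series:
  assumes "even r \<longleftrightarrow> even s"
  shows "Eis r s = poincare_series r s (\<lambda>_. 1)"
proof
  fix z
  show "Eis r s z = poincare_series r s (\<lambda>_. 1) z"
  proof (cases "z \<in> upper_half")
    case True
    have inv: "left_invariant (\<lambda>A. 1 / aut_factor r s A z)"
      using left_invariant_poincare_term[OF assms, of z "\<lambda>_. 1"] True by (simp add: upper_half_def left_invariant_def)
    have "the_elem ((\<lambda>A. 1 / aut_factor r s A z) ` K) = 1 / aut_factor r s (coset_rep K) z" if K: "K \<in> cosets" for K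
    proof -
      have "1 / aut_factor r s A z = 1 / aut_factor r s (coset_rep K) z" if "A \<in> K" for A
        using left_invariant_coset_rep[OF inv K that] by (rule sym)
      hence "(\<lambda>A. 1 / aut_factor r s A z) ` K = (\<lambda>A. 1 / aut_factor r s (coset_rep K) z) ` K"
        by (rule image_cong[OF refl])
      also have "\<dots> = {1 / aut_factor r s (coset_rep K) z}"
        using coset_rep_in(1)[OF K] by blast
      finally have "(\<lambda>A. 1 / aut_factor r s A z) ` K = {1 / aut_factor r s (coset_rep K) z}" .
      thus ?thesis by simp
    qed
    thus ?thesis
      using True unfolding Eis_def poincare_series_def aut_factor_def[symmetric] by (simp cong: infsum_cong)
  qed (simp add: Eis_def poincare_series_def)
qed

lemma poincare_series_moebius:
  assumes z: "z \<in> upper_half" and D: "D \<in> carrier SL2Z"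
  shows "poincare_series r s a (moebius D z) / aut_factor r s D z = (\<Sum>\<^sub>\<infinity>K\<in>cosets. a (coset_rep K) / aut_factor r s (coset_rep K ** D) z)"
proof -
  have nz: "Im z \<noteq> 0" using z by (simp add: upper_half_def)
  have "poincare_series r s a (moebius D z) / aut_factor r s D z =
      (\<Sum>\<^sub>\<infinity>K\<in>cosets. a (coset_rep K) / aut_factor r s (coset_rep K) (moebius D z)) * (1 / aut_factor r s D z)"
    using moebius_upper_half_iff[OF D] z by (simp add: poincare_series_def)
  also have "\<dots> = (\<Sum>\<^sub>\<infinity>K\<in>cosets. a (coset_rep K) / aut_factor r s (coset_rep K) (moebius D z) * (1 / aut_factor r s D z))"
    by (rule infsum_cmult_left'[symmetric])
  also have "\<dots> = (\<Sum>\<^sub>\<infinity>K\<in>cosets. a (coset_rep K) / aut_factor r s (coset_rep K ** D) z)"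
    by (simp add: aut_factor_mult[OF D nz])
  finally show ?thesis .
qed

lemma poincare_series_translate:
  assumes "even r \<longleftrightarrow> even s" and z: "Im z > 0" and rs: "r + s = 2 * h" "h \<ge> n + 2"
    and a: "\<And>A. A \<in> carrier SL2Z \<Longrightarrow> norm (a A) \<le> K * real_of_int (row_norm A) ^ n"
    and "left_invariant a" and D: "D \<in> carrier SL2Z"
  shows "((\<lambda>K. a (coset_rep K ** D) / aut_factor r s (coset_rep K ** D) z) has_sum poincare_series r s a z) cosets"
  unfolding has_sum_cosets_translate[OF left_invariant_poincare_term[OF assms(1) z \<open>left_invariant a\<close>] D]
  using has_sum_infsum[OF poincare_abs_summable(2)[OF z rs a]] z by (simp add: poincare_series_def upper_half_def)

lemma Eis_in_H0R:
  assumes par: "even r \<longleftrightarrow> even s" and "r + s \<ge> 4"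
  shows "Eis r s \<in> H0R {X. bounded X} r s"
proof -
  have "even (r + s)" using par by simp
  then obtain h where h: "r + s = 2 * h" by (elim evenE)
  have h2: "h \<ge> 0 + 2" using h assms(2) by simp
  have one: "norm (1 :: complex) \<le> 1 * real_of_int (row_norm A) ^ 0" for A by simp
  have "actR r s D (Eis r s) = Eis r s" if D: "D \<in> carrier SL2Z" for D
  proof
    fix z
    show "actR r s D (Eis r s) z = Eis r s z"
    proof (cases "z \<in> upper_half")
      case True
      hence z: "Im z > 0" by (simp add: upper_half_def)
      show ?thesis
        unfolding Eis_eq_poincare_series[OF par] actR_aut_factor poincare_series_moebius[OF True D]
        by (rule infsumI[OF poincare_series_translate[OF par z h h2 one left_invariant_const D]])
    next
      case False
      thus ?thesis using moebius_upper_half_iff[OF D] by (simp add: Eis_def actR_aut_factor)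
    qed
  qed
  moreover have "Eis r s \<in> Rspace {X. bounded X}"
    unfolding Eis_eq_poincare_series[OF par] by (rule poincare_series_in_Rspace[OF h h2 one])
  ultimately show ?thesis by (simp add: H0R_def)
qed


text \<open>The sum of \<open>- \<alpha>(\<gamma>) j(\<gamma>, z)\<^sup>-\<^sup>r j(\<gamma>, z\<^sup>*)\<^sup>-\<^sup>s\<close> over the cosets, where \<open>z\<^sup>*\<close> is the conjugate of \<open>z\<close>,
  assembled from its coefficients.\<close>
definition poincare_poly :: "nat \<Rightarrow> nat \<Rightarrow> nat \<Rightarrow> cochain \<Rightarrow> complex \<Rightarrow> complex poly" where
  "poincare_poly k r s \<alpha> z = (\<Sum>i\<le>k - 2. monom (- poincare_series r s (\<lambda>A. coeff (\<alpha> A) i) z) i)"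

lemma coeff_poincare_poly:
  "coeff (poincare_poly k r s \<alpha> z) j = (if j \<le> k - 2 then - poincare_series r s (\<lambda>A. coeff (\<alpha> A) j) z else 0)"
  by (simp add: poincare_poly_def coeff_sum)

lemma cocycle_growth_poincare_series:
  assumes "even k" "k > 2" "even r \<longleftrightarrow> even s" "r + s > k" "\<alpha> \<in> Z1c Bgrp k"
  obtains K h where "r + s = 2 * h" "h \<ge> (k - 2) div 2 + 2"
    "\<And>j A. A \<in> carrier SL2Z \<Longrightarrow> norm (coeff (\<alpha> A) j) \<le> K j * real_of_int (row_norm A) ^ ((k - 2) div 2)"
proof -
  have "even (r + s)" using assms(3) by simp
  then obtain h where h: "r + s = 2 * h" by (elim evenE)
  obtain m where m: "k = 2 * m" using assms(1) by (elim evenE)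
  have "h \<ge> (k - 2) div 2 + 2" using h m assms(2,4) by simp
  moreover have "\<forall>j. \<exists>K. \<forall>A\<in>carrier SL2Z. norm (coeff (\<alpha> A) j) \<le> K * real_of_int (row_norm A) ^ ((k - 2) div 2)"
    using cocycle_growth[OF assms(1,2,5)] by blast
  from choice[OF this] obtain K where
    "\<forall>j. \<forall>A\<in>carrier SL2Z. norm (coeff (\<alpha> A) j) \<le> K j * real_of_int (row_norm A) ^ ((k - 2) div 2)" ..
  ultimately show ?thesis using that[OF h, of K] by blast
qed

lemma Z1c_Bgrp_left_invariant:
  assumes "\<alpha> \<in> Z1c Bgrp k"
  shows "left_invariant (\<lambda>A. coeff (\<alpha> A) j)"
  using assms by (auto simp: left_invariant_def Z1c_def Bgrp_iff)

text \<open>Acting by \<open>D\<close> replaces \<open>\<alpha>(\<gamma>) j(\<gamma>, z)\<^sup>-\<^sup>r \<dots>\<close> by \<open>\<alpha>(\<gamma>).D j(\<gamma>D, z)\<^sup>-\<^sup>r \<dots>\<close>, and the cocycle relation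
  \<open>\<alpha>(\<gamma>).D = \<alpha>(\<gamma>D) - \<alpha>(D)\<close> splits the sum into a translate of the original one and \<open>\<alpha>(D)\<close> times the
  Eisenstein series.\<close>
lemma poincare_poly_cobounds:
  assumes k: "even k" "k > 2" and par: "even r \<longleftrightarrow> even s" and rs: "r + s > k"
    and \<alpha>: "\<alpha> \<in> Z1c Bgrp k" and D: "D \<in> carrier SL2Z"
  shows "actRP k r s D (poincare_poly k r s \<alpha>) z - poincare_poly k r s \<alpha> z = smult (Eis r s z) (\<alpha> D)"
proof (cases "z \<in> upper_half")
  case False
  thus ?thesis using moebius_upper_half_iff[OF D]
    by (simp add: actRP_aut_factor poincare_poly_def poincare_series_def Eis_def)
next
  case True
  hence z: "Im z > 0" by (simp add: upper_half_def)
  obtain K h where h: "r + s = 2 * h" "h \<ge> (k - 2) div 2 + 2"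
    and K: "\<And>j A. A \<in> carrier SL2Z \<Longrightarrow> norm (coeff (\<alpha> A) j) \<le> K j * real_of_int (row_norm A) ^ ((k - 2) div 2)"
    by (rule cocycle_growth_poincare_series[OF k par rs \<alpha>]) (rule that)
  have one: "norm (1 :: complex) \<le> 1 * real_of_int (row_norm A) ^ 0" for A by simp
  have h2: "h \<ge> 0 + 2" using h by simp
  have deg: "coeff (\<alpha> D) j = 0" if "j > k - 2" for j
    using \<alpha> D that by (intro coeff_eq_0) (auto simp: Z1c_def Ppoly_def)
  show ?thesis
  proof (rule poly_eqI)
    fix j
    show "coeff (actRP k r s D (poincare_poly k r s \<alpha>) z - poincare_poly k r s \<alpha> z) j = coeff (smult (Eis r s z) (\<alpha> D)) j"
    proof (cases "j \<le> k - 2")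
      case False
      have "degree (actP k D p) < j" for p using actP_in_Ppoly[of k D p] False by (simp add: Ppoly_def)
      thus ?thesis using False by (simp add: actRP_aut_factor coeff_poincare_poly deg coeff_eq_0)
    next
      case j: True
      let ?w = "\<lambda>L. aut_factor r s (coset_rep L ** D) z"
      have summ: "(\<lambda>L. coeff (\<alpha> (coset_rep L)) i / ?w L) summable_on cosets" for i
      proof -
        define w where "w = moebius D z"
        have w: "Im w > 0" using moebius_upper_half_iff[OF D] True by (simp add: w_def upper_half_def)
        from poincare_abs_summable(2)[OF w h K]
        have "(\<lambda>L. coeff (\<alpha> (coset_rep L)) i / aut_factor r s (coset_rep L) w) summable_on cosets" .
        hence "(\<lambda>L. coeff (\<alpha> (coset_rep L)) i / aut_factor r s (coset_rep L) w * (1 / aut_factor r s D z)) summable_on cosets"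
          by (rule summable_on_cmult_left)
        thus ?thesis using z by (simp add: aut_factor_mult[OF D] w_def)
      qed
      have mov: "poincare_series r s (\<lambda>A. coeff (\<alpha> A) i) (moebius D z) / aut_factor r s D z =
          infsum (\<lambda>L. coeff (\<alpha> (coset_rep L)) i / ?w L) cosets" for i
        by (rule poincare_series_moebius[OF True D])
      have "((\<lambda>L. (\<Sum>i\<le>k - 2. coeff (\<alpha> (coset_rep L)) i / ?w L * actP_coeff k D i j)) has_sum
          (\<Sum>i\<le>k - 2. infsum (\<lambda>L. coeff (\<alpha> (coset_rep L)) i / ?w L) cosets * actP_coeff k D i j)) cosets"
        by (intro has_sum_finite_sum has_sum_cmult_left has_sum_infsum summ)
      moreover have "(\<Sum>i\<le>k - 2. coeff (\<alpha> (coset_rep L)) i / ?w L * actP_coeff k D i j) =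
          coeff (\<alpha> (coset_rep L ** D)) j / ?w L - coeff (\<alpha> D) j * (1 / ?w L)" if L: "L \<in> cosets" for L
      proof -
        have "\<alpha> (coset_rep L ** D) = actP k D (\<alpha> (coset_rep L)) + \<alpha> D"
          using \<alpha> D coset_rep_in(2)[OF L] by (simp add: Z1c_def)
        hence "coeff (\<alpha> (coset_rep L ** D)) j - coeff (\<alpha> D) j = coeff (actP k D (\<alpha> (coset_rep L))) j" by simp
        hence "coeff (\<alpha> (coset_rep L ** D)) j / ?w L - coeff (\<alpha> D) j * (1 / ?w L) =
            coeff (actP k D (\<alpha> (coset_rep L))) j / ?w L" by (simp flip: diff_divide_distrib)
        thus ?thesis by (simp add: coeff_actP sum_divide_distrib)
      qed
      ultimately have 1: "((\<lambda>L. coeff (\<alpha> (coset_rep L ** D)) j / ?w L - coeff (\<alpha> D) j * (1 / ?w L)) has_sum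
          (\<Sum>i\<le>k - 2. infsum (\<lambda>L. coeff (\<alpha> (coset_rep L)) i / ?w L) cosets * actP_coeff k D i j)) cosets"
        by (simp cong: has_sum_cong)
      have 2: "((\<lambda>L. coeff (\<alpha> (coset_rep L ** D)) j / ?w L - coeff (\<alpha> D) j * (1 / ?w L)) has_sum
          (poincare_series r s (\<lambda>A. coeff (\<alpha> A) j) z - coeff (\<alpha> D) j * Eis r s z)) cosets"
        unfolding Eis_eq_poincare_series[OF par]
        by (intro has_sum_minus has_sum_cmult_right poincare_series_translate[OF par z h K Z1c_Bgrp_left_invariant[OF \<alpha>] D]
            poincare_series_translate[OF par z h(1) h2 one left_invariant_const D])
      have "coeff (actRP k r s D (poincare_poly k r s \<alpha>) z) j =
          - (\<Sum>i\<le>k - 2. (poincare_series r s (\<lambda>A. coeff (\<alpha> A) i) (moebius D z) / aut_factor r s D z) * actP_coeff k D i j)"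
        by (simp add: actRP_aut_factor coeff_actP coeff_poincare_poly sum_negf sum_divide_distrib)
      also have "\<dots> = - (poincare_series r s (\<lambda>A. coeff (\<alpha> A) j) z - coeff (\<alpha> D) j * Eis r s z)"
        unfolding mov has_sum_unique[OF 1 2] ..
      finally show ?thesis using j by (simp add: coeff_poincare_poly)
    qed
  qed
qed

lemma coeff_poincare_poly_in_Rspace:
  assumes "even k" "k > 2" "even r \<longleftrightarrow> even s" "r + s > k" "\<alpha> \<in> Z1c Bgrp k"
  shows "(\<lambda>z. coeff (poincare_poly k r s \<alpha> z) j) \<in> Rspace {X. bounded X}"
proof (cases "j \<le> k - 2")
  case True
  obtain K h where h: "r + s = 2 * h" "h \<ge> (k - 2) div 2 + 2"
    and K: "\<And>j A. A \<in> carrier SL2Z \<Longrightarrow> norm (coeff (\<alpha> A) j) \<le> K j * real_of_int (row_norm A) ^ ((k - 2) div 2)"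
    by (rule cocycle_growth_poincare_series[OF assms]) (rule that)
  have "poincare_series r s (\<lambda>A. coeff (\<alpha> A) j) \<in> Rspace {X. bounded X}"
    by (rule poincare_series_in_Rspace[OF h K])
  from fun_subspace_uminus[OF fun_subspace_Rspace this] True show ?thesis
    by (simp add: coeff_poincare_poly fun_Compl_def)
next
  case False
  thus ?thesis using fun_subspace_Rspace[of "{X. bounded X}"] by (simp add: coeff_poincare_poly fun_subspace_def zero_fun_def)
qed


section \<open>Additive groups and their quotients\<close>

definition add_subgroup :: "'a::ab_group_add set \<Rightarrow> bool" where
  "add_subgroup A \<longleftrightarrow> 0 \<in> A \<and> (\<forall>x\<in>A. \<forall>y\<in>A. x - y \<in> A)"

lemma add_subgroupD:
  assumes "add_subgroup A"
  shows "0 \<in> A" "x \<in> A \<Longrightarrow> y \<in> A \<Longrightarrow> x - y \<in> A" "x \<in> A \<Longrightarrow> - x \<in> A" "x \<in> A \<Longrightarrow> y \<in> A \<Longrightarrow> x + y \<in> A"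
proof -
  show 0: "0 \<in> A" and diff: "x \<in> A \<Longrightarrow> y \<in> A \<Longrightarrow> x - y \<in> A" for x y
    using assms by (auto simp: add_subgroup_def)
  show neg: "x \<in> A \<Longrightarrow> - x \<in> A" for x using diff[OF 0] by simp
  show "x \<in> A \<Longrightarrow> y \<in> A \<Longrightarrow> x + y \<in> A" for x y using diff[of x "- y"] neg by simp
qed

lemma carrier_addgrp [simp]: "carrier (addgrp A) = A"
  and mult_addgrp [simp]: "x \<otimes>\<^bsub>addgrp A\<^esub> y = x + y"
  and one_addgrp [simp]: "\<one>\<^bsub>addgrp A\<^esub> = 0"
  by (simp_all add: addgrp_def)

lemma comm_group_addgrp:
  assumes "add_subgroup A"
  shows "comm_group (addgrp A)"
proof (rule comm_groupI)
  fix x assume "x \<in> carrier (addgrp A)"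
  thus "\<exists>y\<in>carrier (addgrp A). y \<otimes>\<^bsub>addgrp A\<^esub> x = \<one>\<^bsub>addgrp A\<^esub>"
    using add_subgroupD(3)[OF assms] by (intro bexI[of _ "- x"]) auto
qed (auto simp: add_subgroupD[OF assms] add_ac)

lemma group_addgrp: "add_subgroup A \<Longrightarrow> group (addgrp A)"
  using comm_group_addgrp comm_group.axioms(2) by blast

lemma inv_addgrp:
  assumes "add_subgroup A" "x \<in> A"
  shows "inv\<^bsub>addgrp A\<^esub> x = - x"
  by (rule group.inv_equality[OF group_addgrp]) (use assms add_subgroupD in auto)

lemma subgroup_addgrp:
  assumes A: "add_subgroup A" and N: "add_subgroup N" and "N \<subseteq> A"
  shows "subgroup N (addgrp A)"
proof (rule group.subgroupI[OF group_addgrp[OF A]])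
  show "N \<subseteq> carrier (addgrp A)" using assms by simp
  show "N \<noteq> {}" using add_subgroupD(1)[OF N] by blast
  fix x assume "x \<in> N"
  thus "inv\<^bsub>addgrp A\<^esub> x \<in> N" using assms(3) by (subst inv_addgrp[OF A]) (auto intro: add_subgroupD(3)[OF N])
qed (auto simp: add_subgroupD[OF N])

definition coset :: "'a::ab_group_add set \<Rightarrow> 'a \<Rightarrow> 'a set" where
  "coset N x = (\<lambda>n. n + x) ` N"

lemma r_coset_addgrp: "N #>\<^bsub>addgrp A\<^esub> x = coset N x"
  by (auto simp: r_coset_def coset_def)

lemma coset_eq_iff:
  assumes "add_subgroup N"
  shows "coset N x = coset N y \<longleftrightarrow> x - y \<in> N"
proof
  assume "coset N x = coset N y"
  moreover have "x \<in> coset N x" using add_subgroupD(1)[OF assms] by (force simp: coset_def)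
  ultimately obtain n where "n \<in> N" "x = n + y" by (auto simp: coset_def)
  thus "x - y \<in> N" by simp
next
  assume xy: "x - y \<in> N"
  have *: "coset N a \<subseteq> coset N b" if "a - b \<in> N" for a b
  proof
    fix w assume "w \<in> coset N a"
    then obtain n where n: "n \<in> N" "w = n + a" by (auto simp: coset_def)
    hence "w = (n + (a - b)) + b" "n + (a - b) \<in> N" using add_subgroupD(4)[OF assms] that by auto
    thus "w \<in> coset N b" unfolding coset_def by blast
  qed
  have "y - x \<in> N" using add_subgroupD(3)[OF assms xy] by simp
  thus "coset N x = coset N y" using *[OF xy] * by blast
qed

lemma coset_0 [simp]: "coset N 0 = N"
  by (simp add: coset_def)

lemma mem_coset: "add_subgroup N \<Longrightarrow> x \<in> coset N x"
  using add_subgroupD(1)[of N] by (force simp: coset_def)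

lemma
  assumes A: "add_subgroup A" and N: "add_subgroup N" and NA: "N \<subseteq> A"
  shows comm_group_quotient: "comm_group (addgrp A Mod N)"
    and mult_quotient: "x \<in> A \<Longrightarrow> y \<in> A \<Longrightarrow>
      coset N x \<otimes>\<^bsub>addgrp A Mod N\<^esub> coset N y = coset N (x + y)"
proof -
  interpret comm_group "addgrp A" by (rule comm_group_addgrp[OF A])
  note sub = subgroup_addgrp[OF A N NA]
  show "comm_group (addgrp A Mod N)" by (rule abelian_FactGroup[OF sub])
  have "N \<lhd> addgrp A" using sub by (simp add: normal_iff_subgroup)
  from normal.rcos_sum[OF this, of x y]
  show "x \<in> A \<Longrightarrow> y \<in> A \<Longrightarrow> coset N x \<otimes>\<^bsub>addgrp A Mod N\<^esub> coset N y = coset N (x + y)"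
    by (simp add: r_coset_addgrp)
qed

lemma carrier_quotient: "carrier (addgrp A Mod N) = coset N ` A"
  by (simp add: carrier_FactGroup r_coset_addgrp)

lemma short_exact_iso:
  assumes ex: "short_exact G1 f G2 g G3" and h: "h \<in> iso G3 G4" and G4: "group G4"
  shows "short_exact G1 f G2 (\<lambda>x. h (g x)) G4"
proof -
  interpret g: group_hom G2 G3 g using ex by (simp add: short_exact_def)
  have G3: "group G3" by (rule g.H.group_axioms)
  interpret h: group_hom G3 G4 h
    using G3 G4 h by (simp add: group_hom_def group_hom_axioms_def iso_def)
  have bij: "bij_betw h (carrier G3) (carrier G4)" using h by (simp add: iso_def)
  have "group_hom G2 G4 (\<lambda>x. h (g x))"
    using g.G.group_axioms G4 by (auto simp: group_hom_def group_hom_axioms_def hom_def)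
  moreover have "kernel G2 G4 (\<lambda>x. h (g x)) = kernel G2 G3 g"
  proof -
    have "h (g x) = \<one>\<^bsub>G4\<^esub> \<longleftrightarrow> g x = \<one>\<^bsub>G3\<^esub>" if "x \<in> carrier G2" for x
      using bij_betw_imp_inj_on[OF bij] that h.hom_one g.hom_closed g.H.one_closed
      by (metis inj_on_eq_iff)
    thus ?thesis by (auto simp: kernel_def)
  qed
  moreover have "(\<lambda>x. h (g x)) ` carrier G2 = carrier G4"
    using ex bij_betw_imp_surj_on[OF bij] by (simp add: short_exact_def image_image[symmetric])
  ultimately show ?thesis using ex by (simp add: short_exact_def)
qed


section \<open>Tensor products\<close>

lemma restrict_UNIV_eq [simp]: "(\<lambda>i\<in>UNIV. f i) = f"
  by (simp add: restrict_def)

lemma group_product_UNIV: "comm_group W \<Longrightarrow> group (product_group UNIV (\<lambda>_. W))"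
  by (simp add: comm_group.axioms(2))

lemma group_tensor: "comm_group W \<Longrightarrow> group (tensor sc V W)"
  unfolding tensor_def by (intro group.group_subgroup_generated group_product_UNIV)

lemma mult_tensor: "x \<otimes>\<^bsub>tensor sc V W\<^esub> y = (\<lambda>z. x z \<otimes>\<^bsub>W\<^esub> y z)"
  by (simp add: tensor_def)

lemma one_tensor: "\<one>\<^bsub>tensor sc V W\<^esub> = (\<lambda>z. \<one>\<^bsub>W\<^esub>)"
  by (simp add: tensor_def)

lemma carrier_tensor_subset:
  assumes "comm_group W" "subgroup H (product_group UNIV (\<lambda>_. W))"
    and "\<And>v w. v \<in> V \<Longrightarrow> w \<in> carrier W \<Longrightarrow> (\<lambda>z. sc (v z) w) \<in> H"
  shows "carrier (tensor sc V W) \<subseteq> H"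
  unfolding tensor_def
  by (rule group.subgroup_generated_minimal[OF group_product_UNIV[OF assms(1)] assms(2)])
     (use assms(3) in auto)

lemma pure_tensor_in:
  assumes "v \<in> V" "w \<in> carrier W" "\<And>c w. w \<in> carrier W \<Longrightarrow> sc c w \<in> carrier W"
  shows "(\<lambda>z. sc (v z) w) \<in> carrier (tensor sc V W)"
  unfolding tensor_def carrier_subgroup_generated
  by (rule generate.incl) (use assms in auto)

lemma tensor_mult_closed:
  assumes "comm_group W" "F \<in> carrier (tensor sc V W)" "G \<in> carrier (tensor sc V W)"
  shows "(\<lambda>z. F z \<otimes>\<^bsub>W\<^esub> G z) \<in> carrier (tensor sc V W)"
proof -
  interpret group "tensor sc V W" by (rule group_tensor[OF assms(1)])
  show ?thesis using m_closed[OF assms(2,3)] by (simp add: mult_tensor)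
qed

definition poly_subspace :: "complex poly set \<Rightarrow> bool" where
  "poly_subspace P \<longleftrightarrow> add_subgroup P \<and> (\<forall>c. \<forall>p\<in>P. smult c p \<in> P)"

lemma poly_subspace_Ppoly: "poly_subspace (Ppoly k)"
  by (auto simp: poly_subspace_def add_subgroup_def Ppoly_def intro: degree_diff_le order_trans[OF degree_smult_le])

lemma poly_subspace_Pc: "poly_subspace (Pc Par k)"
  using poly_subspace_Ppoly[of k]
  by (auto simp: poly_subspace_def add_subgroup_def Pc_def actP_diff actP_smult)

lemma add_subgroup_fun_subspace: "fun_subspace V \<Longrightarrow> add_subgroup V"
  using fun_subspace_uminus[of V] unfolding add_subgroup_def fun_subspace_def
  by (metis diff_conv_add_uminus)

lemma tensorP_coeff:
  assumes V: "fun_subspace V" and P: "poly_subspace P" and F: "F \<in> carrier (tensorP V P)"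
  shows "F z \<in> P" "(\<lambda>z. coeff (F z) i) \<in> V"
proof -
  have P': "add_subgroup P" using P by (simp add: poly_subspace_def)
  note V' = add_subgroup_fun_subspace[OF V]
  define H where "H = {F. (\<forall>z. F z \<in> P) \<and> (\<forall>i. (\<lambda>z. coeff (F z) i) \<in> V)}"
  interpret group "product_group UNIV (\<lambda>_::complex. addgrp P)"
    by (rule group_product_UNIV[OF comm_group_addgrp[OF P']])
  have "subgroup H (product_group UNIV (\<lambda>_. addgrp P))"
  proof (rule subgroupI)
    show "H \<subseteq> carrier (product_group UNIV (\<lambda>_. addgrp P))" by (auto simp: H_def)
    have "(\<lambda>z. 0) \<in> H"
      using add_subgroupD(1)[OF P'] V by (auto simp: H_def fun_subspace_def zero_fun_def)
    thus "H \<noteq> {}" by blast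
  next
    fix a assume a: "a \<in> H"
    have "inv\<^bsub>product_group UNIV (\<lambda>_. addgrp P)\<^esub> a = (\<lambda>z. - a z)"
      using a by (subst inv_product_group) (auto simp: H_def inv_addgrp[OF P'] group_addgrp[OF P'])
    moreover have "(\<lambda>z. - a z) \<in> H"
      using a add_subgroupD(3)[OF P'] fun_subspace_uminus[OF V] by (auto simp: H_def fun_Compl_def)
    ultimately show "inv\<^bsub>product_group UNIV (\<lambda>_. addgrp P)\<^esub> a \<in> H" by simp
  next
    fix a b assume ab: "a \<in> H" "b \<in> H"
    have "(\<lambda>z. coeff (a z) i + coeff (b z) i) \<in> V" for i
      using add_subgroupD(4)[OF V', of "\<lambda>z. coeff (a z) i" "\<lambda>z. coeff (b z) i"] ab
      by (simp add: H_def plus_fun_def)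
    thus "a \<otimes>\<^bsub>product_group UNIV (\<lambda>_. addgrp P)\<^esub> b \<in> H"
      using ab add_subgroupD(4)[OF P'] by (auto simp: H_def)
  qed
  moreover have "(\<lambda>z. smult (v z) w) \<in> H" if "v \<in> V" "w \<in> carrier (addgrp P)" for v w
  proof -
    have "(\<lambda>z. coeff w i * v z) \<in> V" for i using V that by (simp add: fun_subspace_def)
    thus ?thesis using P that by (simp add: H_def poly_subspace_def mult.commute)
  qed
  ultimately have "carrier (tensorP V P) \<subseteq> H"
    by (intro carrier_tensor_subset comm_group_addgrp[OF P'])
  thus "F z \<in> P" "(\<lambda>z. coeff (F z) i) \<in> V" using F by (auto simp: H_def)
qed

lemma tensorP_sum:
  assumes P: "poly_subspace P" and "\<And>i. i \<in> I \<Longrightarrow> F i \<in> carrier (tensorP V P)"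
  shows "(\<lambda>z. \<Sum>i\<in>I. F i z) \<in> carrier (tensorP V P)"
proof -
  have P': "add_subgroup P" using P by (simp add: poly_subspace_def)
  note cg = comm_group_addgrp[OF P']
  have zero: "(\<lambda>z. 0) \<in> carrier (tensorP V P)"
    using monoid.one_closed[OF group.is_monoid[OF group_tensor[OF cg, of smult V]]]
    by (simp add: one_tensor)
  show ?thesis
    using assms(2)
  proof (induction I rule: infinite_finite_induct)
    case (insert i I)
    thus ?case using tensor_mult_closed[OF cg, of "F i" smult V "\<lambda>z. \<Sum>i\<in>I. F i z"] by simp
  qed (simp_all add: zero)
qed

text \<open>The monomials are a basis of the polynomials, so membership in the tensor product is tested on coefficients.\<close>
lemma tensorP_Ppoly_iff:
  assumes V: "fun_subspace V"
  shows "F \<in> carrier (tensorP V (Ppoly k)) \<longleftrightarrow> (\<forall>z. F z \<in> Ppoly k) \<and> (\<forall>i. (\<lambda>z. coeff (F z) i) \<in> V)"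
proof
  assume "F \<in> carrier (tensorP V (Ppoly k))"
  from tensorP_coeff[OF V poly_subspace_Ppoly this]
  show "(\<forall>z. F z \<in> Ppoly k) \<and> (\<forall>i. (\<lambda>z. coeff (F z) i) \<in> V)" by blast
next
  assume F: "(\<forall>z. F z \<in> Ppoly k) \<and> (\<forall>i. (\<lambda>z. coeff (F z) i) \<in> V)"
  have "(\<lambda>z. smult (coeff (F z) i) (monom 1 i)) \<in> carrier (tensorP V (Ppoly k))" if "i \<le> k - 2" for i
    using F that poly_subspace_Ppoly[of k]
    by (intro pure_tensor_in[where v = "\<lambda>z. coeff (F z) i"])
       (auto simp: Ppoly_def degree_monom_eq poly_subspace_def)
  hence "(\<lambda>z. \<Sum>i\<le>k - 2. smult (coeff (F z) i) (monom 1 i)) \<in> carrier (tensorP V (Ppoly k))"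
    by (intro tensorP_sum poly_subspace_Ppoly) auto
  moreover have "(\<Sum>i\<le>k - 2. smult (coeff (F z) i) (monom 1 i)) = F z" for z
  proof (rule poly_eqI)
    fix j
    have "j > k - 2 \<Longrightarrow> coeff (F z) j = 0" using F by (auto simp: Ppoly_def intro!: coeff_eq_0 intro: le_less_trans)
    thus "coeff (\<Sum>i\<le>k - 2. smult (coeff (F z) i) (monom 1 i)) j = coeff (F z) j"
      by (simp add: coeff_sum if_distrib[of "\<lambda>x. _ * x"] not_le[symmetric] cong: if_cong)
  qed
  ultimately show "F \<in> carrier (tensorP V (Ppoly k))" by simp
qed

lemma add_subgroup_tensorP:
  assumes P: "poly_subspace P"
  shows "add_subgroup (carrier (tensorP V P))"
proof -
  have P': "add_subgroup P" using P by (simp add: poly_subspace_def)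
  note cg = comm_group_addgrp[OF P']
  interpret PG: group "product_group UNIV (\<lambda>_::complex. addgrp P)" by (rule group_product_UNIV[OF cg])
  interpret group "tensorP V P" by (rule group_tensor[OF cg])
  show ?thesis
    unfolding add_subgroup_def
  proof (intro conjI ballI)
    show "0 \<in> carrier (tensorP V P)" using one_closed by (simp add: one_tensor zero_fun_def)
    fix F G assume F: "F \<in> carrier (tensorP V P)" and G: "G \<in> carrier (tensorP V P)"
    have Gz: "G \<in> carrier (product_group UNIV (\<lambda>_::complex. addgrp P))"
      using G PG.carrier_subgroup_generated_subset unfolding tensor_def by blast
    hence GP: "G z \<in> P" for z by (auto simp: PiE_iff)
    have "inv\<^bsub>tensorP V P\<^esub> G = (\<lambda>z. - G z)"
      using G Gz unfolding tensor_def
      by (simp add: PG.inv_subgroup_generated inv_addgrp[OF P' GP] group_addgrp[OF P'])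
    hence "(\<lambda>z. - G z) \<in> carrier (tensorP V P)" using inv_closed[OF G] by simp
    from m_closed[OF F this] show "F - G \<in> carrier (tensorP V P)"
      by (simp add: mult_tensor fun_diff_def)
  qed
qed

text \<open>On a line, scalars move to the second factor and every tensor is pure.\<close>
lemma carrier_tensor_line:
  assumes W: "comm_group W"
    and closed: "\<And>c w. w \<in> carrier W \<Longrightarrow> sc c w \<in> carrier W"
    and dist: "\<And>c w w'. w \<in> carrier W \<Longrightarrow> w' \<in> carrier W \<Longrightarrow> sc c (w \<otimes>\<^bsub>W\<^esub> w') = sc c w \<otimes>\<^bsub>W\<^esub> sc c w'"
    and assoc: "\<And>c d w. w \<in> carrier W \<Longrightarrow> sc c (sc d w) = sc (d * c) w"
  shows "carrier (tensor sc (Mtilde_line r s) W) = {\<lambda>z. sc (Eis r s z) w | w. w \<in> carrier W}" (is "_ = ?H")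
proof
  interpret W: comm_group W by (rule W)
  interpret PG: group "product_group UNIV (\<lambda>_::complex. W)" by (rule group_product_UNIV[OF W])
  have inv: "inv\<^bsub>W\<^esub> (sc c w) = sc c (inv\<^bsub>W\<^esub> w)" if w: "w \<in> carrier W" for c w
  proof -
    have one: "sc c \<one>\<^bsub>W\<^esub> = \<one>\<^bsub>W\<^esub>"
      using dist[of "\<one>\<^bsub>W\<^esub>" "\<one>\<^bsub>W\<^esub>" c] closed[of "\<one>\<^bsub>W\<^esub>" c] by simp
    show ?thesis
      by (rule W.inv_equality) (use w closed dist[of "inv\<^bsub>W\<^esub> w" w c] one in auto)
  qed
  have "subgroup ?H (product_group UNIV (\<lambda>_. W))"
  proof (rule PG.subgroupI)
    show "?H \<subseteq> carrier (product_group UNIV (\<lambda>_. W))" using closed by auto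
    show "?H \<noteq> {}" using W.one_closed by blast
  next
    fix a assume "a \<in> ?H"
    then obtain w where w: "w \<in> carrier W" "a = (\<lambda>z. sc (Eis r s z) w)" by blast
    have "inv\<^bsub>product_group UNIV (\<lambda>_. W)\<^esub> a = (\<lambda>z. sc (Eis r s z) (inv\<^bsub>W\<^esub> w))"
      using w closed by (subst inv_product_group) (auto simp: inv)
    thus "inv\<^bsub>product_group UNIV (\<lambda>_. W)\<^esub> a \<in> ?H" using W.inv_closed[OF w(1)] by blast
  next
    fix a b assume "a \<in> ?H" "b \<in> ?H"
    then obtain w w' where w: "w \<in> carrier W" "a = (\<lambda>z. sc (Eis r s z) w)"
      "w' \<in> carrier W" "b = (\<lambda>z. sc (Eis r s z) w')" by blast
    hence "a \<otimes>\<^bsub>product_group UNIV (\<lambda>_. W)\<^esub> b = (\<lambda>z. sc (Eis r s z) (w \<otimes>\<^bsub>W\<^esub> w'))"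
      by (simp add: dist)
    thus "a \<otimes>\<^bsub>product_group UNIV (\<lambda>_. W)\<^esub> b \<in> ?H" using W.m_closed[OF w(1,3)] by blast
  qed
  moreover have "(\<lambda>z. sc (v z) w) \<in> ?H" if v: "v \<in> Mtilde_line r s" and w: "w \<in> carrier W" for v w
  proof -
    obtain c where "v = (\<lambda>z. c * Eis r s z)" using v by (auto simp: Mtilde_line_def)
    hence "(\<lambda>z. sc (v z) w) = (\<lambda>z. sc (Eis r s z) (sc c w))" using assoc[OF w] by simp
    thus ?thesis using closed[OF w] by blast
  qed
  ultimately show "carrier (tensor sc (Mtilde_line r s) W) \<subseteq> ?H"
    by (rule carrier_tensor_subset[OF W])
  have "Eis r s \<in> Mtilde_line r s" unfolding Mtilde_line_def by (intro CollectI exI[of _ 1]) simp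
  thus "?H \<subseteq> carrier (tensor sc (Mtilde_line r s) W)"
    using pure_tensor_in[of "Eis r s" _ _ W sc] closed by blast
qed


section \<open>Cocycles and cohomology\<close>

definition coboundary :: "nat \<Rightarrow> complex poly \<Rightarrow> cochain" where
  "coboundary k p = (\<lambda>A. if A \<in> carrier SL2Z then actP k A p - p else 0)"

lemma B1c_iff: "\<alpha> \<in> B1c Par k \<longleftrightarrow> (\<exists>p\<in>Ppoly k. \<alpha> = coboundary k p) \<and> (\<forall>\<pi>\<in>Par. \<alpha> \<pi> = 0)"
  by (simp add: B1c_def coboundary_def)

lemma coboundary_in_B1c:
  assumes "p \<in> Pc Par k"
  shows "coboundary k p \<in> B1c Par k"
  using assms by (auto simp: B1c_iff Pc_def coboundary_def)

lemma B1cE: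
  assumes "\<alpha> \<in> B1c Par k" "Par \<subseteq> carrier SL2Z"
  obtains p where "p \<in> Pc Par k" "\<alpha> = coboundary k p"
proof -
  obtain p where p: "p \<in> Ppoly k" "\<alpha> = coboundary k p" "\<forall>\<pi>\<in>Par. \<alpha> \<pi> = 0"
    using assms(1) by (auto simp: B1c_iff)
  have "actP k \<pi> p = p" if "\<pi> \<in> Par" for \<pi>
  proof -
    have "coboundary k p \<pi> = 0" "\<pi> \<in> carrier SL2Z" using p that assms(2) by auto
    thus ?thesis by (simp add: coboundary_def)
  qed
  hence "p \<in> Pc Par k" using p(1) by (simp add: Pc_def)
  thus ?thesis using that p(2) by blast
qed

lemma add_subgroup_Z1c: "add_subgroup (Z1c Par k)"
  using poly_subspace_Ppoly[of k]
  by (auto simp: add_subgroup_def Z1c_def actP_diff poly_subspace_def)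

lemma cscale_Z1c: "\<alpha> \<in> Z1c Par k \<Longrightarrow> cscale c \<alpha> \<in> Z1c Par k"
  using poly_subspace_Ppoly[of k]
  by (auto simp: Z1c_def cscale_def actP_smult smult_add_right poly_subspace_def)

lemma coboundary_diff: "coboundary k p - coboundary k q = coboundary k (p - q)"
  by (auto simp: coboundary_def fun_eq_iff actP_diff)

lemma coboundary_smult: "cscale c (coboundary k p) = coboundary k (smult c p)"
  by (auto simp: coboundary_def fun_eq_iff cscale_def actP_smult smult_diff_right)

lemma add_subgroup_B1c: "add_subgroup (B1c Par k)"
  unfolding add_subgroup_def
proof (intro conjI ballI)
  have "coboundary k 0 = 0" by (auto simp: coboundary_def)
  moreover have "0 \<in> Pc Par k" by (auto simp: Pc_def Ppoly_def)
  ultimately show "0 \<in> B1c Par k" using coboundary_in_B1c by metis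
  fix \<alpha> \<beta> assume ab: "\<alpha> \<in> B1c Par k" "\<beta> \<in> B1c Par k"
  then obtain p q where "p \<in> Ppoly k" "q \<in> Ppoly k" "\<alpha> = coboundary k p" "\<beta> = coboundary k q"
    by (auto simp: B1c_iff)
  hence "p - q \<in> Ppoly k" "\<alpha> - \<beta> = coboundary k (p - q)"
    using poly_subspace_Ppoly[of k] by (auto simp: coboundary_diff poly_subspace_def add_subgroup_def)
  moreover have "\<forall>\<pi>\<in>Par. (\<alpha> - \<beta>) \<pi> = 0" using ab by (simp add: B1c_iff)
  ultimately show "\<alpha> - \<beta> \<in> B1c Par k" unfolding B1c_iff by blast
qed

lemma cscale_B1c: "\<alpha> \<in> B1c Par k \<Longrightarrow> cscale c \<alpha> \<in> B1c Par k"
  using poly_subspace_Ppoly[of k]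
  by (auto simp: B1c_iff coboundary_smult poly_subspace_def) (auto simp: cscale_def coboundary_def smult_diff_right actP_smult)

lemma B1c_subset_Z1c: "Par \<subseteq> carrier SL2Z \<Longrightarrow> B1c Par k \<subseteq> Z1c Par k"
proof
  fix \<alpha> assume "\<alpha> \<in> B1c Par k"
  then obtain p where p: "p \<in> Ppoly k" "\<alpha> = coboundary k p" "\<forall>\<pi>\<in>Par. \<alpha> \<pi> = 0" by (auto simp: B1c_iff)
  have "\<alpha> A \<in> Ppoly k" for A
    using p(1) actP_in_Ppoly[of k A p] poly_subspace_Ppoly[of k]
    by (auto simp: p(2) coboundary_def poly_subspace_def add_subgroup_def)
  moreover have "\<alpha> (A ** B) = actP k B (\<alpha> A) + \<alpha> B" if "A \<in> carrier SL2Z" "B \<in> carrier SL2Z" for A B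
    using that by (simp add: p(2) coboundary_def SL2Z_mult actP_mult[OF p(1)] actP_diff)
  moreover have "\<alpha> A = 0" if "A \<notin> carrier SL2Z" for A using that by (simp add: p(2) coboundary_def)
  ultimately show "\<alpha> \<in> Z1c Par k" using p(3) unfolding Z1c_def by blast
qed

lemma cscale_add: "cscale c (\<alpha> + \<beta>) = cscale c \<alpha> + cscale c \<beta>"
  by (simp add: cscale_def fun_eq_iff smult_add_right)

lemma cscale_cscale: "cscale c (cscale d \<alpha>) = cscale (d * c) \<alpha>"
  by (simp add: cscale_def fun_eq_iff mult.commute)

lemma H1scale_coset: "H1scale Par k c (coset (B1c Par k) \<alpha>) = coset (B1c Par k) (cscale c \<alpha>)"
proof
  note sub = add_subgroup_B1c[of Par k]
  show "H1scale Par k c (coset (B1c Par k) \<alpha>) \<subseteq> coset (B1c Par k) (cscale c \<alpha>)"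
  proof
    fix w assume "w \<in> H1scale Par k c (coset (B1c Par k) \<alpha>)"
    then obtain \<beta> \<beta>' where b: "\<beta> \<in> B1c Par k" "\<beta>' \<in> B1c Par k" "w = cscale c (\<beta> + \<alpha>) + \<beta>'"
      by (auto simp: H1scale_def coset_def)
    hence "w = (cscale c \<beta> + \<beta>') + cscale c \<alpha>" by (simp add: cscale_add)
    moreover have "cscale c \<beta> + \<beta>' \<in> B1c Par k" by (intro add_subgroupD(4)[OF sub] cscale_B1c b)
    ultimately show "w \<in> coset (B1c Par k) (cscale c \<alpha>)" unfolding coset_def by blast
  qed
  show "coset (B1c Par k) (cscale c \<alpha>) \<subseteq> H1scale Par k c (coset (B1c Par k) \<alpha>)"
    using mem_coset[OF sub, of \<alpha>] by (auto simp: H1scale_def coset_def[of _ "cscale c \<alpha>"] add.commute)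
qed

lemma comm_group_H1c: "Par \<subseteq> carrier SL2Z \<Longrightarrow> comm_group (H1c Par k)"
  unfolding H1c_def by (intro comm_group_quotient add_subgroup_Z1c add_subgroup_B1c B1c_subset_Z1c)

lemma carrier_H1c: "carrier (H1c Par k) = coset (B1c Par k) ` Z1c Par k"
  by (simp add: H1c_def carrier_quotient)

lemma one_H1c: "\<one>\<^bsub>H1c Par k\<^esub> = coset (B1c Par k) 0"
  by (simp add: H1c_def)

lemma mult_H1c:
  assumes "Par \<subseteq> carrier SL2Z" "\<alpha> \<in> Z1c Par k" "\<beta> \<in> Z1c Par k"
  shows "coset (B1c Par k) \<alpha> \<otimes>\<^bsub>H1c Par k\<^esub> coset (B1c Par k) \<beta> = coset (B1c Par k) (\<alpha> + \<beta>)"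
  unfolding H1c_def using assms by (intro mult_quotient add_subgroup_Z1c add_subgroup_B1c B1c_subset_Z1c)

lemma H1scale_closed: "w \<in> carrier (H1c Par k) \<Longrightarrow> H1scale Par k c w \<in> carrier (H1c Par k)"
  by (auto simp: carrier_H1c H1scale_coset cscale_Z1c)

lemma carrier_target:
  assumes "Par \<subseteq> carrier SL2Z"
  shows "carrier (target Par k r s) = {\<lambda>z. H1scale Par k (Eis r s z) w | w. w \<in> carrier (H1c Par k)}"
  unfolding target_def
proof (rule carrier_tensor_line[OF comm_group_H1c[OF assms] H1scale_closed])
  fix c d w w'
  assume "w \<in> carrier (H1c Par k)"
  then obtain \<alpha> where \<alpha>: "\<alpha> \<in> Z1c Par k" "w = coset (B1c Par k) \<alpha>" by (auto simp: carrier_H1c)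
  show "H1scale Par k c (H1scale Par k d w) = H1scale Par k (d * c) w"
    by (simp add: \<alpha> H1scale_coset cscale_cscale)
  assume "w' \<in> carrier (H1c Par k)"
  then obtain \<beta> where \<beta>: "\<beta> \<in> Z1c Par k" "w' = coset (B1c Par k) \<beta>" by (auto simp: carrier_H1c)
  show "H1scale Par k c (w \<otimes>\<^bsub>H1c Par k\<^esub> w') = H1scale Par k c w \<otimes>\<^bsub>H1c Par k\<^esub> H1scale Par k c w'"
    by (simp add: \<alpha> \<beta> mult_H1c[OF assms] cscale_Z1c H1scale_coset cscale_add)
qed

lemma carrier_target_cocycles:
  assumes "Par \<subseteq> carrier SL2Z"
  shows "carrier (target Par k r s) = {\<lambda>z. coset (B1c Par k) (cscale (Eis r s z) \<alpha>) | \<alpha>. \<alpha> \<in> Z1c Par k}"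
proof -
  have "{\<lambda>z. H1scale Par k (Eis r s z) w | w. w \<in> carrier (H1c Par k)} =
      {\<lambda>z. H1scale Par k (Eis r s z) (coset (B1c Par k) \<alpha>) | \<alpha>. \<alpha> \<in> Z1c Par k}"
    unfolding carrier_H1c by blast
  thus ?thesis by (simp only: carrier_target[OF assms] H1scale_coset)
qed

text \<open>The zeros of a cocycle form a subgroup, so a cocycle is determined by its values on generators.\<close>
lemma cocycle_inverse_zero:
  assumes "\<alpha> \<in> Z1c Par k" "A \<in> carrier SL2Z" "\<alpha> A = 0" "B \<in> carrier SL2Z" "B ** A = mat 1"
  shows "\<alpha> B = 0"
proof -
  interpret group SL2Z by (rule group_SL2Z)
  have AB: "A ** B = mat 1" using inv_comm[of B A] assms by simp
  have P: "\<alpha> B \<in> Ppoly k" "\<alpha> (mat 1) \<in> Ppoly k"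
    using assms(1,4) one_closed by (auto simp: Z1c_def)
  have coc: "\<alpha> (X ** Y) = actP k Y (\<alpha> X) + \<alpha> Y" if "X \<in> carrier SL2Z" "Y \<in> carrier SL2Z" for X Y
    using assms(1) that by (simp add: Z1c_def)
  have "\<alpha> (mat 1) = 0" using coc[of "mat 1" "mat 1"] actP_one[OF P(2)] one_closed by simp
  hence "actP k A (\<alpha> B) = 0" using coc[OF assms(4,2)] assms(3,5) by simp
  hence "actP k B (actP k A (\<alpha> B)) = 0" by simp
  hence "actP k (A ** B) (\<alpha> B) = 0" using actP_mult[OF P(1) assms(2,4)] by simp
  thus ?thesis using actP_one[OF P(1)] AB by simp
qed

lemma cocycle_mult_zero:
  assumes "\<alpha> \<in> Z1c Par k" "A \<in> carrier SL2Z" "B \<in> carrier SL2Z" "\<alpha> A = 0" "\<alpha> B = 0"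
  shows "\<alpha> (A ** B) = 0"
  using assms by (simp add: Z1c_def)

lemma cocycle_eq_zero:
  assumes \<alpha>: "\<alpha> \<in> Z1c Par k" and "\<alpha> Tmat = 0" "\<alpha> Smat = 0"
  shows "\<alpha> = 0"
proof
  fix A
  define M where "M = {A \<in> carrier SL2Z. \<alpha> A = 0}"
  have "A \<in> M" if A: "A \<in> carrier SL2Z"
  proof (rule SL2Z_generated[OF A])
    show "M \<subseteq> carrier SL2Z" "Tmat \<in> M" "Smat \<in> M"
      using assms(2,3) Tmat_SL2Z Smat_SL2Z by (auto simp: M_def)
    show "A ** B \<in> M" if "A \<in> M" "B \<in> M" for A B
      using that cocycle_mult_zero[OF \<alpha>, of A B] SL2Z_mult by (simp add: M_def)
    show "B \<in> M" if "A \<in> M" "B \<in> carrier SL2Z" "B ** A = mat 1" for A B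
      using that cocycle_inverse_zero[OF \<alpha>, of A B] by (simp add: M_def)
  qed
  thus "\<alpha> A = 0 A" using \<alpha> by (cases "A \<in> carrier SL2Z") (auto simp: M_def Z1c_def)
qed

text \<open>The parabolic elements generate the group, so a cocycle that vanishes on all of them is zero.\<close>
lemma Z1c_parabolics: "Z1c parabolics k \<subseteq> {0}"
proof
  fix \<alpha> assume \<alpha>: "\<alpha> \<in> Z1c parabolics k"
  define M where "M = {A \<in> carrier SL2Z. \<alpha> A = 0}"
  have "A \<in> M" if A: "A \<in> carrier SL2Z" for A
  proof (rule parabolics_generate[OF A])
    show "M \<subseteq> carrier SL2Z" "parabolics \<subseteq> M"
      using \<alpha> by (auto simp: M_def parabolics_def Z1c_def)
    show "A ** B \<in> M" if "A \<in> M" "B \<in> M" for A B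
      using that cocycle_mult_zero[OF \<alpha>, of A B] SL2Z_mult by (simp add: M_def)
    show "B \<in> M" if "A \<in> M" "B \<in> carrier SL2Z" "B ** A = mat 1" for A B
      using that cocycle_inverse_zero[OF \<alpha>, of A B] by (simp add: M_def)
  qed
  hence "\<alpha> Tmat = 0" "\<alpha> Smat = 0" using Tmat_SL2Z Smat_SL2Z by (auto simp: M_def)
  thus "\<alpha> \<in> {0}" using cocycle_eq_zero[OF \<alpha>] by simp
qed


section \<open>Second-order invariants\<close>

interpretation fs: vector_space "\<lambda>(c::complex) (f::complex \<Rightarrow> complex) z. c * f z"
  by unfold_locales (auto simp: fun_eq_iff algebra_simps)

lemma sum_fun_apply: "(\<Sum>i\<in>I. f i) x = (\<Sum>i\<in>I. f i x)"
  by (induction I rule: infinite_finite_induct) auto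

text \<open>What exactness depends on: the invariance conditions include the one for \<open>T\<close>, and every cocycle in question,
  times the Eisenstein series, is cobounded by a second-order invariant. The latter is the analytic
  ingredient and gives surjectivity.\<close>
locale second_order =
  fixes k r s :: nat and U :: "(complex \<Rightarrow> complex) set" and Par :: "(int^2^2) set" and Xs :: "real set set"
  assumes k2: "k > 2" and Par_SL2Z: "Par \<subseteq> carrier SL2Z" and Tmat_Par: "Tmat \<in> Par"
    and basis: "is_basis (H0R Xs r s) U"
    and cobounding: "\<And>\<alpha>. \<alpha> \<in> Z1c Par k \<Longrightarrow> \<exists>F\<in>Mc2 Xs Par k r s. \<forall>z. \<forall>A\<in>carrier SL2Z.
      actRP k r s A F z - F z = smult (Eis r s z) (\<alpha> A)"
begin

abbreviation "RP \<equiv> carrier (tensorP (Rspace Xs) (Ppoly k))"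
abbreviation "HP \<equiv> carrier (tensorP (H0R Xs r s) (Ppoly k))"
abbreviation "HPc \<equiv> carrier (tensorP (H0R Xs r s) (Pc Par k))"
abbreviation "M \<equiv> Mc2 Xs Par k r s"
abbreviation "Bc \<equiv> B1c Par k"
abbreviation "Z \<equiv> Z1c Par k"

lemma H0R_subset: "H0R Xs r s \<subseteq> Rspace Xs"
  by (auto simp: H0R_def)

lemma RP_iff: "F \<in> RP \<longleftrightarrow> (\<forall>z. F z \<in> Ppoly k) \<and> (\<forall>i. (\<lambda>z. coeff (F z) i) \<in> Rspace Xs)"
  by (rule tensorP_Ppoly_iff[OF fun_subspace_Rspace])

lemma HP_iff: "F \<in> HP \<longleftrightarrow> (\<forall>z. F z \<in> Ppoly k) \<and> (\<forall>i. (\<lambda>z. coeff (F z) i) \<in> H0R Xs r s)"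
  by (rule tensorP_Ppoly_iff[OF fun_subspace_H0R])

lemma HPcD:
  assumes "F \<in> HPc"
  shows "F z \<in> Pc Par k" "F \<in> HP"
proof -
  note * = tensorP_coeff[OF fun_subspace_H0R poly_subspace_Pc assms]
  show "F z \<in> Pc Par k" by (rule *)
  show "F \<in> HP" unfolding HP_iff using * by (auto simp: Pc_def)
qed

lemma add_subgroup_RP: "add_subgroup RP" and add_subgroup_HP: "add_subgroup HP"
  and add_subgroup_HPc: "add_subgroup HPc"
  by (intro add_subgroup_tensorP poly_subspace_Ppoly poly_subspace_Pc)+

lemma RP_D:
  assumes "F \<in> RP"
  shows "F z \<in> Ppoly k" "z \<notin> upper_half \<Longrightarrow> F z = 0"
proof -
  show "F z \<in> Ppoly k" using assms by (simp add: RP_iff)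
  assume "z \<notin> upper_half"
  moreover have "(\<lambda>z. coeff (F z) i) \<in> Rspace Xs" for i using assms by (simp add: RP_iff)
  ultimately have "coeff (F z) i = 0" for i by (simp add: Rspace_def)
  thus "F z = 0" by (simp add: poly_eq_iff)
qed

lemma HP_subset_RP: "HP \<subseteq> RP"
  using H0R_subset unfolding HP_iff RP_iff subset_iff by blast

text \<open>Invariant scalar coefficients absorb the automorphy factor, so only the action on polynomials remains.\<close>
lemma actRP_HP:
  assumes W: "W \<in> HP" and A: "A \<in> carrier SL2Z"
  shows "actRP k r s A W z = actP k A (W z)"
proof (rule poly_eqI)
  fix j
  have inv: "coeff (W (moebius A z)) i / aut_factor r s A z = coeff (W z) i" for i
  proof -
    have "(\<lambda>z. coeff (W z) i) \<in> H0R Xs r s" using W by (simp add: HP_iff)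
    hence "actR r s A (\<lambda>z. coeff (W z) i) = (\<lambda>z. coeff (W z) i)" using A by (simp add: H0R_def)
    thus ?thesis unfolding actR_aut_factor by (rule fun_cong)
  qed
  have "coeff (actRP k r s A W z) j =
      (\<Sum>i\<le>k - 2. coeff (W (moebius A z)) i / aut_factor r s A z * actP_coeff k A i j)"
    by (simp add: actRP_aut_factor coeff_actP sum_divide_distrib)
  thus "coeff (actRP k r s A W z) j = coeff (actP k A (W z)) j"
    by (simp add: inv coeff_actP)
qed

text \<open>The value of \<open>F.(A - 1)\<close> at the point \<open>z\<close>, as a cochain in \<open>A\<close>. For a second-order
  invariant it is a cocycle, described without reference to a basis.\<close>
definition defect :: "(complex \<Rightarrow> complex poly) \<Rightarrow> complex \<Rightarrow> cochain" where
  "defect F z = (\<lambda>A. if A \<in> carrier SL2Z then actRP k r s A F z - F z else 0)"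

lemma M_D:
  assumes "F \<in> M"
  shows "F \<in> RP" "A \<in> carrier SL2Z \<Longrightarrow> (\<lambda>z. defect F z A) \<in> HP" "\<pi> \<in> Par \<Longrightarrow> actRP k r s \<pi> F = F"
  using assms by (auto simp: Mc2_def defect_def fun_diff_def)

lemma M_I:
  assumes "F \<in> RP" "\<And>A. A \<in> carrier SL2Z \<Longrightarrow> (\<lambda>z. defect F z A) \<in> HP" "\<And>\<pi>. \<pi> \<in> Par \<Longrightarrow> actRP k r s \<pi> F = F"
  shows "F \<in> M"
  using assms by (auto simp: Mc2_def defect_def fun_diff_def)

lemma defect_diff: "defect (F - G) z = defect F z - defect G z"
  by (auto simp: defect_def actRP_diff fun_eq_iff)

lemma defect_add: "defect (F + G) z = defect F z + defect G z"
  by (auto simp: defect_def actRP_add fun_eq_iff)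

lemma defect_mult:
  assumes F: "F \<in> M" and A: "A \<in> carrier SL2Z" and B: "B \<in> carrier SL2Z"
  shows "defect F z (A ** B) = actP k B (defect F z A) + defect F z B"
proof -
  define W where "W = (\<lambda>z. defect F z A)"
  have W: "W \<in> HP" unfolding W_def by (rule M_D(2)[OF F A])
  have "actRP k r s A F = W + F" using A by (auto simp: W_def defect_def fun_eq_iff)
  hence "actRP k r s (A ** B) F = actRP k r s B W + actRP k r s B F"
    using actRP_mult[OF RP_D(2)[OF M_D(1)[OF F]] RP_D(1)[OF M_D(1)[OF F]] A B] by (simp add: actRP_add)
  hence "actRP k r s (A ** B) F z = actP k B (W z) + actRP k r s B F z"
    by (simp add: actRP_HP[OF W B])
  thus ?thesis using A B SL2Z_mult[OF A B] by (simp add: defect_def W_def)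
qed

lemma defect_Z1c:
  assumes "F \<in> M"
  shows "defect F z \<in> Z"
  unfolding Z1c_def
proof (intro CollectI conjI ballI allI impI)
  show "A \<notin> carrier SL2Z \<Longrightarrow> defect F z A = 0" for A by (simp add: defect_def)
  show "A \<in> carrier SL2Z \<Longrightarrow> defect F z A \<in> Ppoly k" for A
    using M_D(2)[OF assms, of A] by (simp add: HP_iff)
  show "A \<in> carrier SL2Z \<Longrightarrow> B \<in> carrier SL2Z \<Longrightarrow> defect F z (A ** B) = actP k B (defect F z A) + defect F z B" for A B
    by (rule defect_mult[OF assms])
  show "\<pi> \<in> Par \<Longrightarrow> defect F z \<pi> = 0" for \<pi> using M_D(3)[OF assms] by (simp add: defect_def)
qed

lemma defect_HPc:
  assumes "F \<in> HPc"
  shows "defect F z = coboundary k (F z)"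
  using actRP_HP[OF HPcD(2)[OF assms]] by (auto simp: defect_def coboundary_def)

lemma add_subgroup_M: "add_subgroup M"
  unfolding add_subgroup_def
proof (intro conjI ballI)
  have "0 \<in> RP" "0 \<in> HP" by (rule add_subgroupD[OF add_subgroup_RP] add_subgroupD[OF add_subgroup_HP])+
  moreover have "actRP k r s A 0 = 0" for A by (simp add: actRP_def fun_eq_iff)
  ultimately show "0 \<in> M" by (auto intro!: M_I simp: defect_def zero_fun_def)
  fix F G assume F: "F \<in> M" and G: "G \<in> M"
  show "F - G \<in> M"
  proof (rule M_I)
    show "F - G \<in> RP" by (intro add_subgroupD(2)[OF add_subgroup_RP] M_D F G)
    show "(\<lambda>z. defect (F - G) z A) \<in> HP" if "A \<in> carrier SL2Z" for A
    proof -
      have "(\<lambda>z. defect (F - G) z A) = (\<lambda>z. defect F z A) - (\<lambda>z. defect G z A)" by (simp add: defect_diff fun_eq_iff)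
      thus ?thesis using add_subgroupD(2)[OF add_subgroup_HP M_D(2)[OF F that] M_D(2)[OF G that]] by simp
    qed
    show "actRP k r s \<pi> (F - G) = F - G" if "\<pi> \<in> Par" for \<pi>
      using M_D(3)[OF F that] M_D(3)[OF G that] by (simp add: actRP_diff)
  qed
qed

lemma HPc_subset_M: "HPc \<subseteq> M"
proof
  fix F assume F: "F \<in> HPc"
  note F' = HPcD[OF F]
  show "F \<in> M"
  proof (rule M_I)
    show "F \<in> RP" using F'(2) HP_subset_RP by blast
    fix A assume A: "A \<in> carrier SL2Z"
    have eq: "(\<lambda>z. defect F z A) = (\<lambda>z. actP k A (F z) - F z)"
      using A by (simp add: defect_HPc[OF F] coboundary_def)
    have "(\<lambda>z. coeff (actP k A (F z)) j) \<in> H0R Xs r s" for j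
      unfolding coeff_actP
    proof (rule fun_subspace_sum[OF fun_subspace_H0R])
      fix i
      have "(\<lambda>z. actP_coeff k A i j * coeff (F z) i) \<in> H0R Xs r s"
        using F'(2) fun_subspace_H0R[of Xs r s] by (simp add: HP_iff fun_subspace_def)
      thus "(\<lambda>z. coeff (F z) i * actP_coeff k A i j) \<in> H0R Xs r s" by (simp add: mult.commute)
    qed
    hence "(\<lambda>z. actP k A (F z)) \<in> HP" by (simp add: HP_iff actP_in_Ppoly)
    from add_subgroupD(2)[OF add_subgroup_HP this F'(2)] show "(\<lambda>z. defect F z A) \<in> HP"
      by (simp add: eq fun_diff_def)
  next
    fix \<pi> assume "\<pi> \<in> Par"
    thus "actRP k r s \<pi> F = F"
      using actRP_HP[OF F'(2)] F'(1) Par_SL2Z by (auto simp: Pc_def fun_eq_iff)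
  qed
qed


subsection \<open>The cocycle components\<close>

text \<open>The coefficient of \<open>u\<close> in the expansion of \<open>W\<close> over the basis \<open>U\<close> with polynomial coefficients.\<close>
definition basis_comp :: "(complex \<Rightarrow> complex poly) \<Rightarrow> (complex \<Rightarrow> complex) \<Rightarrow> complex poly" where
  "basis_comp W u = (\<Sum>i\<le>k - 2. monom (fs.representation U (\<lambda>z. coeff (W z) i) u) i)"

lemma coeff_basis_comp:
  "coeff (basis_comp W u) j = (if j \<le> k - 2 then fs.representation U (\<lambda>z. coeff (W z) j) u else 0)"
  by (simp add: basis_comp_def coeff_sum)

lemma basis_comp_Ppoly: "basis_comp W u \<in> Ppoly k"
  by (auto simp: Ppoly_def intro!: degree_le simp: coeff_basis_comp)

lemma indep: "fs.independent U" and span: "fs.span U = H0R Xs r s"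
  using basis by (auto simp: is_basis_def)

lemma basis_comp_support: "finite {u. basis_comp W u \<noteq> 0}" "basis_comp W u \<noteq> 0 \<Longrightarrow> u \<in> U"
proof -
  have "{u. basis_comp W u \<noteq> 0} \<subseteq> (\<Union>i\<le>k - 2. {u. fs.representation U (\<lambda>z. coeff (W z) i) u \<noteq> 0})"
    by (auto simp: poly_eq_iff coeff_basis_comp split: if_splits)
  thus "finite {u. basis_comp W u \<noteq> 0}"
    by (rule finite_subset) (auto intro: fs.finite_representation)
  assume "basis_comp W u \<noteq> 0"
  then obtain i where "fs.representation U (\<lambda>z. coeff (W z) i) u \<noteq> 0"
    by (auto simp: poly_eq_iff coeff_basis_comp split: if_splits)
  thus "u \<in> U" by (rule fs.representation_ne_zero)
qed

lemma basis_comp_expand: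
  assumes W: "W \<in> HP" and T: "finite T" "{u. basis_comp W u \<noteq> 0} \<subseteq> T"
  shows "W z = (\<Sum>u\<in>T. smult (u z) (basis_comp W u))"
proof -
  have "W z = (\<Sum>u | basis_comp W u \<noteq> 0. smult (u z) (basis_comp W u))"
  proof (rule poly_eqI)
    fix j
    let ?v = "\<lambda>z. coeff (W z) j"
    show "coeff (W z) j = coeff (\<Sum>u | basis_comp W u \<noteq> 0. smult (u z) (basis_comp W u)) j"
    proof (cases "j \<le> k - 2")
      case True
      have "?v \<in> fs.span U" using W by (simp add: span HP_iff)
      from fs.sum_nonzero_representation_eq[OF indep this]
      have "?v = (\<Sum>u | fs.representation U ?v u \<noteq> 0. (\<lambda>z. fs.representation U ?v u * u z))" by simp
      hence "?v z = (\<Sum>u | fs.representation U ?v u \<noteq> 0. (\<lambda>z. fs.representation U ?v u * u z)) z"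
        by (rule fun_cong)
      also have "\<dots> = (\<Sum>u | fs.representation U ?v u \<noteq> 0. fs.representation U ?v u * u z)"
        by (simp add: sum_fun_apply)
      also have "\<dots> = (\<Sum>u | basis_comp W u \<noteq> 0. fs.representation U ?v u * u z)"
        using True basis_comp_support(1)[of W]
        by (intro sum.mono_neutral_left) (auto simp: poly_eq_iff coeff_basis_comp)
      finally show ?thesis using True by (simp add: coeff_sum coeff_basis_comp mult.commute)
    next
      case False
      have "W z \<in> Ppoly k" using W by (simp add: HP_iff)
      thus ?thesis using False by (simp add: coeff_sum coeff_basis_comp Ppoly_def coeff_eq_0)
    qed
  qed
  also have "\<dots> = (\<Sum>u\<in>T. smult (u z) (basis_comp W u))"
    using T by (intro sum.mono_neutral_left) auto
  finally show ?thesis .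
qed

lemma basis_comp_unique:
  assumes W: "W \<in> HP" and T: "finite T" "T \<subseteq> U" and eq: "\<And>z. W z = (\<Sum>u\<in>T. smult (u z) (q u))"
    and q: "\<And>u. q u \<in> Ppoly k" "\<And>u. u \<notin> T \<Longrightarrow> q u = 0"
  shows "basis_comp W u = q u"
proof (rule poly_eqI)
  fix j
  show "coeff (basis_comp W u) j = coeff (q u) j"
  proof (cases "j \<le> k - 2")
    case True
    let ?v = "\<lambda>z. coeff (W z) j"
    have sub: "{u. coeff (q u) j \<noteq> 0} \<subseteq> T" using q(2) by force
    have "fs.representation U ?v = (\<lambda>u. coeff (q u) j)"
    proof (rule fs.representation_eqI[OF indep])
      show "?v \<in> fs.span U" using W by (simp add: span HP_iff)
      show "coeff (q b) j \<noteq> 0 \<Longrightarrow> b \<in> U" for b using sub T by blast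
      show "finite {b. coeff (q b) j \<noteq> 0}" by (rule finite_subset[OF sub T(1)])
      have "(\<Sum>b | coeff (q b) j \<noteq> 0. coeff (q b) j * b z) = ?v z" for z
      proof -
        have "?v z = (\<Sum>u\<in>T. coeff (q u) j * u z)" by (simp add: eq coeff_sum mult.commute)
        also have "\<dots> = (\<Sum>b | coeff (q b) j \<noteq> 0. coeff (q b) j * b z)"
          using T(1) sub by (intro sum.mono_neutral_right) auto
        finally show ?thesis ..
      qed
      thus "(\<Sum>b | coeff (q b) j \<noteq> 0. (\<lambda>z. coeff (q b) j * b z)) = ?v"
        by (simp add: fun_eq_iff sum_fun_apply)
    qed
    thus ?thesis using True by (simp add: coeff_basis_comp)
  next
    case False
    thus ?thesis using q(1)[of u] by (simp add: coeff_basis_comp Ppoly_def coeff_eq_0)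
  qed
qed

definition psi :: "(complex \<Rightarrow> complex poly) \<Rightarrow> (complex \<Rightarrow> complex) \<Rightarrow> cochain" where
  "psi F u = (\<lambda>A. if A \<in> carrier SL2Z then basis_comp (\<lambda>z. defect F z A) u else 0)"

lemma psi_Z1c:
  assumes F: "F \<in> M"
  shows "psi F u \<in> Z"
  unfolding Z1c_def
proof (intro CollectI conjI ballI allI impI)
  show "A \<notin> carrier SL2Z \<Longrightarrow> psi F u A = 0" for A by (simp add: psi_def)
  show "A \<in> carrier SL2Z \<Longrightarrow> psi F u A \<in> Ppoly k" for A by (simp add: psi_def basis_comp_Ppoly)
  show "psi F u \<pi> = 0" if "\<pi> \<in> Par" for \<pi>
  proof -
    have "defect F z \<pi> = 0" for z using M_D(3)[OF F that] by (simp add: defect_def)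
    hence "basis_comp (\<lambda>z. defect F z \<pi>) u = 0"
      using add_subgroupD(1)[OF add_subgroup_HP]
      by (intro basis_comp_unique[of _ "{}" "\<lambda>_. 0"]) (auto simp: Ppoly_def zero_fun_def)
    thus ?thesis by (simp add: psi_def)
  qed
  fix A B assume A: "A \<in> carrier SL2Z" and B: "B \<in> carrier SL2Z"
  note AB = SL2Z_mult[OF A B]
  let ?T = "{u. basis_comp (\<lambda>z. defect F z A) u \<noteq> 0} \<union> {u. basis_comp (\<lambda>z. defect F z B) u \<noteq> 0}"
  have fin: "finite ?T" using basis_comp_support by blast
  have "basis_comp (\<lambda>z. defect F z (A ** B)) u = actP k B (basis_comp (\<lambda>z. defect F z A) u) + basis_comp (\<lambda>z. defect F z B) u"
  proof (rule basis_comp_unique[OF M_D(2)[OF F AB] fin])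
    show "?T \<subseteq> U" using basis_comp_support(2) by blast
    show "u \<notin> ?T \<Longrightarrow> actP k B (basis_comp (\<lambda>z. defect F z A) u) + basis_comp (\<lambda>z. defect F z B) u = 0" for u by simp
    show "actP k B (basis_comp (\<lambda>z. defect F z A) u) + basis_comp (\<lambda>z. defect F z B) u \<in> Ppoly k" for u
      using poly_subspace_Ppoly[of k] by (intro add_subgroupD(4) actP_in_Ppoly basis_comp_Ppoly) (simp add: poly_subspace_def)
    fix z
    have sum: "actP k B (\<Sum>u\<in>T. f u) = (\<Sum>u\<in>T. actP k B (f u))" for f :: "(complex \<Rightarrow> complex) \<Rightarrow> complex poly" and T
      by (induction T rule: infinite_finite_induct) (auto simp: actP_add)
    have "defect F z A = (\<Sum>u\<in>?T. smult (u z) (basis_comp (\<lambda>z. defect F z A) u))"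
      by (rule basis_comp_expand[OF M_D(2)[OF F A] fin]) blast
    moreover have "defect F z B = (\<Sum>u\<in>?T. smult (u z) (basis_comp (\<lambda>z. defect F z B) u))"
      by (rule basis_comp_expand[OF M_D(2)[OF F B] fin]) blast
    ultimately have "defect F z (A ** B) = actP k B (\<Sum>u\<in>?T. smult (u z) (basis_comp (\<lambda>z. defect F z A) u)) +
        (\<Sum>u\<in>?T. smult (u z) (basis_comp (\<lambda>z. defect F z B) u))"
      using defect_mult[OF F A B, of z] by simp
    thus "defect F z (A ** B) = (\<Sum>u\<in>?T. smult (u z) (actP k B (basis_comp (\<lambda>z. defect F z A) u) + basis_comp (\<lambda>z. defect F z B) u))"
      by (simp only: sum actP_smult smult_add_right sum.distrib)
  qed
  thus "psi F u (A ** B) = actP k B (psi F u A) + psi F u B" using A B AB by (simp add: psi_def)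
qed

text \<open>For a single matrix finitely many basis elements occur. The cocycle \<open>psi F u\<close> vanishes if it does so at \<open>S\<close> and
  \<open>T\<close>, so finitely many suffice for all matrices at once.\<close>
lemma psi_support:
  assumes "F \<in> M"
  shows "finite {u. psi F u \<noteq> 0}" "{u. psi F u \<noteq> 0} \<subseteq> U"
proof -
  have "{u. psi F u \<noteq> 0} \<subseteq> {u. basis_comp (\<lambda>z. defect F z Tmat) u \<noteq> 0} \<union> {u. basis_comp (\<lambda>z. defect F z Smat) u \<noteq> 0}"
  proof
    fix u assume "u \<in> {u. psi F u \<noteq> 0}"
    hence "psi F u Tmat \<noteq> 0 \<or> psi F u Smat \<noteq> 0" using cocycle_eq_zero[OF psi_Z1c[OF assms]] by blast
    thus "u \<in> {u. basis_comp (\<lambda>z. defect F z Tmat) u \<noteq> 0} \<union> {u. basis_comp (\<lambda>z. defect F z Smat) u \<noteq> 0}"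
      by (auto simp: psi_def Tmat_SL2Z Smat_SL2Z)
  qed
  moreover have "finite ({u. basis_comp (\<lambda>z. defect F z Tmat) u \<noteq> 0} \<union> {u. basis_comp (\<lambda>z. defect F z Smat) u \<noteq> 0})"
    using basis_comp_support by blast
  ultimately show "finite {u. psi F u \<noteq> 0}" by (rule finite_subset)
  show "{u. psi F u \<noteq> 0} \<subseteq> U"
  proof
    fix u assume "u \<in> {u. psi F u \<noteq> 0}"
    then obtain A where "psi F u A \<noteq> 0" by (auto simp: fun_eq_iff)
    thus "u \<in> U" using basis_comp_support(2) by (auto simp: psi_def split: if_splits)
  qed
qed

lemma psi_expand:
  assumes F: "F \<in> M"
  shows "defect F z A = (\<Sum>u | psi F u \<noteq> 0. smult (u z) (psi F u A))"
proof (cases "A \<in> carrier SL2Z")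
  case True
  have "defect F z A = (\<Sum>u | psi F u \<noteq> 0. smult (u z) (basis_comp (\<lambda>z. defect F z A) u))"
    by (rule basis_comp_expand[OF M_D(2)[OF F True] psi_support(1)[OF F]]) (use True in \<open>auto simp: psi_def fun_eq_iff\<close>)
  thus ?thesis using True by (simp add: psi_def)
qed (simp add: defect_def psi_def)

text \<open>Linear independence of the basis makes the family of components unique. It exists because the components
  inherit the cocycle relation and only finitely many are nonzero.\<close>
lemma psi_comp_eq:
  assumes F: "F \<in> M"
  shows "psi_comp U Par k r s F = psi F"
  unfolding psi_comp_def
proof (rule the_equality)
  have "\<forall>A\<in>carrier SL2Z. actRP k r s A F - F = (\<lambda>z. \<Sum>u | psi F u \<noteq> 0. smult (u z) (psi F u A))"
  proof
    fix A assume A: "A \<in> carrier SL2Z"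
    show "actRP k r s A F - F = (\<lambda>z. \<Sum>u | psi F u \<noteq> 0. smult (u z) (psi F u A))"
      unfolding psi_expand[OF F, symmetric] using A by (simp add: defect_def fun_diff_def)
  qed
  thus "finite {u. psi F u \<noteq> 0} \<and> {u. psi F u \<noteq> 0} \<subseteq> U \<and> (\<forall>u\<in>U. psi F u \<in> Z) \<and>
    (\<forall>A\<in>carrier SL2Z. actRP k r s A F - F = (\<lambda>z. \<Sum>u | psi F u \<noteq> 0. smult (u z) (psi F u A)))"
    using psi_support[OF F] psi_Z1c[OF F] by blast
next
  fix \<psi> assume \<psi>: "finite {u. \<psi> u \<noteq> 0} \<and> {u. \<psi> u \<noteq> 0} \<subseteq> U \<and> (\<forall>u\<in>U. \<psi> u \<in> Z) \<and>
    (\<forall>A\<in>carrier SL2Z. actRP k r s A F - F = (\<lambda>z. \<Sum>u | \<psi> u \<noteq> 0. smult (u z) (\<psi> u A)))"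
  have Z: "\<psi> u \<in> Z" for u
    using \<psi> add_subgroupD(1)[OF add_subgroup_Z1c] by (cases "\<psi> u = 0") auto
  show "\<psi> = psi F"
  proof (intro ext)
    fix u A
    show "\<psi> u A = psi F u A"
    proof (cases "A \<in> carrier SL2Z")
      case True
      have "basis_comp (\<lambda>z. defect F z A) u = \<psi> u A"
      proof (rule basis_comp_unique[OF M_D(2)[OF F True]])
        show "finite {u. \<psi> u \<noteq> 0}" "{u. \<psi> u \<noteq> 0} \<subseteq> U" using \<psi> by blast+
        show "\<psi> u A \<in> Ppoly k" for u using Z[of u] True by (simp add: Z1c_def)
        show "u \<notin> {u. \<psi> u \<noteq> 0} \<Longrightarrow> \<psi> u A = 0" for u by simp
        fix z
        have "actRP k r s A F - F = (\<lambda>z. \<Sum>u | \<psi> u \<noteq> 0. smult (u z) (\<psi> u A))" using \<psi> True by blast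
        from fun_cong[OF this, of z] show "defect F z A = (\<Sum>u | \<psi> u \<noteq> 0. smult (u z) (\<psi> u A))"
          using True by (simp add: defect_def)
      qed
      thus ?thesis using True by (simp add: psi_def)
    next
      case False
      thus ?thesis using Z[of u] by (simp add: psi_def Z1c_def)
    qed
  qed
qed

text \<open>Summing the components over the basis restores \<open>F.(A - 1)\<close>; the basis disappears from the argument.\<close>
lemma psi_cocycle_eq: "F \<in> M \<Longrightarrow> psi_cocycle U Par k r s F z = defect F z"
  by (rule ext) (simp add: psi_cocycle_def psi_comp_eq sum_fun_apply cscale_def psi_expand)

lemma psi_class_eq: "F \<in> M \<Longrightarrow> psi_class U Par k r s F = (\<lambda>z. coset Bc (defect F z))"
  by (simp add: psi_class_def psi_cocycle_eq r_coset_addgrp)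


subsection \<open>Exactness\<close>

abbreviation "Q \<equiv> Mquot Xs Par k r s"
abbreviation "pbar \<equiv> psi_bar U Par k r s"

lemma carrier_Q: "carrier Q = coset HPc ` M"
  by (simp add: Mquot_def carrier_quotient)

lemma mult_Q: "F \<in> M \<Longrightarrow> G \<in> M \<Longrightarrow> coset HPc F \<otimes>\<^bsub>Q\<^esub> coset HPc G = coset HPc (F + G)"
  unfolding Mquot_def by (rule mult_quotient[OF add_subgroup_M add_subgroup_HPc HPc_subset_M])

lemma group_Q: "group Q"
  unfolding Mquot_def
  using comm_group_quotient[OF add_subgroup_M add_subgroup_HPc HPc_subset_M] by (rule comm_group.axioms(2))

lemma iota_bar_eq: "iota_bar Xs Par k r s F = coset HPc F"
  by (simp add: iota_bar_def r_coset_addgrp)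

text \<open>Adding \<open>N\<close> in \<open>H\<^sup>0 \<otimes> P\<^sup>c\<close> changes the cocycle at \<open>z\<close> by the coboundary of \<open>N z\<close>.\<close>
lemma pbar_coset:
  assumes F: "F \<in> M"
  shows "pbar (coset HPc F) = (\<lambda>z. coset Bc (defect F z))"
proof -
  have "psi_class U Par k r s G = (\<lambda>z. coset Bc (defect F z))" if G: "G \<in> coset HPc F" for G
  proof -
    obtain N where N: "N \<in> HPc" "G = N + F" using G by (auto simp: coset_def)
    have "G \<in> M" using add_subgroupD(4)[OF add_subgroup_M] N F HPc_subset_M by blast
    moreover have "defect G z - defect F z \<in> Bc" for z
      using coboundary_in_B1c[OF HPcD(1)[OF N(1)]] by (simp add: N(2) defect_add defect_HPc[OF N(1)])
    ultimately show ?thesis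
      unfolding psi_class_eq[OF \<open>G \<in> M\<close>] by (intro ext) (simp add: coset_eq_iff[OF add_subgroup_B1c])
  qed
  hence "psi_class U Par k r s ` coset HPc F = (\<lambda>G z. coset Bc (defect F z)) ` coset HPc F"
    by (intro image_cong refl)
  also have "\<dots> = {\<lambda>z. coset Bc (defect F z)}" using mem_coset[OF add_subgroup_HPc, of F] by blast
  finally show ?thesis by (simp add: psi_bar_def)
qed

lemma H0RP_iff: "F \<in> H0RP Xs k r s \<longleftrightarrow> F \<in> RP \<and> (\<forall>z. defect F z = 0)"
proof -
  have "(\<forall>A\<in>carrier SL2Z. actRP k r s A F = F) \<longleftrightarrow> (\<forall>z. defect F z = 0)"
    by (auto simp: defect_def fun_eq_iff)
  thus ?thesis by (simp add: H0RP_def)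
qed

lemma H0RP_subset_M: "H0RP Xs k r s \<subseteq> M"
proof
  fix F assume F0: "F \<in> H0RP Xs k r s"
  hence F: "F \<in> RP" "\<And>z. defect F z = 0" by (auto simp: H0RP_iff)
  have inv: "actRP k r s A F = F" if "A \<in> carrier SL2Z" for A using F0 that by (simp add: H0RP_def)
  show "F \<in> M"
    using F inv add_subgroupD(1)[OF add_subgroup_HP] Par_SL2Z by (intro M_I) (auto simp: zero_fun_def)
qed

lemma add_subgroup_H0RP: "add_subgroup (H0RP Xs k r s)"
  using add_subgroup_RP by (auto simp: add_subgroup_def H0RP_iff defect_diff) (auto simp: defect_def actRP_def)

text \<open>For such an element the polynomial at each point is fixed by the whole group, hence zero.\<close>
lemma H0RP_HPc_zero:
  assumes "F \<in> H0RP Xs k r s" "F \<in> HPc"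
  shows "F = 0"
proof
  fix z
  have "coboundary k (F z) = 0" using assms by (simp add: H0RP_iff flip: defect_HPc)
  hence "actP k A (F z) = F z" if "A \<in> carrier SL2Z" for A
    using that by (auto simp: coboundary_def fun_eq_iff split: if_splits)
  moreover have "F z \<in> Ppoly k" using HPcD(2)[OF assms(2)] by (simp add: HP_iff)
  ultimately show "F z = 0 z" using actP_invariant_zero[OF k2] by simp
qed

text \<open>If \<open>F.(A - 1)\<close> is at each \<open>z\<close> the coboundary of a polynomial fixed by \<open>Par\<close>, this polynomial is a constant
  \<open>c(z)\<close>, because \<open>T\<close> belongs to \<open>Par\<close>. Its coboundary at \<open>S\<close> is \<open>c(z) (X\<^sup>k\<^sup>-\<^sup>2 - 1)\<close>, so \<open>- c\<close> is a coefficient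
  of \<open>F.(S - 1)\<close> and hence belongs to \<^const>\<open>H0R\<close>. Subtracting \<open>c\<close> makes \<open>F\<close> invariant.\<close>
lemma kernel_correction:
  assumes F: "F \<in> M" and defect: "\<And>z. defect F z \<in> Bc"
  obtains G where "G \<in> HPc" "F - G \<in> H0RP Xs k r s"
proof -
  define c where "c = (\<lambda>z. - coeff (defect F z Smat) 0)"
  define G where "G = (\<lambda>z. [:c z:])"
  have G: "G z \<in> Pc Par k \<and> defect F z = coboundary k (G z)" for z
  proof -
    obtain p where p: "p \<in> Pc Par k" "defect F z = coboundary k p" by (rule B1cE[OF defect Par_SL2Z])
    obtain d where d: "p = [:d:]"
      using actP_Tmat_invariant_constant[of p k] p(1) Tmat_Par by (auto simp: Pc_def)
    have "defect F z Smat = monom d (k - 2) - [:d:]"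
      by (simp add: p(2) d coboundary_def Smat_SL2Z actP_Smat_constant)
    hence "c z = d" using k2 by (simp add: c_def)
    thus ?thesis using p d by (simp add: G_def)
  qed
  have "G \<in> HPc"
  proof (cases "\<forall>z. c z = 0")
    case True
    hence "G = 0" by (auto simp: G_def fun_eq_iff)
    thus ?thesis using add_subgroupD(1)[OF add_subgroup_HPc] by simp
  next
    case False
    then obtain z0 where z0: "c z0 \<noteq> 0" by blast
    \<comment> \<open>A nonzero value of \<open>c\<close> shows that constants lie in \<open>Pc\<close>, so that \<open>G = c \<otimes> 1\<close> is a pure tensor.\<close>
    have "smult (1 / c z0) (G z0) \<in> Pc Par k"
      using G[of z0] poly_subspace_Pc[of Par k] by (simp add: poly_subspace_def)
    hence one: "[:1:] \<in> Pc Par k" using z0 by (simp add: G_def)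
    have "(\<lambda>z. coeff (defect F z Smat) 0) \<in> H0R Xs r s"
      using M_D(2)[OF F Smat_SL2Z] by (simp add: HP_iff)
    from fun_subspace_uminus[OF fun_subspace_H0R this]
    have "c \<in> H0R Xs r s" by (simp add: c_def fun_Compl_def)
    hence "(\<lambda>z. smult (c z) [:1:]) \<in> HPc"
      by (rule pure_tensor_in) (use one poly_subspace_Pc[of Par k] in \<open>auto simp: poly_subspace_def\<close>)
    thus ?thesis by (simp add: G_def)
  qed
  moreover have "F - G \<in> H0RP Xs k r s"
    using F \<open>G \<in> HPc\<close> HPc_subset_M add_subgroupD(2)[OF add_subgroup_M] G M_D(1)
    by (auto simp: H0RP_iff defect_diff defect_HPc)
  ultimately show ?thesis by (rule that)
qed

abbreviation "Tg \<equiv> target Par k r s"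
abbreviation "Mt \<equiv> Mc2_tilde U Xs Par k r s"

lemma group_target: "group Tg"
  unfolding target_def by (rule group_tensor[OF comm_group_H1c[OF Par_SL2Z]])

lemma carrier_Mt: "carrier Mt = {K \<in> carrier Q. pbar K \<in> carrier Tg}"
  by (simp add: Mc2_tilde_def)

lemma mult_target_pbar:
  assumes "F \<in> M" "G \<in> M"
  shows "pbar (coset HPc F) \<otimes>\<^bsub>Tg\<^esub> pbar (coset HPc G) = pbar (coset HPc F \<otimes>\<^bsub>Q\<^esub> coset HPc G)"
  using assms add_subgroupD(4)[OF add_subgroup_M]
  by (simp add: pbar_coset mult_Q target_def mult_tensor mult_H1c[OF Par_SL2Z defect_Z1c defect_Z1c] defect_add)

lemma one_target: "\<one>\<^bsub>Tg\<^esub> = (\<lambda>z. coset Bc 0)"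
  by (simp add: target_def one_tensor one_H1c)

abbreviation "PG \<equiv> product_group UNIV (\<lambda>_::complex. H1c Par k)"

lemma group_PG: "group PG"
  by (rule group_product_UNIV[OF comm_group_H1c[OF Par_SL2Z]])

lemma subgroup_target: "subgroup (carrier Tg) PG"
  unfolding target_def tensor_def by (rule group.subgroup_subgroup_generated[OF group_PG])

lemma pbar_hom: "group_hom Q PG pbar"
proof -
  have "pbar K \<in> carrier PG" if "K \<in> carrier Q" for K
    using that defect_Z1c by (auto simp: carrier_Q pbar_coset carrier_H1c)
  moreover have "pbar (K \<otimes>\<^bsub>Q\<^esub> L) = pbar K \<otimes>\<^bsub>PG\<^esub> pbar L" if "K \<in> carrier Q" "L \<in> carrier Q" for K L
    using that mult_target_pbar by (auto simp: carrier_Q target_def mult_tensor)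
  ultimately show ?thesis
    using group_Q group_PG by (auto simp: group_hom_def group_hom_axioms_def hom_def)
qed

lemma subgroup_Mt: "subgroup (carrier Mt) Q"
proof -
  interpret group_hom Q PG pbar by (rule pbar_hom)
  interpret T: subgroup "carrier Tg" PG by (rule subgroup_target)
  show ?thesis
  proof (rule G.subgroupI)
    show "carrier Mt \<subseteq> carrier Q" by (auto simp: carrier_Mt)
    have "\<one>\<^bsub>Q\<^esub> \<in> carrier Mt" using T.one_closed hom_one by (simp add: carrier_Mt)
    thus "carrier Mt \<noteq> {}" by blast
    fix K assume "K \<in> carrier Mt"
    hence K: "K \<in> carrier Q" "pbar K \<in> carrier Tg" by (auto simp: carrier_Mt)
    show "inv\<^bsub>Q\<^esub> K \<in> carrier Mt"
      using G.inv_closed[OF K(1)] hom_inv[OF K(1)] T.m_inv_closed[OF K(2)] by (simp add: carrier_Mt)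
    fix L assume "L \<in> carrier Mt"
    hence L: "L \<in> carrier Q" "pbar L \<in> carrier Tg" by (auto simp: carrier_Mt)
    show "K \<otimes>\<^bsub>Q\<^esub> L \<in> carrier Mt"
      using G.m_closed[OF K(1) L(1)] hom_mult[OF K(1) L(1)] T.m_closed[OF K(2) L(2)]
      by (simp only: carrier_Mt mem_Collect_eq)
  qed
qed

lemma group_Mt: "group Mt"
proof -
  have "Mt = Q\<lparr>carrier := carrier Mt\<rparr>" by (simp add: Mc2_tilde_def)
  thus ?thesis using group.subgroup_imp_group[OF group_Q subgroup_Mt] by simp
qed

theorem sequence_exact:
  "short_exact (addgrp (H0RP Xs k r s)) (iota_bar Xs Par k r s) Mt pbar Tg"
  unfolding short_exact_def
proof (intro conjI)
  have mult_Mt: "K \<otimes>\<^bsub>Mt\<^esub> L = K \<otimes>\<^bsub>Q\<^esub> L" for K L by (simp add: Mc2_tilde_def)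
  interpret Tg: group Tg by (rule group_target)
  have iota_closed: "coset HPc F \<in> carrier Mt \<and> pbar (coset HPc F) = \<one>\<^bsub>Tg\<^esub>" if F: "F \<in> H0RP Xs k r s" for F
  proof -
    have "F \<in> M" using F H0RP_subset_M by blast
    moreover from this have "pbar (coset HPc F) = \<one>\<^bsub>Tg\<^esub>"
      using F by (simp add: pbar_coset one_target H0RP_iff)
    ultimately show ?thesis by (simp add: carrier_Mt carrier_Q)
  qed
  show "group_hom (addgrp (H0RP Xs k r s)) Mt (iota_bar Xs Par k r s)"
    using H0RP_subset_M iota_closed
    by (auto simp: group_hom_def group_hom_axioms_def hom_def group_Mt group_addgrp[OF add_subgroup_H0RP]
        iota_bar_eq mult_Mt mult_Q subset_iff)
  have hom: "pbar (K \<otimes>\<^bsub>Q\<^esub> L) = pbar K \<otimes>\<^bsub>Tg\<^esub> pbar L" if "K \<in> carrier Mt" "L \<in> carrier Mt" for K L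
    using that mult_target_pbar by (auto simp: carrier_Mt carrier_Q)
  show "group_hom Mt Tg pbar"
    using hom by (auto simp: group_hom_def group_hom_axioms_def hom_def group_Mt group_target carrier_Mt mult_Mt)
  show "inj_on (iota_bar Xs Par k r s) (carrier (addgrp (H0RP Xs k r s)))"
  proof (rule inj_onI)
    fix F G assume "F \<in> carrier (addgrp (H0RP Xs k r s))" "G \<in> carrier (addgrp (H0RP Xs k r s))"
      and eq: "iota_bar Xs Par k r s F = iota_bar Xs Par k r s G"
    hence "F - G \<in> H0RP Xs k r s" using add_subgroupD(2)[OF add_subgroup_H0RP] by simp
    moreover have "F - G \<in> HPc" using eq by (simp add: iota_bar_eq coset_eq_iff[OF add_subgroup_HPc])
    ultimately show "F = G" using H0RP_HPc_zero[of "F - G"] by simp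
  qed
  show "iota_bar Xs Par k r s ` carrier (addgrp (H0RP Xs k r s)) = kernel Mt Tg pbar"
  proof (intro equalityI subsetI)
    fix K assume "K \<in> iota_bar Xs Par k r s ` carrier (addgrp (H0RP Xs k r s))"
    thus "K \<in> kernel Mt Tg pbar" using iota_closed by (auto simp: kernel_def iota_bar_eq)
  next
    fix K assume "K \<in> kernel Mt Tg pbar"
    then obtain F where F: "F \<in> M" "K = coset HPc F" "pbar K = \<one>\<^bsub>Tg\<^esub>"
      by (auto simp: kernel_def carrier_Mt carrier_Q)
    have "coset Bc (defect F z) = coset Bc 0" for z
      using fun_cong[OF F(3), of z] F(1,2) by (simp add: pbar_coset one_target)
    hence "defect F z \<in> Bc" for z by (simp add: coset_eq_iff[OF add_subgroup_B1c] del: coset_0)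
    then obtain G where G: "G \<in> HPc" "F - G \<in> H0RP Xs k r s" by (rule kernel_correction[OF F(1)])
    have "(F - G) - F \<in> HPc" using add_subgroupD(3)[OF add_subgroup_HPc G(1)] by simp
    hence "K = iota_bar Xs Par k r s (F - G)"
      unfolding F(2) iota_bar_eq using coset_eq_iff[OF add_subgroup_HPc] by blast
    thus "K \<in> iota_bar Xs Par k r s ` carrier (addgrp (H0RP Xs k r s))" using G(2) by simp
  qed
  show "pbar ` carrier Mt = carrier Tg"
  proof (intro equalityI subsetI)
    fix w assume "w \<in> pbar ` carrier Mt"
    thus "w \<in> carrier Tg" by (auto simp: carrier_Mt)
  next
    fix w assume w: "w \<in> carrier Tg"
    then obtain \<alpha> where \<alpha>: "\<alpha> \<in> Z" "w = (\<lambda>z. coset Bc (cscale (Eis r s z) \<alpha>))"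
      by (auto simp: carrier_target_cocycles[OF Par_SL2Z])
    obtain F where F: "F \<in> M" "\<And>z A. A \<in> carrier SL2Z \<Longrightarrow> actRP k r s A F z - F z = smult (Eis r s z) (\<alpha> A)"
      using cobounding[OF \<alpha>(1)] by blast
    have "defect F z = cscale (Eis r s z) \<alpha>" for z
      using F(2) \<alpha>(1) by (auto simp: defect_def cscale_def Z1c_def)
    hence "pbar (coset HPc F) = w" using F(1) \<alpha>(2) by (simp add: pbar_coset)
    thus "w \<in> pbar ` carrier Mt" using F(1) w by (force simp: carrier_Mt carrier_Q)
  qed
qed (rule group_addgrp[OF add_subgroup_H0RP] | rule group_Mt | rule group_target)?

end


section \<open>Existence of cobounding second-order invariants\<close>

lemma zero_in_Mc2: "(\<lambda>z. 0) \<in> Mc2 Xs Par k r s"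
proof -
  have "actRP k r s A (\<lambda>z. 0) = (\<lambda>z. 0)" for A by (simp add: actRP_def)
  moreover have "0 \<in> carrier (tensorP V (Ppoly k))" for V
    by (rule add_subgroupD(1)[OF add_subgroup_tensorP[OF poly_subspace_Ppoly]])
  ultimately show ?thesis by (simp add: Mc2_def zero_fun_def fun_diff_def)
qed

lemma poincare_poly_in_Mc2:
  assumes k: "even k" "k > 2" and par: "even r \<longleftrightarrow> even s" and rs: "r + s > k"
    and \<alpha>: "\<alpha> \<in> Z1c Bgrp k"
  shows "poincare_poly k r s \<alpha> \<in> Mc2 {X. bounded X} Bgrp k r s"
proof -
  let ?F = "poincare_poly k r s \<alpha>"
  have "degree (?F z) \<le> k - 2" for z
    unfolding poincare_poly_def by (rule degree_sum_le) (auto intro: order_trans[OF degree_monom_le])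
  hence F: "?F \<in> carrier (tensorP (Rspace {X. bounded X}) (Ppoly k))"
    unfolding tensorP_Ppoly_iff[OF fun_subspace_Rspace]
    using coeff_poincare_poly_in_Rspace[OF k par rs \<alpha>] by (simp add: Ppoly_def)
  have eq: "actRP k r s A ?F - ?F = (\<lambda>z. smult (Eis r s z) (\<alpha> A))" if "A \<in> carrier SL2Z" for A
    using poincare_poly_cobounds[OF k par rs \<alpha> that] by (simp add: fun_eq_iff)
  have "Eis r s \<in> H0R {X. bounded X} r s" using Eis_in_H0R[OF par] k rs by simp
  hence "(\<lambda>z. smult (Eis r s z) (\<alpha> A)) \<in> carrier (tensorP (H0R {X. bounded X} r s) (Ppoly k))"
    if "A \<in> carrier SL2Z" for A
    using \<alpha> that poly_subspace_Ppoly[of k]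
    by (intro pure_tensor_in) (auto simp: Z1c_def poly_subspace_def)
  moreover have "actRP k r s \<pi> ?F = ?F" if \<pi>: "\<pi> \<in> Bgrp" for \<pi>
  proof -
    have "\<alpha> \<pi> = 0" "\<pi> \<in> carrier SL2Z" using \<alpha> \<pi> by (auto simp: Z1c_def Bgrp_iff)
    hence "actRP k r s \<pi> ?F - ?F = 0" using eq[of \<pi>] by (simp add: zero_fun_def)
    thus ?thesis by simp
  qed
  ultimately show ?thesis using F eq by (simp add: Mc2_def)
qed

text \<open>If all parabolic elements are imposed, the only cocycle is zero and is cobounded by zero; for the
  stabiliser of the cusp the Poincare series cobounds.\<close>
lemma second_orderI:
  assumes k: "even k" "k > 2" and par: "even r \<longleftrightarrow> even s" and rs: "r + s > k"
    and U: "is_basis (H0R Xs r s) U"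
    and cases: "(Par = parabolics \<and> Xs = {UNIV}) \<or> (Par = Bgrp \<and> Xs = {X. bounded X})"
  shows "second_order k r s U Par Xs"
proof
  show "k > 2" "is_basis (H0R Xs r s) U" by fact+
  show "Par \<subseteq> carrier SL2Z" "Tmat \<in> Par"
    using cases Tmat_parabolic Tmat_Bgrp by (auto simp: parabolics_def Bgrp_iff)
  fix \<alpha> assume \<alpha>: "\<alpha> \<in> Z1c Par k"
  show "\<exists>F\<in>Mc2 Xs Par k r s. \<forall>z. \<forall>A\<in>carrier SL2Z. actRP k r s A F z - F z = smult (Eis r s z) (\<alpha> A)"
    using cases
  proof
    assume "Par = parabolics \<and> Xs = {UNIV}"
    hence "\<alpha> = 0" using \<alpha> Z1c_parabolics by blast
    thus ?thesis by (intro bexI[OF _ zero_in_Mc2]) (simp add: actRP_def)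
  next
    assume "Par = Bgrp \<and> Xs = {X. bounded X}"
    thus ?thesis using \<alpha> poincare_poly_in_Mc2[OF k par rs] poincare_poly_cobounds[OF k par rs] by blast
  qed
qed


section \<open>Transport along the Eichler-Shimura isomorphism\<close>

lemma fun_subspace_cusp_forms: "fun_subspace (cusp_forms k)"
  unfolding fun_subspace_def
proof (intro conjI ballI allI)
  show "0 \<in> cusp_forms k" by (simp add: cusp_forms_def zero_fun_def)
  fix f g assume "f \<in> cusp_forms k" "g \<in> cusp_forms k"
  thus "f + g \<in> cusp_forms k"
    using tendsto_add[of f 0 "filtercomap Im at_top" g 0]
    by (auto simp: cusp_forms_def plus_fun_def distrib_left intro: holomorphic_on_add)
next
  fix c f assume "f \<in> cusp_forms k"
  thus "(\<lambda>z. c * f z) \<in> cusp_forms k"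
    using tendsto_mult_left[of f 0 "filtercomap Im at_top" c]
    by (auto simp: cusp_forms_def intro: holomorphic_on_mult)
qed

lemma fun_subspace_conj_cusp_forms: "fun_subspace (conj_cusp_forms k)"
proof -
  have "\<exists>f\<in>cusp_forms k. (\<lambda>z. cnj (g z)) + (\<lambda>z. cnj (h z)) = (\<lambda>z. cnj (f z))"
    if "g \<in> cusp_forms k" "h \<in> cusp_forms k" for g h
    using fun_subspace_cusp_forms[of k] that by (intro bexI[of _ "g + h"]) (auto simp: fun_subspace_def fun_eq_iff)
  moreover have "\<exists>f\<in>cusp_forms k. (\<lambda>z. c * cnj (g z)) = (\<lambda>z. cnj (f z))"
    if "g \<in> cusp_forms k" for c g
    using fun_subspace_cusp_forms[of k] that
    by (intro bexI[of _ "\<lambda>z. cnj c * g z"]) (auto simp: fun_subspace_def fun_eq_iff)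
  moreover have "\<exists>f\<in>cusp_forms k. 0 = (\<lambda>z. cnj (f z))"
    using fun_subspace_cusp_forms[of k] by (intro bexI[of _ 0]) (auto simp: fun_subspace_def fun_eq_iff)
  ultimately show ?thesis
    unfolding fun_subspace_def conj_cusp_forms_def image_iff by blast
qed

lemma add_subgroup_Times: "add_subgroup A \<Longrightarrow> add_subgroup B \<Longrightarrow> add_subgroup (A \<times> B)"
  by (auto simp: add_subgroup_def zero_prod_def)

lemma add_subgroup_SSbar: "add_subgroup (cusp_forms k \<times> conj_cusp_forms k)"
  by (intro add_subgroup_Times add_subgroup_fun_subspace fun_subspace_cusp_forms fun_subspace_conj_cusp_forms)

lemma comm_group_SSbar: "comm_group (SSbar k)"
  unfolding SSbar_def by (rule comm_group_addgrp[OF add_subgroup_SSbar])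

lemma carrier_tensor_SSbar:
  "carrier (tensor SSscale (Mtilde_line r s) (SSbar k)) = {\<lambda>z. SSscale (Eis r s z) w | w. w \<in> carrier (SSbar k)}"
proof (rule carrier_tensor_line[OF comm_group_SSbar])
  show "SSscale c w \<in> carrier (SSbar k)" if "w \<in> carrier (SSbar k)" for c w
    using that fun_subspace_cusp_forms[of k] fun_subspace_conj_cusp_forms[of k]
    by (auto simp: SSbar_def SSscale_def fun_subspace_def)
  fix c d w w'
  show "SSscale c (w \<otimes>\<^bsub>SSbar k\<^esub> w') = SSscale c w \<otimes>\<^bsub>SSbar k\<^esub> SSscale c w'"
    unfolding SSbar_def mult_addgrp
    by (cases w; cases w') (simp add: SSscale_def fun_eq_iff distrib_left)
  show "SSscale c (SSscale d w) = SSscale (d * c) w"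
    by (cases w) (simp only: SSscale_def case_prod_conv Pair_inject fun_eq_iff mult.assoc mult.left_commute simp_thms)
qed

text \<open>Applied pointwise, a linear isomorphism of the second factors identifies the two tensor products.\<close>
lemma Eichler_Shimura_tensor_iso:
  assumes Par: "Par \<subseteq> carrier SL2Z" and ES: "linear_iso (H1scale Par k) (H1c Par k) SSscale (SSbar k) ES"
  shows "(\<lambda>w z. ES (w z)) \<in> iso (target Par k r s) (tensor SSscale (Mtilde_line r s) (SSbar k))"
proof -
  have hom: "ES \<in> hom (H1c Par k) (SSbar k)" and bij: "bij_betw ES (carrier (H1c Par k)) (carrier (SSbar k))"
    and lin: "\<And>c v. v \<in> carrier (H1c Par k) \<Longrightarrow> ES (H1scale Par k c v) = SSscale c (ES v)"
    using ES by (auto simp: linear_iso_def iso_def)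
  let ?h = "\<lambda>w z. ES (w z)" and ?T = "target Par k r s" and ?S = "tensor SSscale (Mtilde_line r s) (SSbar k)"
  have ran: "w z \<in> carrier (H1c Par k)" if "w \<in> carrier ?T" for w z
    using that H1scale_closed by (auto simp: carrier_target[OF Par])
  have img: "?h ` carrier ?T = carrier ?S"
  proof -
    have "?h ` carrier ?T = (\<lambda>v z. ES (H1scale Par k (Eis r s z) v)) ` carrier (H1c Par k)"
      unfolding carrier_target[OF Par] by (simp only: Setcompr_eq_image image_image)
    also have "\<dots> = (\<lambda>v z. SSscale (Eis r s z) (ES v)) ` carrier (H1c Par k)"
      by (intro image_cong refl) (simp add: lin)
    also have "\<dots> = (\<lambda>w z. SSscale (Eis r s z) w) ` (ES ` carrier (H1c Par k))"
      by (simp add: image_image)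
    also have "\<dots> = carrier ?S"
      unfolding bij_betw_imp_surj_on[OF bij] carrier_tensor_SSbar by blast
    finally show ?thesis .
  qed
  have "inj_on ?h (carrier ?T)"
  proof (rule inj_onI, rule ext)
    fix v w z assume v: "v \<in> carrier ?T" and w: "w \<in> carrier ?T" and eq: "(\<lambda>z. ES (v z)) = (\<lambda>z. ES (w z))"
    show "v z = w z"
      using inj_onD[OF bij_betw_imp_inj_on[OF bij] fun_cong[OF eq, of z]] ran[OF v] ran[OF w] by blast
  qed
  moreover have "?h \<in> hom ?T ?S"
    using img hom ran by (auto simp: hom_def target_def mult_tensor)
  ultimately show ?thesis using img by (simp add: iso_def bij_betw_def)
qed

theorem theorem3p8:
  fixes k r s :: nat and U :: "(complex \<Rightarrow> complex) set"
    and Par :: "(int^2^2) set" and Xs :: "real set set"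
  assumes "even k" and "k > 2"
    and "r > 0" and "s > 0" and "even r \<longleftrightarrow> even s" and "r + s \<ge> 4"
    and "r + s > k"
    and "is_basis (H0R Xs r s) U"
    and "(Par = parabolics \<and> Xs = {UNIV}) \<or> (Par = Bgrp \<and> Xs = {X. bounded X})"
  shows "short_exact
           (addgrp (H0RP Xs k r s)) (iota_bar Xs Par k r s)
           (Mc2_tilde U Xs Par k r s) (psi_bar U Par k r s)
           (target Par k r s)
    \<and> (\<forall>ES. linear_iso (H1scale Par k) (H1c Par k) SSscale (SSbar k) ES \<longrightarrow>
         short_exact
           (addgrp (H0RP Xs k r s)) (iota_bar Xs Par k r s)
           (Mc2_tilde U Xs Par k r s) (\<lambda>K z. ES (psi_bar U Par k r s K z))
           (tensor SSscale (Mtilde_line r s) (SSbar k)))"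
proof (intro conjI allI impI)
  interpret second_order k r s U Par Xs
    by (rule second_orderI[OF assms(1,2,5,7,8,9)])
  show "short_exact (addgrp (H0RP Xs k r s)) (iota_bar Xs Par k r s)
     (Mc2_tilde U Xs Par k r s) (psi_bar U Par k r s) (target Par k r s)"
    by (rule sequence_exact)
  fix ES assume "linear_iso (H1scale Par k) (H1c Par k) SSscale (SSbar k) ES"
  thus "short_exact (addgrp (H0RP Xs k r s)) (iota_bar Xs Par k r s)
     (Mc2_tilde U Xs Par k r s) (\<lambda>K z. ES (psi_bar U Par k r s K z))
     (tensor SSscale (Mtilde_line r s) (SSbar k))"
    by (rule short_exact_iso[OF sequence_exact Eichler_Shimura_tensor_iso[OF Par_SL2Z]
          group_tensor[OF comm_group_SSbar]])
qed

end
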